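(* Let $M$ be a presymplectic manifold with the closed 2-form $\sigma$, and let $N$ be an embedded submanifold of $M$. Then $N$ is totally Dirac (as a submanifold of the Dirac manifold $(M,D_\sigma)$) if and only if it has a normal bundle $\nu N$ which is an isotropic submanifold of $(TM,\sigma^C)$.
   Context: Everything is $C^\infty$, and the Einstein summation convention is used. A presymplectic form is a closed 2-form (of not necessarily constant rank). For a manifold $M$ put $E(M)=TM\oplus T^*M$, with the metric $g((X,\alpha),(Y,\beta))=\frac12(\alpha(Y)+\beta(X))$ and the 2-form $\omega((X,\alpha),(Y,\beta))=\frac12(\alpha(Y)-\beta(X))$. A Dirac structure on $M$ is a maximal $g$-isotropic subbundle $D\subseteq E(M)$ such that $\Gamma D$ is closed under the Courant bracket $[(X,\alpha),(Y,\beta)]=([X,Y],L_X\beta-L_Y\alpha+d(\omega((X,\alpha),(Y,\beta))))$. A presymplectic form $\sigma$ defines the Dirac structure $D_\sigma=\{(X,i(X)\sigma)\,/\,X\in TM\}$. Complete lift: let $x^i$ be local coordinates on $M$ and $v^i$ the natural fiber coordinates on $TM$. For a 2-form $\sigma=\frac12\sigma_{ij}dx^i\wedge dx^j$ on $M$, the complete lift is the 2-form on the manifold $TM$ $$\sigma^C=\frac12 v^k\frac{\partial\sigma_{ij}}{\partial x^k}dx^i\wedge dx^j+\sigma_{ij}dx^i\wedge dv^j,$$ which is closed if $\sigma$ is closed. A normal bundle of $N$ is a vector subbundle $\nu N$ of $T_NM=TM|_N$ with $T_NM=\nu N\oplus TN$; its total space is regarded as a submanifold of the manifold $TM$. The decomposition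 identifies $T^*N$ with $\mathrm{ann}\,\nu N$ and $\nu^*N$ with $\mathrm{ann}\,TN$ ($\mathrm{ann}$ = annihilator). A submanifold $Q$ of a Dirac manifold $(W,D')$ is isotropic if the conditions $X\in TQ$ and $(X,\alpha)\in D'$ imply $\alpha\in\mathrm{ann}\,TQ$. For a presymplectic manifold $(W,\sigma')$ (with $D'=D_{\sigma'}$) this is the classical condition $TQ\subseteq T^{\perp_{\sigma'}}Q$. Let $(M,D)$ be a Dirac manifold. $N$ is properly normalizable by the normal bundle $\nu N$ if $$(X,\alpha)\in D|_N\ \Rightarrow\ (pr_{TN}X,pr_{T^*N}\alpha)\in D|_N,$$ with projections defined by $T_NM=\nu N\oplus TN$; then $(N,\nu N)$ is a properly normalized submanifold. Its second fundamental form associates to $(X,\alpha),(Y,\beta)\in D|_N\cap(TN\oplus T^*N)$ the 1-form $B((X,\alpha),(Y,\beta))\in\nu^*N$ defined on $Z\in\nu N$ by $$B((X,\alpha),(Y,\beta))(Z)=Z(\tilde\alpha(\tilde Y))-\alpha([\tilde Z,\tilde Y])+\beta([\tilde Z,\tilde X]),$$ where $\tilde Z,(\tilde X,\tilde\alpha),(\tilde Y,\tilde\beta)$ extend $Z,(X,\alpha),(Y,\beta)$ from $N$ to $M$ and $(\tilde X,\tilde\alpha),(\tilde Y,\tilde\beta)\in\Gamma D$; the result is independent of the choice of the extensions. $N$ is a totally Dirac submanifold of $(M,D)$ if it is properly normalizable by a certain normal bundle $\nu N$ and the second fundamental form of $(N,\nu N)$ is zero. *)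

theory Defs
  imports "HOL-Analysis.Analysis"
begin

section \<open>Smooth maps between open subsets of Euclidean spaces\<close>

text \<open>\<^verbatim>\<open>Ck_on k S f\<close> and \<^verbatim>\<open>smooth_on S f\<close> are meant for open \<^verbatim>\<open>S\<close> and a Euclidean domain only.\<close>

primrec Ck_on :: "nat \<Rightarrow> 'e::euclidean_space set \<Rightarrow> ('e \<Rightarrow> 'f::real_normed_vector) \<Rightarrow> bool" where
  "Ck_on 0 S f \<longleftrightarrow> continuous_on S f"
| "Ck_on (Suc k) S f \<longleftrightarrow>
     (\<forall>x\<in>S. f differentiable (at x)) \<and> (\<forall>v. Ck_on k S (\<lambda>x. frechet_derivative f (at x) v))"

definition smooth_on :: "'e::euclidean_space set \<Rightarrow> ('e \<Rightarrow> 'f::real_normed_vector) \<Rightarrow> bool" where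
  "smooth_on S f \<longleftrightarrow> (\<forall>k. Ck_on k S f)"

section \<open>Smooth manifolds\<close>

text \<open>
  A chart is a pair of its domain and its coordinate map; the values of the map outside the domain
  are irrelevant. A manifold is given by a smooth atlas: the underlying set is the union of the
  chart domains and the topology is the one that makes every chart a homeomorphism onto an open
  set. The dimension of the manifold is that of the model space \<^verbatim>\<open>'e\<close>.
\<close>

type_synonym ('a, 'e) chart = "'a set \<times> ('a \<Rightarrow> 'e)"

abbreviation chart_inv :: "('a, 'e) chart \<Rightarrow> 'e \<Rightarrow> 'a" where
  "chart_inv c \<equiv> inv_into (fst c) (snd c)"

abbreviation chart_image :: "('a, 'e) chart \<Rightarrow> 'e set" where
  "chart_image c \<equiv> snd c ` fst c"

definition transition :: "('a, 'e) chart \<Rightarrow> ('a, 'e) chart \<Rightarrow> 'e \<Rightarrow> 'e" where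
  "transition c d = snd d \<circ> chart_inv c"

definition compatible :: "('a, 'e::euclidean_space) chart \<Rightarrow> ('a, 'e) chart \<Rightarrow> bool" where
  "compatible c d \<longleftrightarrow>
     open (snd c ` (fst c \<inter> fst d)) \<and> open (snd d ` (fst c \<inter> fst d)) \<and>
     smooth_on (snd c ` (fst c \<inter> fst d)) (transition c d) \<and>
     smooth_on (snd d ` (fst c \<inter> fst d)) (transition d c)"

definition smooth_atlas :: "('a, 'e::euclidean_space) chart set \<Rightarrow> bool" where
  "smooth_atlas A \<longleftrightarrow> (\<forall>c\<in>A. inj_on (snd c) (fst c)) \<and> (\<forall>c\<in>A. \<forall>d\<in>A. compatible c d)"

definition points :: "('a, 'e) chart set \<Rightarrow> 'a set" where
  "points A = (\<Union>c\<in>A. fst c)"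

definition manifold_topology :: "('a, 'e::euclidean_space) chart set \<Rightarrow> 'a topology" where
  "manifold_topology A =
     topology (\<lambda>W. W \<subseteq> points A \<and> (\<forall>c\<in>A. open (snd c ` (W \<inter> fst c))))"

definition smooth_manifold :: "('a, 'e::euclidean_space) chart set \<Rightarrow> bool" where
  "smooth_manifold A \<longleftrightarrow> smooth_atlas A \<and>
     Hausdorff_space (manifold_topology A) \<and> second_countable (manifold_topology A)"

definition maximal_atlas :: "('a, 'e::euclidean_space) chart set \<Rightarrow> ('a, 'e) chart set" where
  "maximal_atlas A =
     {c. fst c \<subseteq> points A \<and> inj_on (snd c) (fst c) \<and> (\<forall>d\<in>A. compatible c d)}"

section \<open>Tangent vectors\<close>

text \<open>
  A tangent vector at \<^verbatim>\<open>p\<close> is represented by its component vector in a fixed, arbitrarily chosen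
  chart \<^verbatim>\<open>preferred_chart A p\<close> at \<^verbatim>\<open>p\<close>. So every tangent space is a copy of \<^verbatim>\<open>'e\<close>, a point of the
  tangent bundle is a pair \<^verbatim>\<open>(p, v)\<close>, and components in other charts are obtained by the usual
  transformation rule. A covector at \<^verbatim>\<open>p\<close> is a linear function \<^verbatim>\<open>'e \<Rightarrow> real\<close>, and a 2-form at \<^verbatim>\<open>p\<close> a
  function \<^verbatim>\<open>'e \<Rightarrow> 'e \<Rightarrow> real\<close>, on tangent vectors so represented.
\<close>

definition preferred_chart :: "('a, 'e) chart set \<Rightarrow> 'a \<Rightarrow> ('a, 'e) chart" where
  "preferred_chart A p = (SOME c. c \<in> A \<and> p \<in> fst c)"

text \<open>The component vector of a tangent vector at \<^verbatim>\<open>p\<close> in the chart \<^verbatim>\<open>c\<close>, and conversely.\<close>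

definition components ::
    "('a, 'e::euclidean_space) chart set \<Rightarrow> ('a, 'e) chart \<Rightarrow> 'a \<Rightarrow> 'e \<Rightarrow> 'e" where
  "components A c p v = frechet_derivative (transition (preferred_chart A p) c)
     (at (snd (preferred_chart A p) p)) v"

definition vector_of_components ::
    "('a, 'e::euclidean_space) chart set \<Rightarrow> ('a, 'e) chart \<Rightarrow> 'a \<Rightarrow> 'e \<Rightarrow> 'e" where
  "vector_of_components A c p u = frechet_derivative (transition c (preferred_chart A p))
     (at (snd c p)) u"

text \<open>The charts \<^verbatim>\<open>(x\<^sup>i, v\<^sup>i)\<close> of the tangent bundle induced by the charts \<^verbatim>\<open>(x\<^sup>i)\<close> of the base.\<close>

definition tangent_chart ::
    "('a, 'e::euclidean_space) chart set \<Rightarrow> ('a, 'e) chart \<Rightarrow> ('a \<times> 'e, 'e \<times> 'e) chart" where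
  "tangent_chart A c = (fst c \<times> UNIV, \<lambda>(p, v). (snd c p, components A c p v))"

definition tangent_bundle ::
    "('a, 'e::euclidean_space) chart set \<Rightarrow> ('a \<times> 'e, 'e \<times> 'e) chart set" where
  "tangent_bundle A = tangent_chart A ` A"

section \<open>Vector fields and differential forms\<close>

text \<open>Local expressions, as functions on the image of the chart \<^verbatim>\<open>c\<close>.\<close>

definition vector_field_coeff ::
    "('a, 'e::euclidean_space) chart set \<Rightarrow> ('a \<Rightarrow> 'e) \<Rightarrow> ('a, 'e) chart \<Rightarrow> 'e \<Rightarrow> 'e" where
  "vector_field_coeff A X c x = components A c (chart_inv c x) (X (chart_inv c x))"

definition one_form_coeff ::
    "('a, 'e::euclidean_space) chart set \<Rightarrow> ('a \<Rightarrow> 'e \<Rightarrow> real) \<Rightarrow> ('a, 'e) chart \<Rightarrow> 'e \<Rightarrow> 'e \<Rightarrow> real"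
  where
  "one_form_coeff A \<alpha> c x u =
     \<alpha> (chart_inv c x) (vector_of_components A c (chart_inv c x) u)"

definition two_form_coeff ::
    "('a, 'e::euclidean_space) chart set \<Rightarrow> ('a \<Rightarrow> 'e \<Rightarrow> 'e \<Rightarrow> real) \<Rightarrow> ('a, 'e) chart
      \<Rightarrow> 'e \<Rightarrow> 'e \<Rightarrow> 'e \<Rightarrow> real" where
  "two_form_coeff A \<sigma> c x u w =
     \<sigma> (chart_inv c x) (vector_of_components A c (chart_inv c x) u)
                       (vector_of_components A c (chart_inv c x) w)"

definition vector_field_on ::
    "('a, 'e::euclidean_space) chart set \<Rightarrow> 'a set \<Rightarrow> ('a \<Rightarrow> 'e) \<Rightarrow> bool" where
  "vector_field_on A W X \<longleftrightarrow>
     (\<forall>c\<in>A. smooth_on (snd c ` (W \<inter> fst c)) (vector_field_coeff A X c))"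

definition one_form :: "('a, 'e::euclidean_space) chart set \<Rightarrow> ('a \<Rightarrow> 'e \<Rightarrow> real) \<Rightarrow> bool" where
  "one_form A \<alpha> \<longleftrightarrow> (\<forall>p\<in>points A. linear (\<alpha> p)) \<and>
     (\<forall>c\<in>A. \<forall>u. smooth_on (chart_image c) (\<lambda>x. one_form_coeff A \<alpha> c x u))"

definition two_form :: "('a, 'e::euclidean_space) chart set \<Rightarrow> ('a \<Rightarrow> 'e \<Rightarrow> 'e \<Rightarrow> real) \<Rightarrow> bool" where
  "two_form A \<sigma> \<longleftrightarrow>
     (\<forall>p\<in>points A. bilinear (\<sigma> p) \<and> (\<forall>u w. \<sigma> p u w = - \<sigma> p w u)) \<and>
     (\<forall>c\<in>A. \<forall>u w. smooth_on (chart_image c) (\<lambda>x. two_form_coeff A \<sigma> c x u w))"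

text \<open>The exterior derivative of a 2-form at \<^verbatim>\<open>x\<close> in the chart \<^verbatim>\<open>c\<close>, on constant vectors \<^verbatim>\<open>u, v, w\<close>.\<close>

definition ext_deriv_coeff ::
    "('a, 'e::euclidean_space) chart set \<Rightarrow> ('a \<Rightarrow> 'e \<Rightarrow> 'e \<Rightarrow> real) \<Rightarrow> ('a, 'e) chart
      \<Rightarrow> 'e \<Rightarrow> 'e \<Rightarrow> 'e \<Rightarrow> 'e \<Rightarrow> real" where
  "ext_deriv_coeff A \<sigma> c x u v w =
     frechet_derivative (\<lambda>y. two_form_coeff A \<sigma> c y v w) (at x) u +
     frechet_derivative (\<lambda>y. two_form_coeff A \<sigma> c y w u) (at x) v +
     frechet_derivative (\<lambda>y. two_form_coeff A \<sigma> c y u v) (at x) w"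

definition presymplectic ::
    "('a, 'e::euclidean_space) chart set \<Rightarrow> ('a \<Rightarrow> 'e \<Rightarrow> 'e \<Rightarrow> real) \<Rightarrow> bool" where
  "presymplectic A \<sigma> \<longleftrightarrow> two_form A \<sigma> \<and>
     (\<forall>c\<in>A. \<forall>x\<in>chart_image c. \<forall>u v w. ext_deriv_coeff A \<sigma> c x u v w = 0)"

text \<open>The derivative at \<^verbatim>\<open>p\<close> of the function \<^verbatim>\<open>f\<close> in the direction of the tangent vector \<^verbatim>\<open>v\<close>.\<close>

definition directional_derivative ::
    "('a, 'e::euclidean_space) chart set \<Rightarrow> 'a \<Rightarrow> 'e \<Rightarrow> ('a \<Rightarrow> real) \<Rightarrow> real" where
  "directional_derivative A p v f =
     frechet_derivative (f \<circ> chart_inv (preferred_chart A p)) (at (snd (preferred_chart A p) p)) v"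

text \<open>\<^verbatim>\<open>[X, Y]\<^sup>i = X\<^sup>j \<partial>Y\<^sup>i/\<partial>x\<^sup>j - Y\<^sup>j \<partial>X\<^sup>i/\<partial>x\<^sup>j\<close> in the preferred chart at \<^verbatim>\<open>p\<close>.\<close>

definition lie_bracket ::
    "('a, 'e::euclidean_space) chart set \<Rightarrow> ('a \<Rightarrow> 'e) \<Rightarrow> ('a \<Rightarrow> 'e) \<Rightarrow> 'a \<Rightarrow> 'e" where
  "lie_bracket A X Y p = (let c = preferred_chart A p; x = snd c p in
     frechet_derivative (vector_field_coeff A Y c) (at x) (vector_field_coeff A X c x) -
     frechet_derivative (vector_field_coeff A X c) (at x) (vector_field_coeff A Y c x))"

text \<open>
  The complete lift to the tangent bundle. Evaluating
  \<^verbatim>\<open>(1/2) v\<^sup>k \<partial>\<sigma>\<^sub>i\<^sub>j/\<partial>x\<^sup>k dx\<^sup>i \<and> dx\<^sup>j + \<sigma>\<^sub>i\<^sub>j dx\<^sup>i \<and> dv\<^sup>j\<close>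
  at the point \<^verbatim>\<open>(x, v)\<close> on the vectors \<^verbatim>\<open>(u, a)\<close> and \<^verbatim>\<open>(w, b)\<close> gives
  \<^verbatim>\<open>v\<^sup>k \<partial>\<sigma>\<^sub>i\<^sub>j/\<partial>x\<^sup>k u\<^sup>i w\<^sup>j + \<sigma>\<^sub>i\<^sub>j (u\<^sup>i b\<^sup>j - w\<^sup>i a\<^sup>j)\<close>.
  The formula is used in the preferred chart at \<^verbatim>\<open>p\<close>; the result does not depend on the chart.
\<close>

definition complete_lift ::
    "('a, 'e::euclidean_space) chart set \<Rightarrow> ('a \<Rightarrow> 'e \<Rightarrow> 'e \<Rightarrow> real)
      \<Rightarrow> 'a \<times> 'e \<Rightarrow> 'e \<times> 'e \<Rightarrow> 'e \<times> 'e \<Rightarrow> real" where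
  "complete_lift A \<sigma> \<xi> U V =
     (let c = preferred_chart A (fst \<xi>); Tc = tangent_chart A c;
          (x, v) = snd Tc \<xi>;
          (u, a) = components (tangent_bundle A) Tc \<xi> U;
          (w, b) = components (tangent_bundle A) Tc \<xi> V
      in frechet_derivative (\<lambda>y. two_form_coeff A \<sigma> c y u w) (at x) v
         + two_form_coeff A \<sigma> c x u b - two_form_coeff A \<sigma> c x w a)"

section \<open>Submanifolds and normal bundles\<close>

definition slice_chart ::
    "('a, 'e::euclidean_space) chart set \<Rightarrow> 'a set \<Rightarrow> ('a, 'e) chart \<Rightarrow> 'e set \<Rightarrow> bool" where
  "slice_chart A N c S \<longleftrightarrow>
     c \<in> maximal_atlas A \<and> subspace S \<and> snd c ` (N \<inter> fst c) = chart_image c \<inter> S"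

definition embedded_submanifold :: "('a, 'e::euclidean_space) chart set \<Rightarrow> 'a set \<Rightarrow> bool" where
  "embedded_submanifold A N \<longleftrightarrow> N \<subseteq> points A \<and>
     (\<exists>k. \<forall>p\<in>N. \<exists>c S. slice_chart A N c S \<and> dim S = k \<and> p \<in> fst c)"

definition tangent_space :: "('a, 'e::euclidean_space) chart set \<Rightarrow> 'a set \<Rightarrow> 'a \<Rightarrow> 'e set" where
  "tangent_space A N p =
     {v. \<exists>c S. slice_chart A N c S \<and> p \<in> fst c \<and> components A c p v \<in> S}"

text \<open>
  \<^verbatim>\<open>\<nu> p\<close> is the fibre over \<^verbatim>\<open>p \<in> N\<close>; the values of \<^verbatim>\<open>\<nu>\<close> outside \<^verbatim>\<open>N\<close> are irrelevant. That the fibres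
  form a (smooth) vector bundle is expressed by local frames \<^verbatim>\<open>Z 0, ..., Z (m - 1)\<close>; a smooth
  section along \<^verbatim>\<open>N\<close> is, locally, the restriction of a smooth vector field of the ambient manifold.
\<close>

definition normal_bundle ::
    "('a, 'e::euclidean_space) chart set \<Rightarrow> 'a set \<Rightarrow> ('a \<Rightarrow> 'e set) \<Rightarrow> bool" where
  "normal_bundle A N \<nu> \<longleftrightarrow>
     (\<forall>p\<in>N. subspace (\<nu> p) \<and> \<nu> p \<inter> tangent_space A N p = {0} \<and>
        {z + t | z t. z \<in> \<nu> p \<and> t \<in> tangent_space A N p} = UNIV) \<and>
     (\<forall>p\<in>N. \<exists>W Z m. openin (manifold_topology A) W \<and> p \<in> W \<and>
        (\<forall>i<m::nat. vector_field_on A W (Z i)) \<and>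
        (\<forall>q\<in>N \<inter> W. \<nu> q = span ((\<lambda>i. Z i q) ` {..<m}) \<and> dim (\<nu> q) = m))"

definition total_space :: "'a set \<Rightarrow> ('a \<Rightarrow> 'e set) \<Rightarrow> ('a \<times> 'e) set" where
  "total_space N \<nu> = (SIGMA p:N. \<nu> p)"

definition annihilator :: "'e::real_vector set \<Rightarrow> ('e \<Rightarrow> real) set" where
  "annihilator S = {\<alpha>. linear \<alpha> \<and> (\<forall>x\<in>S. \<alpha> x = 0)}"

text \<open>The projection onto \<^verbatim>\<open>P\<close> along \<^verbatim>\<open>Q\<close>, for a decomposition of a vector space as \<^verbatim>\<open>P \<oplus> Q\<close>.\<close>

definition projection :: "'v::minus set \<Rightarrow> 'v set \<Rightarrow> 'v \<Rightarrow> 'v" where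
  "projection P Q x = (THE y. y \<in> P \<and> x - y \<in> Q)"

section \<open>Submanifolds of Dirac manifolds\<close>

text \<open>
  A Dirac structure enters the following notions only through its fibres
  \<^verbatim>\<open>D p \<subseteq> T\<^sub>pM \<oplus> T\<^sub>p\<^sup>*M\<close>, so they are stated for any such family \<^verbatim>\<open>D\<close>.
\<close>

type_synonym ('a, 'e) dirac_family = "'a \<Rightarrow> ('e \<times> ('e \<Rightarrow> real)) set"

text \<open>\<^verbatim>\<open>\<sigma> p X\<close> is the interior product \<^verbatim>\<open>i(X)\<sigma>\<close>.\<close>

definition dirac_of_form :: "('a \<Rightarrow> 'e \<Rightarrow> 'e \<Rightarrow> real) \<Rightarrow> ('a, 'e) dirac_family" where
  "dirac_of_form \<sigma> p = {(X, \<sigma> p X) | X. True}"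

definition isotropic_submanifold ::
    "('a, 'e::euclidean_space) chart set \<Rightarrow> ('a, 'e) dirac_family \<Rightarrow> 'a set \<Rightarrow> bool" where
  "isotropic_submanifold A D Q \<longleftrightarrow> embedded_submanifold A Q \<and>
     (\<forall>p\<in>Q. \<forall>X \<alpha>. X \<in> tangent_space A Q p \<and> (X, \<alpha>) \<in> D p
        \<longrightarrow> \<alpha> \<in> annihilator (tangent_space A Q p))"

text \<open>Here \<^verbatim>\<open>T\<^sup>*N\<close> is identified with \<^verbatim>\<open>ann \<nu>N\<close>, and its complement \<^verbatim>\<open>\<nu>\<^sup>*N\<close> with \<^verbatim>\<open>ann TN\<close>.\<close>

definition properly_normalized ::
    "('a, 'e::euclidean_space) chart set \<Rightarrow> ('a, 'e) dirac_family \<Rightarrow> 'a set \<Rightarrow> ('a \<Rightarrow> 'e set) \<Rightarrow> bool"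
  where
  "properly_normalized A D N \<nu> \<longleftrightarrow> normal_bundle A N \<nu> \<and>
     (\<forall>p\<in>N. \<forall>X \<alpha>. (X, \<alpha>) \<in> D p \<longrightarrow>
        (projection (tangent_space A N p) (\<nu> p) X,
         projection (annihilator (\<nu> p)) (annihilator (tangent_space A N p)) \<alpha>) \<in> D p)"

text \<open>The intersection of \<^verbatim>\<open>D\<close> with \<^verbatim>\<open>TN \<oplus> T\<^sup>*N\<close> at \<^verbatim>\<open>p\<close>.\<close>

definition tangential_part ::
    "('a, 'e::euclidean_space) chart set \<Rightarrow> ('a, 'e) dirac_family \<Rightarrow> 'a set \<Rightarrow> ('a \<Rightarrow> 'e set)
      \<Rightarrow> 'a \<Rightarrow> ('e \<times> ('e \<Rightarrow> real)) set" where
  "tangential_part A D N \<nu> p = D p \<inter> (tangent_space A N p \<times> annihilator (\<nu> p))"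

text \<open>
  The admissible extensions are the global sections of \<^verbatim>\<open>TM\<close> and of \<^verbatim>\<open>D\<close> whose restrictions to \<^verbatim>\<open>N\<close>
  are sections of \<^verbatim>\<open>\<nu>N\<close> and of \<^verbatim>\<open>D \<inter> (TN \<oplus> T\<^sup>*N)\<close>, with prescribed values at \<^verbatim>\<open>p\<close>.
\<close>

definition normal_extension ::
    "('a, 'e::euclidean_space) chart set \<Rightarrow> 'a set \<Rightarrow> ('a \<Rightarrow> 'e set)
      \<Rightarrow> 'a \<Rightarrow> 'e \<Rightarrow> ('a \<Rightarrow> 'e) \<Rightarrow> bool" where
  "normal_extension A N \<nu> p Z Z' \<longleftrightarrow>
     vector_field_on A (points A) Z' \<and> (\<forall>q\<in>N. Z' q \<in> \<nu> q) \<and> Z' p = Z"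

definition dirac_extension ::
    "('a, 'e::euclidean_space) chart set \<Rightarrow> ('a, 'e) dirac_family \<Rightarrow> 'a set \<Rightarrow> ('a \<Rightarrow> 'e set)
      \<Rightarrow> 'a \<Rightarrow> 'e \<times> ('e \<Rightarrow> real) \<Rightarrow> ('a \<Rightarrow> 'e) \<Rightarrow> ('a \<Rightarrow> 'e \<Rightarrow> real) \<Rightarrow> bool" where
  "dirac_extension A D N \<nu> p \<Phi> X' \<alpha>' \<longleftrightarrow>
     vector_field_on A (points A) X' \<and> one_form A \<alpha>' \<and> (\<forall>q\<in>points A. (X' q, \<alpha>' q) \<in> D q) \<and>
     (\<forall>q\<in>N. (X' q, \<alpha>' q) \<in> tangential_part A D N \<nu> q) \<and> (X' p, \<alpha>' p) = \<Phi>"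

text \<open>
  \<^verbatim>\<open>second_fundamental_form A D N \<nu> p (X, \<alpha>) (Y, \<beta>) Z\<close> is \<^verbatim>\<open>B((X,\<alpha>),(Y,\<beta>))(Z)\<close> at \<^verbatim>\<open>p\<close>, the common
  value of the defining expression for all choices of the extensions.
\<close>

definition second_fundamental_form ::
    "('a, 'e::euclidean_space) chart set \<Rightarrow> ('a, 'e) dirac_family \<Rightarrow> 'a set \<Rightarrow> ('a \<Rightarrow> 'e set)
      \<Rightarrow> 'a \<Rightarrow> 'e \<times> ('e \<Rightarrow> real) \<Rightarrow> 'e \<times> ('e \<Rightarrow> real) \<Rightarrow> 'e \<Rightarrow> real" where
  "second_fundamental_form A D N \<nu> p \<Phi> \<Psi> Z =
     (THE r. \<exists>Z' X' \<alpha>' Y' \<beta>'.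
        normal_extension A N \<nu> p Z Z' \<and>
        dirac_extension A D N \<nu> p \<Phi> X' \<alpha>' \<and> dirac_extension A D N \<nu> p \<Psi> Y' \<beta>' \<and>
        r = directional_derivative A p Z (\<lambda>q. \<alpha>' q (Y' q))
              - snd \<Phi> (lie_bracket A Z' Y' p) + snd \<Psi> (lie_bracket A Z' X' p))"

definition totally_dirac ::
    "('a, 'e::euclidean_space) chart set \<Rightarrow> ('a, 'e) dirac_family \<Rightarrow> 'a set \<Rightarrow> bool" where
  "totally_dirac A D N \<longleftrightarrow> embedded_submanifold A N \<and>
     (\<exists>\<nu>. properly_normalized A D N \<nu> \<and>
        (\<forall>p\<in>N. \<forall>\<Phi>\<in>tangential_part A D N \<nu> p. \<forall>\<Psi>\<in>tangential_part A D N \<nu> p. \<forall>Z\<in>\<nu> p.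
           second_fundamental_form A D N \<nu> p \<Phi> \<Psi> Z = 0))"

end

theory Submission
  imports Defs
begin

text \<open>
  Both conditions on a normal bundle \<open>\<nu>N\<close> amount to \<open>\<sigma>(TN, \<nu>N) = 0\<close>, called \<open>conormal\<close> below, so each
  side of the theorem says that some normal bundle satisfies it.

  On the Dirac side, applying proper normalization to \<open>X \<in> TN\<close> forces \<open>i(X)\<sigma>\<close> into \<open>ann \<nu>N\<close>, and
  conversely \<open>\<sigma>(TN, \<nu>N) = 0\<close> makes \<open>X \<mapsto> i(X)\<sigma>\<close> commute with the projections
  (\<open>properly_normalized_iff\<close>). For such a \<open>\<nu>N\<close> the second fundamental form vanishes by itself: its
  defining expression is \<open>(L\<^sub>Z\<sigma>)(X, Y)\<close>, closedness gives \<open>L\<^sub>Z\<sigma> = d(i(Z)\<sigma>)\<close>, and the pullback to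
  \<open>N\<close> of \<open>i(Z)\<sigma>\<close> is zero for every normal field \<open>Z\<close>. Its value is a definite description over global
  extensions, so extensions with prescribed values have to be constructed as well; this is done with bump
  functions (\<open>cut_off_vector_field\<close>).

  On the side of the tangent bundle, a tangent vector of \<open>\<nu>N\<close> is the lift of a vector of \<open>TN\<close> by a
  normal field plus a vertical vector from \<open>\<nu>N\<close>. On a lift and a vertical vector \<open>\<sigma>\<^sup>C\<close> gives
  \<open>\<sigma>(X, V)\<close>, so isotropy implies \<open>\<sigma>(TN, \<nu>N) = 0\<close>; on two lifts by \<open>Z\<close> it gives
  \<open>(L\<^sub>Z\<sigma>)(X, Y)\<close>, which is zero for the same reason as before.

  The fact shared by both sides is \<open>lie_derivative_vanishes\<close>. It is proved in a chart of \<open>M\<close>, with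
  \<open>N\<close> parametrized by a linear subspace: \<open>\<sigma>(z, d\<phi> t) = 0\<close> is differentiated along \<open>N\<close>, and the symmetry
  of \<open>d\<^sup>2\<phi>\<close> and the closedness of \<open>\<sigma>\<close> do the rest. The tangent spaces of \<open>\<nu>N\<close> are read off from charts
  \<open>(x, w)\<close> of \<open>TM\<close> adapted to a slice chart of \<open>N\<close> and to a frame of \<open>\<nu>N\<close>, in which \<open>\<nu>N\<close>
  is the linear slice \<open>S \<times> S\<^sup>\<bottom>\<close> (\<open>slice_chart_total_space\<close>, \<open>adapted_chart_exists\<close>).
\<close>

section \<open>Calculus of smooth maps on open sets\<close>

declare Ck_on.simps(2) [simp del]

lemma Ck_on_Suc_differentiable: "Ck_on (Suc k) S f \<Longrightarrow> x \<in> S \<Longrightarrow> f differentiable (at x)"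
  by (simp add: Ck_on.simps(2))

lemma Ck_on_Suc_frechet_derivative:
  "Ck_on (Suc k) S f \<Longrightarrow> Ck_on k S (\<lambda>x. frechet_derivative f (at x) v)"
  by (simp add: Ck_on.simps(2))

lemma Ck_on_subset:
  "Ck_on k S f \<Longrightarrow> T \<subseteq> S \<Longrightarrow> Ck_on k T f"
  by (induction k arbitrary: f) (auto simp: Ck_on.simps(2) intro: continuous_on_subset)

lemma Ck_on_cong:
  assumes "Ck_on k S f" "open S" "\<And>x. x \<in> S \<Longrightarrow> f x = g x"
  shows "Ck_on k S g"
  using assms
proof (induction k arbitrary: f g)
  case 0
  then show ?case by (simp cong: continuous_on_cong)
next
  case (Suc k)
  have "frechet_derivative f (at x) = frechet_derivative g (at x)" if "x \<in> S" for x
    using Ck_on_Suc_differentiable[OF Suc.prems(1) that] \<open>open S\<close> that Suc.prems(3)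
    by (rule frechet_derivative_transform_within_open)
  then have "Ck_on k S (\<lambda>x. frechet_derivative g (at x) v)" for v
    by (intro Suc.IH[OF Ck_on_Suc_frechet_derivative[OF Suc.prems(1)] \<open>open S\<close>]) simp
  moreover have "g differentiable (at x)" if "x \<in> S" for x
    using Ck_on_Suc_differentiable[OF Suc.prems(1) that] Suc.prems(2,3) that
    by (meson differentiable_def has_derivative_transform_within_open)
  ultimately show ?case by (simp add: Ck_on.simps(2))
qed

lemma Ck_on_SucD: "Ck_on (Suc k) S f \<Longrightarrow> Ck_on k S f"
proof (induction k arbitrary: f)
  case 0
  then show ?case
    by (simp add: Ck_on_Suc_differentiable differentiable_imp_continuous_on
        differentiable_at_imp_differentiable_on)
next
  case (Suc k)
  have "Ck_on k S (\<lambda>x. frechet_derivative f (at x) v)" for v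
    by (rule Suc.IH[OF Ck_on_Suc_frechet_derivative[OF Suc.prems]])
  moreover have "\<forall>x\<in>S. f differentiable (at x)"
    using Ck_on_Suc_differentiable[OF Suc.prems] by blast
  ultimately show ?case by (simp add: Ck_on.simps(2))
qed

lemma Ck_on_SucI:
  assumes "open S" "\<And>x. x \<in> S \<Longrightarrow> (f has_derivative f' x) (at x)"
    "\<And>v. Ck_on k S (\<lambda>x. f' x v)"
  shows "Ck_on (Suc k) S f"
proof -
  have "Ck_on k S (\<lambda>x. frechet_derivative f (at x) v)" for v
  proof (rule Ck_on_cong[OF assms(3) \<open>open S\<close>])
    show "f' x v = frechet_derivative f (at x) v" if "x \<in> S" for x
      using frechet_derivative_at[OF assms(2)[OF that]] by simp
  qed
  moreover have "f differentiable (at x)" if "x \<in> S" for x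
    using assms(2)[OF that] by (rule differentiableI)
  ultimately show ?thesis
    by (simp add: Ck_on.simps(2))
qed

lemma Ck_on_has_derivative:
  "Ck_on (Suc k) S f \<Longrightarrow> x \<in> S \<Longrightarrow> (f has_derivative frechet_derivative f (at x)) (at x)"
  by (simp add: Ck_on_Suc_differentiable flip: frechet_derivative_works)

lemma Ck_on_const: "Ck_on k S (\<lambda>x. c)"
proof (induction k arbitrary: c)
  case (Suc k)
  show ?case by (simp add: Ck_on.simps(2) Suc.IH)
qed simp

lemma Ck_on_bounded_linear:
  assumes "bounded_linear L" "open S" "Ck_on k S f"
  shows "Ck_on k S (\<lambda>x. L (f x))"
  using assms(3)
proof (induction k arbitrary: f)
  case 0
  then show ?case using assms(1) by (simp add: linear_continuous_on_compose linear_linear bounded_linear.continuous_on)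
next
  case (Suc k)
  show ?case
  proof (rule Ck_on_SucI[OF \<open>open S\<close>])
    show "((\<lambda>x. L (f x)) has_derivative (\<lambda>v. L (frechet_derivative f (at x) v))) (at x)"
      if "x \<in> S" for x
      using bounded_linear.has_derivative[OF assms(1) Ck_on_has_derivative[OF Suc.prems that]] .
    show "Ck_on k S (\<lambda>x. L (frechet_derivative f (at x) v))" for v
      by (rule Suc.IH[OF Ck_on_Suc_frechet_derivative[OF Suc.prems]])
  qed
qed

lemma Ck_on_id: "Ck_on k S (\<lambda>x. x)"
  by (cases k) (auto simp: Ck_on.simps(2) Ck_on_const)

lemma Ck_on_add:
  assumes "open S" "Ck_on k S f" "Ck_on k S g"
  shows "Ck_on k S (\<lambda>x. f x + g x)"
  using assms(2,3)
proof (induction k arbitrary: f g)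
  case 0
  then show ?case by (simp add: continuous_on_add)
next
  case (Suc k)
  show ?case
  proof (rule Ck_on_SucI[OF \<open>open S\<close>])
    show "((\<lambda>x. f x + g x) has_derivative
        (\<lambda>v. frechet_derivative f (at x) v + frechet_derivative g (at x) v)) (at x)"
      if "x \<in> S" for x
      using Suc.prems that by (intro has_derivative_add Ck_on_has_derivative)
    show "Ck_on k S (\<lambda>x. frechet_derivative f (at x) v + frechet_derivative g (at x) v)" for v
      by (intro Suc.IH Ck_on_Suc_frechet_derivative Suc.prems)
  qed
qed

lemma Ck_on_bounded_bilinear:
  assumes "bounded_bilinear B" "open S" "Ck_on k S f" "Ck_on k S g"
  shows "Ck_on k S (\<lambda>x. B (f x) (g x))"
  using assms(3,4)
proof (induction k arbitrary: f g)
  case 0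
  then show ?case using assms(1) by (simp add: bounded_bilinear.continuous_on)
next
  case (Suc k)
  show ?case
  proof (rule Ck_on_SucI[OF \<open>open S\<close>])
    show "((\<lambda>x. B (f x) (g x)) has_derivative
        (\<lambda>v. B (f x) (frechet_derivative g (at x) v) + B (frechet_derivative f (at x) v) (g x))) (at x)"
      if "x \<in> S" for x
      using Suc.prems that
      by (intro bounded_bilinear.FDERIV[OF assms(1)] Ck_on_has_derivative)
    show "Ck_on k S (\<lambda>x. B (f x) (frechet_derivative g (at x) v) + B (frechet_derivative f (at x) v) (g x))" for v
      by (intro Ck_on_add[OF assms(2)] Suc.IH Ck_on_SucD[OF Suc.prems(1)] Ck_on_SucD[OF Suc.prems(2)]
          Ck_on_Suc_frechet_derivative Suc.prems)
  qed
qed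

lemma Ck_on_sum:
  assumes "open S" "\<And>i. i \<in> I \<Longrightarrow> Ck_on k S (f i)"
  shows "Ck_on k S (\<lambda>x. \<Sum>i\<in>I. f i x)"
  using assms(2)
  by (induction I rule: infinite_finite_induct) (auto simp: Ck_on_const intro: Ck_on_add[OF assms(1)])

lemma linear_eq_basis_sum:
  fixes L :: "'e::euclidean_space \<Rightarrow> 'f::real_vector"
  assumes "linear L"
  shows "L v = (\<Sum>b\<in>Basis. (v \<bullet> b) *\<^sub>R L b)"
  by (metis (no_types, lifting) assms euclidean_representation linear_scale linear_sum sum.cong)

text \<open>
  The rule for \<open>L\<^sub>x(g(x))\<close>, obtained by expanding \<open>g(x)\<close> in a basis. It is the form in which products
  occur below: derivatives, frames and 2-forms are families of linear maps with smooth values on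
  constant vectors.
\<close>

lemma Ck_on_linear_family:
  fixes L :: "'d::euclidean_space \<Rightarrow> 'e::euclidean_space \<Rightarrow> 'f::real_normed_vector"
  assumes "open S" "\<And>x. x \<in> S \<Longrightarrow> linear (L x)" "\<And>b. Ck_on k S (\<lambda>x. L x b)" "Ck_on k S g"
  shows "Ck_on k S (\<lambda>x. L x (g x))"
proof (rule Ck_on_cong[OF _ \<open>open S\<close>])
  show "Ck_on k S (\<lambda>x. \<Sum>b\<in>Basis. (g x \<bullet> b) *\<^sub>R L x b)"
    using assms
    by (intro Ck_on_sum Ck_on_bounded_bilinear[OF bounded_bilinear_scaleR]
        Ck_on_bounded_linear[OF bounded_linear_inner_left]) auto
qed (metis assms(2) linear_eq_basis_sum)

lemma Ck_on_compose:
  fixes f :: "'e::euclidean_space \<Rightarrow> 'f::real_normed_vector" and g :: "'d::euclidean_space \<Rightarrow> 'e"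
  assumes "open S" "Ck_on k T f" "Ck_on k S g" "g ` S \<subseteq> T"
  shows "Ck_on k S (\<lambda>x. f (g x))"
  using assms(2,3)
proof (induction k arbitrary: f)
  case 0
  then show ?case using assms(4) continuous_on_compose2 by auto
next
  case (Suc k)
  show ?case
  proof (rule Ck_on_SucI[OF \<open>open S\<close>])
    show "((\<lambda>x. f (g x)) has_derivative
        (\<lambda>v. frechet_derivative f (at (g x)) (frechet_derivative g (at x) v))) (at x)"
      if "x \<in> S" for x
      using has_derivative_compose[OF Ck_on_has_derivative[OF Suc.prems(2) that]
         Ck_on_has_derivative[OF Suc.prems(1)]] that assms(4) by auto
    show "Ck_on k S (\<lambda>x. frechet_derivative f (at (g x)) (frechet_derivative g (at x) v))" for v
    proof (rule Ck_on_linear_family[OF \<open>open S\<close>])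
      show "linear (frechet_derivative f (at (g x)))" if "x \<in> S" for x
        using assms(4) that
        by (auto intro!: linear_frechet_derivative Ck_on_Suc_differentiable[OF Suc.prems(1)])
      show "Ck_on k S (\<lambda>x. frechet_derivative f (at (g x)) b)" for b
        by (intro Suc.IH Ck_on_SucD[OF Suc.prems(2)] Ck_on_Suc_frechet_derivative[OF Suc.prems(1)])
      show "Ck_on k S (\<lambda>x. frechet_derivative g (at x) v)"
        by (rule Ck_on_Suc_frechet_derivative[OF Suc.prems(2)])
    qed
  qed
qed

lemma Ck_on_local:
  assumes "\<And>x. x \<in> S \<Longrightarrow> \<exists>T. open T \<and> x \<in> T \<and> Ck_on k T f"
  shows "Ck_on k S f"
  using assms
proof (induction k arbitrary: f)
  case 0
  have "isCont f x" if "x \<in> S" for x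
    using 0[OF that] by (auto simp: continuous_on_eq_continuous_at)
  then show ?case by (simp add: continuous_at_imp_continuous_on)
next
  case (Suc k)
  have "Ck_on k S (\<lambda>x. frechet_derivative f (at x) v)" for v
  proof (rule Suc.IH)
    fix x assume "x \<in> S"
    then obtain T where "open T" "x \<in> T" "Ck_on (Suc k) T f" using Suc.prems by blast
    then show "\<exists>T. open T \<and> x \<in> T \<and> Ck_on k T (\<lambda>x. frechet_derivative f (at x) v)"
      using Ck_on_Suc_frechet_derivative[of k T f v] by (intro exI[of _ T] conjI)
  qed
  moreover have "f differentiable (at x)" if x: "x \<in> S" for x
  proof -
    obtain T where "x \<in> T" "Ck_on (Suc k) T f" using Suc.prems[OF x] by blast
    then show ?thesis by (rule Ck_on_Suc_differentiable[rotated])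
  qed
  ultimately show ?case by (simp add: Ck_on.simps(2))
qed

lemma smooth_on_subset: "smooth_on S f \<Longrightarrow> T \<subseteq> S \<Longrightarrow> smooth_on T f"
  by (meson Ck_on_subset smooth_on_def)

lemma smooth_on_cong:
  "smooth_on S f \<Longrightarrow> open S \<Longrightarrow> (\<And>x. x \<in> S \<Longrightarrow> f x = g x) \<Longrightarrow> smooth_on S g"
  by (meson Ck_on_cong smooth_on_def)

lemma smooth_on_local:
  "(\<And>x. x \<in> S \<Longrightarrow> \<exists>T. open T \<and> x \<in> T \<and> smooth_on T f) \<Longrightarrow> smooth_on S f"
  unfolding smooth_on_def by (meson Ck_on_local)

lemma smooth_on_const: "smooth_on S (\<lambda>x. c)"
  by (simp add: Ck_on_const smooth_on_def)

lemma smooth_on_id: "smooth_on S (\<lambda>x. x)"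
  by (simp add: Ck_on_id smooth_on_def)

lemma smooth_on_bounded_linear:
  "bounded_linear L \<Longrightarrow> open S \<Longrightarrow> smooth_on S f \<Longrightarrow> smooth_on S (\<lambda>x. L (f x))"
  by (simp add: Ck_on_bounded_linear smooth_on_def)

lemma smooth_on_add:
  "open S \<Longrightarrow> smooth_on S f \<Longrightarrow> smooth_on S g \<Longrightarrow> smooth_on S (\<lambda>x. f x + g x)"
  by (simp add: Ck_on_add smooth_on_def)

lemma smooth_on_diff:
  assumes "open S" "smooth_on S f" "smooth_on S g"
  shows "smooth_on S (\<lambda>x. f x - g x)"
  using smooth_on_add[OF assms(1,2) smooth_on_bounded_linear[OF
      bounded_linear_minus[OF bounded_linear_ident] assms(1,3)]] by simp

lemma smooth_on_sum:
  "open S \<Longrightarrow> (\<And>i. i \<in> I \<Longrightarrow> smooth_on S (f i)) \<Longrightarrow> smooth_on S (\<lambda>x. \<Sum>i\<in>I. f i x)"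
  by (simp add: Ck_on_sum smooth_on_def)

lemma smooth_on_scaleR:
  "open S \<Longrightarrow> smooth_on S f \<Longrightarrow> smooth_on S g \<Longrightarrow> smooth_on S (\<lambda>x. f x *\<^sub>R g x)"
  by (simp add: Ck_on_bounded_bilinear[OF bounded_bilinear_scaleR] smooth_on_def)

lemma smooth_on_compose:
  fixes f :: "'e::euclidean_space \<Rightarrow> 'f::real_normed_vector" and g :: "'d::euclidean_space \<Rightarrow> 'e"
  assumes "open S" "smooth_on T f" "smooth_on S g" "g ` S \<subseteq> T"
  shows "smooth_on S (\<lambda>x. f (g x))"
  using assms by (auto simp: smooth_on_def intro: Ck_on_compose)

lemma smooth_on_linear_family:
  fixes L :: "'d::euclidean_space \<Rightarrow> 'e::euclidean_space \<Rightarrow> 'f::real_normed_vector"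
  assumes "open S" "\<And>x. x \<in> S \<Longrightarrow> linear (L x)" "\<And>b. smooth_on S (\<lambda>x. L x b)" "smooth_on S g"
  shows "smooth_on S (\<lambda>x. L x (g x))"
  using assms by (auto simp: smooth_on_def intro: Ck_on_linear_family)

lemma smooth_on_Pair:
  fixes f :: "'d::euclidean_space \<Rightarrow> 'e::real_normed_vector" and g :: "'d \<Rightarrow> 'f::real_normed_vector"
  assumes "open S" "smooth_on S f" "smooth_on S g"
  shows "smooth_on S (\<lambda>x. (f x, g x))"
proof -
  have "smooth_on S (\<lambda>x. (f x, 0) + (0, g x))"
    by (intro smooth_on_add smooth_on_bounded_linear[of "\<lambda>a. (a, 0)"] smooth_on_bounded_linear[of "\<lambda>a. (0, a)"]
         assms bounded_linear_Pair bounded_linear_ident bounded_linear_zero)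
  then show ?thesis by simp
qed

lemma smooth_on_fst: "open S \<Longrightarrow> smooth_on S f \<Longrightarrow> smooth_on S (\<lambda>x. fst (f x))"
  using bounded_linear_fst by (rule smooth_on_bounded_linear)

lemma smooth_on_snd: "open S \<Longrightarrow> smooth_on S f \<Longrightarrow> smooth_on S (\<lambda>x. snd (f x))"
  using bounded_linear_snd by (rule smooth_on_bounded_linear)

lemma smooth_on_has_derivative:
  "smooth_on S f \<Longrightarrow> x \<in> S \<Longrightarrow> (f has_derivative frechet_derivative f (at x)) (at x)"
  unfolding smooth_on_def by (meson Ck_on_has_derivative)

lemma smooth_on_differentiable:
  "smooth_on S f \<Longrightarrow> x \<in> S \<Longrightarrow> f differentiable (at x)"
  by (meson differentiable_def smooth_on_has_derivative)

lemma smooth_on_continuous_on: "smooth_on S f \<Longrightarrow> continuous_on S f"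
  unfolding smooth_on_def by (metis Ck_on.simps(1))

lemma smooth_on_frechet_derivative:
  "smooth_on S f \<Longrightarrow> smooth_on S (\<lambda>x. frechet_derivative f (at x) v)"
  unfolding smooth_on_def by (intro allI Ck_on_Suc_frechet_derivative) (erule spec)

lemma smooth_on_frechet_derivative_compose:
  fixes f :: "'e::euclidean_space \<Rightarrow> 'f::real_normed_vector" and g :: "'d::euclidean_space \<Rightarrow> 'e"
  assumes "open S" "smooth_on T f" "smooth_on S g" "g ` S \<subseteq> T" "smooth_on S w"
  shows "smooth_on S (\<lambda>x. frechet_derivative f (at (g x)) (w x))"
proof (rule smooth_on_linear_family[OF \<open>open S\<close> _ _ assms(5)])
  show "linear (frechet_derivative f (at (g x)))" if "x \<in> S" for x
    using that assms(4) by (intro linear_frechet_derivative smooth_on_differentiable[OF assms(2)]) auto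
  show "smooth_on S (\<lambda>x. frechet_derivative f (at (g x)) b)" for b
    by (rule smooth_on_compose[OF assms(1) smooth_on_frechet_derivative[OF assms(2)] assms(3,4)])
qed

section \<open>Inverses of smooth families of linear isomorphisms\<close>

text \<open>
  A lower bound for an injective linear map survives a perturbation that is small on a basis. So
  injectivity is an open condition, and inverses are locally bounded.
\<close>

lemma linear_family_bounded_below:
  fixes K :: "'d::euclidean_space \<Rightarrow> 'e::euclidean_space \<Rightarrow> 'f::euclidean_space"
  assumes S: "open S" "y\<^sub>0 \<in> S" and lin: "\<And>y. y \<in> S \<Longrightarrow> linear (K y)"
    and cont: "\<And>w. continuous_on S (\<lambda>y. K y w)" and inj: "inj (K y\<^sub>0)"
  obtains T c where "open T" "y\<^sub>0 \<in> T" "T \<subseteq> S" "c > 0"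
    "\<And>y w. y \<in> T \<Longrightarrow> c * norm w \<le> norm (K y w)"
proof -
  obtain B where B: "B > 0" "\<And>w. B * norm w \<le> norm (K y\<^sub>0 w)"
    using linear_inj_bounded_below_pos[OF lin[OF S(2)] inj] by blast
  define e where "e y = (\<Sum>b\<in>Basis. norm (K y b - K y\<^sub>0 b))" for y
  have e: "norm (K y w - K y\<^sub>0 w) \<le> e y * norm w" if "y \<in> S" for y w
  proof -
    have "K y w - K y\<^sub>0 w = (\<Sum>b\<in>Basis. (w \<bullet> b) *\<^sub>R (K y b - K y\<^sub>0 b))"
      by (subst (1 2) linear_eq_basis_sum[of "K _"])
        (simp_all add: lin that S(2) sum_subtractf scaleR_diff_right)
    also have "norm \<dots> \<le> (\<Sum>b\<in>Basis. norm w * norm (K y b - K y\<^sub>0 b))"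
      by (rule order_trans[OF norm_sum]) (auto intro!: sum_mono mult_right_mono simp: Basis_le_norm)
    finally show ?thesis by (simp add: e_def sum_distrib_left mult.commute)
  qed
  define T where "T = {y\<in>S. e y < B / 2}"
  have "continuous_on S e"
    unfolding e_def by (intro continuous_intros cont)
  then have "open T"
    using continuous_open_preimage[OF _ S(1) open_lessThan[of "B/2"]]
    by (simp add: T_def vimage_def Int_def)
  moreover have "y\<^sub>0 \<in> T" using S B by (simp add: T_def e_def)
  moreover have "B / 2 * norm w \<le> norm (K y w)" if "y \<in> T" for y w
  proof -
    have "norm (K y w - K y\<^sub>0 w) \<le> B / 2 * norm w"
      using e[of y w] that mult_right_mono[of "e y" "B/2" "norm w"] by (auto simp: T_def)
    then show ?thesis
      using B(2)[of w] norm_triangle_ineq2[of "K y\<^sub>0 w" "K y w"] by (simp add: norm_minus_commute)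
  qed
  ultimately show ?thesis using that[of T "B/2"] B(1) by (auto simp: T_def)
qed

lemma linear_two_sided_inverse:
  assumes "linear K" "\<And>w. H (K w) = w" "\<And>w. K (H w) = w"
  shows "linear H"
proof (rule linearI)
  show "H (a + b) = H a + H b" for a b
    using assms(2)[of "H a + H b"] by (simp add: linear_add[OF assms(1)] assms(3))
  show "H (r *\<^sub>R a) = r *\<^sub>R H a" for r a
    using assms(2)[of "r *\<^sub>R H a"] by (simp add: linear_scale[OF assms(1)] assms(3))
qed

text \<open>
  The product rule at a zero of \<open>g\<close>: the term with the derivative of \<open>f\<close> drops out. This computes
  the derivative of an inverse when only the continuity of the inverse is known.
\<close>

lemma has_derivative_scaleR_vanishing:
  fixes g :: "'d::real_normed_vector \<Rightarrow> real" and f :: "'d \<Rightarrow> 'f::real_normed_vector"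
  assumes g: "(g has_derivative g') (at x)" and "g x = 0" and f: "isCont f x"
  shows "((\<lambda>y. g y *\<^sub>R f y) has_derivative (\<lambda>h. g' h *\<^sub>R f x)) (at x)"
proof -
  have bl: "bounded_linear g'" using g by (rule has_derivative_bounded_linear)
  obtain B where B: "\<And>h. norm (g' h) \<le> norm h * B"
    using bounded_linear.bounded[OF bl] by blast
  have g0: "((\<lambda>y. (1 / norm (y - x)) *\<^sub>R (g y - (g x + g' (y - x)))) \<longlongrightarrow> 0) (at x)"
    using g unfolding has_derivative_within by (rule conjunct2)
  have f0: "((\<lambda>y. f y - f x) \<longlongrightarrow> 0) (at x)"
    using f unfolding isCont_def by (rule LIM_zero)
  have 1: "((\<lambda>y. ((1 / norm (y - x)) *\<^sub>R (g y - (g x + g' (y - x)))) *\<^sub>R f y) \<longlongrightarrow> 0 *\<^sub>R f x) (at x)"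
    using f by (intro tendsto_scaleR g0) (simp add: isCont_def)
  have 2: "((\<lambda>y. (1 / norm (y - x) * g' (y - x)) *\<^sub>R (f y - f x)) \<longlongrightarrow> 0) (at x)"
  proof (rule Lim_null_comparison)
    have "norm ((1 / norm (y - x) * g' (y - x)) *\<^sub>R (f y - f x)) \<le> B * norm (f y - f x)"
      if "y \<noteq> x" for y
    proof -
      have "norm (1 / norm (y - x) * g' (y - x)) \<le> B"
        using B[of "y - x"] that by (simp add: abs_mult pos_divide_le_eq mult.commute[of B])
      then show ?thesis unfolding norm_scaleR real_norm_def by (rule mult_right_mono) simp
    qed
    then show "\<forall>\<^sub>F y in at x. norm ((1 / norm (y - x) * g' (y - x)) *\<^sub>R (f y - f x)) \<le> B * norm (f y - f x)"
      by (simp add: eventually_at_filter)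
    show "((\<lambda>y. B * norm (f y - f x)) \<longlongrightarrow> 0) (at x)"
      using tendsto_mult[OF tendsto_const[of B] tendsto_norm[OF f0]] by simp
  qed
  have rearrange: "(c *\<^sub>R (a - (0 + d))) *\<^sub>R u + (c * d) *\<^sub>R (u - v) =
      c *\<^sub>R (a *\<^sub>R u - (0 *\<^sub>R v + d *\<^sub>R v))" for a c d and u v :: 'f
    by (simp add: scaleR_diff_left scaleR_diff_right right_diff_distrib)
  have eq: "((1 / norm (y - x)) *\<^sub>R (g y - (g x + g' (y - x)))) *\<^sub>R f y +
      (1 / norm (y - x) * g' (y - x)) *\<^sub>R (f y - f x) =
      (1 / norm (y - x)) *\<^sub>R (g y *\<^sub>R f y - (g x *\<^sub>R f x + g' (y - x) *\<^sub>R f x))" for y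
    unfolding \<open>g x = 0\<close> by (rule rearrange)
  have "((\<lambda>y. (1 / norm (y - x)) *\<^sub>R (g y *\<^sub>R f y - (g x *\<^sub>R f x + g' (y - x) *\<^sub>R f x))) \<longlongrightarrow> 0) (at x)"
    using tendsto_add[OF 1 2] unfolding eq by simp
  with bounded_linear_compose[OF bounded_linear_scaleR_left bl] show ?thesis
    unfolding has_derivative_within by (rule conjI)
qed

lemma linear_frechet_derivative_family:
  fixes K :: "'d::euclidean_space \<Rightarrow> 'e::euclidean_space \<Rightarrow> 'f::real_normed_vector"
  assumes "open S" "y \<in> S" "\<And>y. y \<in> S \<Longrightarrow> linear (K y)"
    and "\<And>w. (\<lambda>y. K y w) differentiable (at y)"
  shows "linear (\<lambda>w. frechet_derivative (\<lambda>y. K y w) (at y) v)"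
proof (rule linearI)
  note d = assms(4)[THEN frechet_derivative_works[THEN iffD1]]
  show "frechet_derivative (\<lambda>y. K y (a + b)) (at y) v =
    frechet_derivative (\<lambda>y. K y a) (at y) v + frechet_derivative (\<lambda>y. K y b) (at y) v" for a b
  proof -
    have "((\<lambda>y. K y (a + b)) has_derivative (\<lambda>v. frechet_derivative (\<lambda>y. K y a) (at y) v +
        frechet_derivative (\<lambda>y. K y b) (at y) v)) (at y)"
      by (rule has_derivative_transform_within_open[OF has_derivative_add[OF d[of a] d[of b]] assms(1,2)])
        (simp add: linear_add[OF assms(3)])
    from fun_cong[OF frechet_derivative_at[OF this], of v] show ?thesis by simp
  qed
  show "frechet_derivative (\<lambda>y. K y (r *\<^sub>R a)) (at y) v = r *\<^sub>R frechet_derivative (\<lambda>y. K y a) (at y) v" for r a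
  proof -
    have "((\<lambda>y. K y (r *\<^sub>R a)) has_derivative (\<lambda>v. r *\<^sub>R frechet_derivative (\<lambda>y. K y a) (at y) v)) (at y)"
      by (rule has_derivative_transform_within_open[OF has_derivative_scaleR_right[OF d[of a]] assms(1,2)])
        (simp add: linear_scale[OF assms(3)])
    from fun_cong[OF frechet_derivative_at[OF this], of v] show ?thesis by simp
  qed
qed

text \<open>
  The identity \<open>H\<^sub>y w - q = - H\<^sub>y (K\<^sub>y q - w)\<close>, for \<open>q\<close> the value of \<open>H\<^sub>y w\<close> at the given point, first yields
  continuity, then the derivative \<open>- H\<^sub>y (K'\<^sub>y (H\<^sub>y w))\<close>. That formula contains \<open>H\<close> undifferentiated, so
  regularity increases by induction.
\<close>

lemma Ck_on_inverse_family:
  fixes K H :: "'d::euclidean_space \<Rightarrow> 'e::euclidean_space \<Rightarrow> 'e"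
  assumes S: "open S" and lin: "\<And>y. y \<in> S \<Longrightarrow> linear (K y)"
    and HK: "\<And>y w. y \<in> S \<Longrightarrow> H y (K y w) = w" and KH: "\<And>y w. y \<in> S \<Longrightarrow> K y (H y w) = w"
    and "\<And>w. Ck_on k S (\<lambda>y. K y w)"
  shows "Ck_on k S (\<lambda>y. H y w)"
proof -
  have linH: "linear (H y)" if "y \<in> S" for y
    by (rule linear_two_sided_inverse[of "K y"]) (use that in \<open>auto intro: lin HK KH\<close>)
  have inj: "inj (K y)" if "y \<in> S" for y
    by (rule inj_on_inverseI[of _ "H y"]) (rule HK[OF that])
  have cont: "continuous_on S (\<lambda>y. H y w)" if K: "\<And>w. continuous_on S (\<lambda>y. K y w)" for w
  proof (rule continuous_at_imp_continuous_on, rule ballI)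
    fix y\<^sub>0 assume y0: "y\<^sub>0 \<in> S"
    obtain T c where T: "open T" "y\<^sub>0 \<in> T" "T \<subseteq> S" "c > 0"
      "\<And>y w. y \<in> T \<Longrightarrow> c * norm w \<le> norm (K y w)"
      using linear_family_bounded_below[OF S y0 lin K inj[OF y0]] by blast
    have "((\<lambda>y. H y w - H y\<^sub>0 w) \<longlongrightarrow> 0) (at y\<^sub>0)"
    proof (rule Lim_null_comparison)
      show "\<forall>\<^sub>F y in at y\<^sub>0. norm (H y w - H y\<^sub>0 w) \<le> norm (w - K y (H y\<^sub>0 w)) / c"
      proof (rule eventually_mono[OF eventually_at_in_open'[OF T(1,2)]])
        fix y assume y: "y \<in> T"
        then have "K y (H y w - H y\<^sub>0 w) = w - K y (H y\<^sub>0 w)"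
          using T(3) by (auto simp: linear_diff[OF lin] KH)
        then show "norm (H y w - H y\<^sub>0 w) \<le> norm (w - K y (H y\<^sub>0 w)) / c"
          using T(5)[OF y, of "H y w - H y\<^sub>0 w"] T(4) by (simp add: pos_le_divide_eq mult.commute)
      qed
      have "isCont (\<lambda>y. K y (H y\<^sub>0 w)) y\<^sub>0"
        using K S y0 by (simp add: continuous_on_eq_continuous_at)
      then have "((\<lambda>y. norm (w - K y (H y\<^sub>0 w)) / c) \<longlongrightarrow> norm (w - K y\<^sub>0 (H y\<^sub>0 w)) / c) (at y\<^sub>0)"
        using T(4) by (intro tendsto_intros) (auto simp: isCont_def)
      then show "((\<lambda>y. norm (w - K y (H y\<^sub>0 w)) / c) \<longlongrightarrow> 0) (at y\<^sub>0)"
        by (simp add: KH y0)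
    qed
    then show "isCont (\<lambda>y. H y w) y\<^sub>0" unfolding isCont_def by (rule LIM_zero_cancel)
  qed
  define K' where "K' v y q = frechet_derivative (\<lambda>y. K y q) (at y) v" for v y q
  have deriv: "((\<lambda>y. H y w) has_derivative (\<lambda>v. - H y (K' v y (H y w)))) (at y)"
    if y: "y \<in> S" and K: "\<And>w. Ck_on (Suc k) S (\<lambda>y. K y w)" for y w and k
  proof -
    have contK: "continuous_on S (\<lambda>y. K y w)" for w
      by (intro differentiable_imp_continuous_on differentiable_at_imp_differentiable_on
          Ck_on_Suc_differentiable[OF K])
    define q where "q = H y w"
    have k: "((\<lambda>z. K z q - w) has_derivative (\<lambda>v. K' v y q)) (at y)"
      unfolding K'_def using has_derivative_diff[OF Ck_on_has_derivative[OF K y, of q] has_derivative_const[of w]]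
      by simp
    have "((\<lambda>z. q - (\<Sum>b\<in>Basis. ((K z q - w) \<bullet> b) *\<^sub>R H z b)) has_derivative
       (\<lambda>v. 0 - (\<Sum>b\<in>Basis. (K' v y q \<bullet> b) *\<^sub>R H y b))) (at y)"
    proof (intro has_derivative_diff has_derivative_const has_derivative_sum has_derivative_scaleR_vanishing)
      show "((\<lambda>z. (K z q - w) \<bullet> b) has_derivative (\<lambda>v. K' v y q \<bullet> b)) (at y)" for b
        by (rule has_derivative_inner_left[OF k])
      show "(K y q - w) \<bullet> b = 0" for b by (simp add: q_def KH y)
      show "isCont (\<lambda>z. H z b) y" for b
        using cont[OF contK] S y by (simp add: continuous_on_eq_continuous_at)
    qed
    then have "((\<lambda>z. q - (\<Sum>b\<in>Basis. ((K z q - w) \<bullet> b) *\<^sub>R H z b)) has_derivative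
       (\<lambda>v. - H y (K' v y q))) (at y)"
      by (simp add: linear_eq_basis_sum[OF linH[OF y], symmetric])
    then show ?thesis unfolding q_def[symmetric]
    proof (rule has_derivative_transform_within_open[OF _ S y])
      fix z assume z: "z \<in> S"
      show "q - (\<Sum>b\<in>Basis. ((K z q - w) \<bullet> b) *\<^sub>R H z b) = H z w"
        by (simp add: linear_eq_basis_sum[OF linH[OF z], symmetric] linear_diff[OF linH[OF z]] HK[OF z])
    qed
  qed
  show ?thesis using assms(5)
  proof (induction k arbitrary: w)
    case 0
    then show ?case using cont by simp
  next
    case (Suc k)
    have Hk: "Ck_on k S (\<lambda>y. H y w)" for w
      by (rule Suc.IH) (rule Ck_on_SucD[OF Suc.prems])
    show ?case
    proof (rule Ck_on_SucI[OF S])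
      show "((\<lambda>y. H y w) has_derivative (\<lambda>v. - H y (K' v y (H y w)))) (at y)" if "y \<in> S" for y
        by (rule deriv[OF that Suc.prems])
      fix v
      have "Ck_on k S (\<lambda>y. K' v y (H y w))"
      proof (rule Ck_on_linear_family[OF S _ _ Hk])
        show "linear (K' v y)" if "y \<in> S" for y
          unfolding K'_def[abs_def]
          by (rule linear_frechet_derivative_family[OF S that lin Ck_on_Suc_differentiable[OF Suc.prems that]])
        show "Ck_on k S (\<lambda>y. K' v y b)" for b
          unfolding K'_def by (rule Ck_on_Suc_frechet_derivative[OF Suc.prems])
      qed
      with S linH Hk have "Ck_on k S (\<lambda>y. H y (K' v y (H y w)))"
        by (rule Ck_on_linear_family)
      then show "Ck_on k S (\<lambda>y. - H y (K' v y (H y w)))"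
        by (rule Ck_on_bounded_linear[OF bounded_linear_minus[OF bounded_linear_ident] S])
    qed
  qed
qed

lemma smooth_on_inverse_family:
  fixes K H :: "'d::euclidean_space \<Rightarrow> 'e::euclidean_space \<Rightarrow> 'e"
  assumes "open S" "\<And>y. y \<in> S \<Longrightarrow> linear (K y)"
    "\<And>y w. y \<in> S \<Longrightarrow> H y (K y w) = w" "\<And>y w. y \<in> S \<Longrightarrow> K y (H y w) = w"
    and "\<And>w. smooth_on S (\<lambda>y. K y w)"
  shows "smooth_on S (\<lambda>y. H y w)"
  unfolding smooth_on_def
proof
  show "Ck_on k S (\<lambda>y. H y w)" for k
    by (rule Ck_on_inverse_family[of S K H, OF assms(1-4)])
      (use assms(5) in \<open>simp_all add: smooth_on_def\<close>)
qed

section \<open>Symmetry of second derivatives\<close>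

lemma has_derivative_along_line:
  assumes "(f has_derivative f') (at (p + r *\<^sub>R u))"
  shows "((\<lambda>r. f (p + r *\<^sub>R u)) has_derivative (\<lambda>h. f' (h *\<^sub>R u))) (at r)"
proof -
  have "((\<lambda>r. p + r *\<^sub>R u) has_derivative (\<lambda>h. h *\<^sub>R u)) (at r)"
    by (auto intro!: derivative_eq_intros)
  from has_derivative_compose[OF this assms] show ?thesis .
qed

lemma has_real_derivative_along_line:
  fixes f :: "'e::real_normed_vector \<Rightarrow> real"
  assumes "(f has_derivative f') (at (p + r *\<^sub>R u))"
  shows "((\<lambda>r. f (p + r *\<^sub>R u)) has_real_derivative f' u) (at r)"
proof -
  have "f' (h *\<^sub>R u) = f' u * h" for h
    using linear_scale[OF has_derivative_linear[OF assms]] by (simp add: mult.commute)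
  then show ?thesis
    using has_derivative_along_line[OF assms] by (simp add: has_field_derivative_def mult_commute_abs)
qed

text \<open>
  The mean value theorem twice, first along \<open>u\<close> and then along \<open>v\<close>. The left-hand side is symmetric in
  \<open>u\<close> and \<open>v\<close>, which is what makes the second derivative symmetric in the limit \<open>t \<rightarrow> 0\<close>.
\<close>

lemma second_difference_eq:
  fixes f :: "'e::euclidean_space \<Rightarrow> real"
  assumes f: "smooth_on S f" and t: "t > 0"
    and box: "\<And>r s. 0 \<le> r \<Longrightarrow> r \<le> t \<Longrightarrow> 0 \<le> s \<Longrightarrow> s \<le> t \<Longrightarrow> x + r *\<^sub>R u + s *\<^sub>R v \<in> S"
  obtains r s where "0 \<le> r" "r \<le> t" "0 \<le> s" "s \<le> t"
    "f (x + t *\<^sub>R u + t *\<^sub>R v) - f (x + t *\<^sub>R u) - f (x + t *\<^sub>R v) + f x =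
     t * t * frechet_derivative (\<lambda>y. frechet_derivative f (at y) u) (at (x + r *\<^sub>R u + s *\<^sub>R v)) v"
proof -
  let ?Df = "\<lambda>y. frechet_derivative f (at y) u"
  define g where "g r = f (x + t *\<^sub>R v + r *\<^sub>R u) - f (x + r *\<^sub>R u)" for r
  have g: "(g has_real_derivative ?Df (x + t *\<^sub>R v + r *\<^sub>R u) - ?Df (x + r *\<^sub>R u)) (at r)"
    if "0 \<le> r" "r \<le> t" for r
    unfolding g_def using box[OF that, of 0] box[OF that, of t] t
    by (intro DERIV_diff has_real_derivative_along_line smooth_on_has_derivative[OF f])
      (simp_all add: algebra_simps)
  obtain r where r: "0 < r" "r < t"
    "g t - g 0 = (t - 0) * (?Df (x + t *\<^sub>R v + r *\<^sub>R u) - ?Df (x + r *\<^sub>R u))"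
    using MVT2[OF t g] by blast
  have k: "((\<lambda>s. ?Df (x + r *\<^sub>R u + s *\<^sub>R v)) has_real_derivative
      frechet_derivative ?Df (at (x + r *\<^sub>R u + s *\<^sub>R v)) v) (at s)" if "0 \<le> s" "s \<le> t" for s
    using r that
    by (intro has_real_derivative_along_line smooth_on_has_derivative[OF smooth_on_frechet_derivative[OF f]] box) auto
  obtain s where s: "0 < s" "s < t"
    "?Df (x + r *\<^sub>R u + t *\<^sub>R v) - ?Df (x + r *\<^sub>R u + 0 *\<^sub>R v) =
      (t - 0) * frechet_derivative ?Df (at (x + r *\<^sub>R u + s *\<^sub>R v)) v"
    using MVT2[OF t k] by blast
  show ?thesis
  proof (rule that[of r s])
    have "f (x + t *\<^sub>R u + t *\<^sub>R v) - f (x + t *\<^sub>R u) - f (x + t *\<^sub>R v) + f x = g t - g 0"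
      by (simp add: g_def add_ac)
    also have "\<dots> = t * (?Df (x + r *\<^sub>R u + t *\<^sub>R v) - ?Df (x + r *\<^sub>R u + 0 *\<^sub>R v))"
      using r(3) by (simp add: add_ac)
    finally show "f (x + t *\<^sub>R u + t *\<^sub>R v) - f (x + t *\<^sub>R u) - f (x + t *\<^sub>R v) + f x =
      t * t * frechet_derivative ?Df (at (x + r *\<^sub>R u + s *\<^sub>R v)) v"
      using s(3) by simp
  qed (use r s in auto)
qed

lemma second_derivative_symmetric_real:
  fixes f :: "'e::euclidean_space \<Rightarrow> real"
  assumes S: "open S" "x \<in> S" and f: "smooth_on S f"
  shows "frechet_derivative (\<lambda>y. frechet_derivative f (at y) u) (at x) v =
         frechet_derivative (\<lambda>y. frechet_derivative f (at y) v) (at x) u" (is "?a x = ?b x")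
proof -
  have cont: "isCont (\<lambda>y. frechet_derivative (\<lambda>y. frechet_derivative f (at y) u) (at y) v) x" for u v
    using smooth_on_continuous_on[OF smooth_on_frechet_derivative[OF smooth_on_frechet_derivative[OF f]]] S
    by (simp add: continuous_on_eq_continuous_at)
  have "\<bar>?a x - ?b x\<bar> \<le> 0 + e" if e: "e > 0" for e
  proof -
    obtain d1 where d1: "d1 > 0" "\<And>y. dist y x < d1 \<Longrightarrow> \<bar>?a y - ?a x\<bar> < e / 2"
      using cont[of u v] e unfolding continuous_at_eps_delta
      by (metis dist_real_def half_gt_zero)
    obtain d2 where d2: "d2 > 0" "\<And>y. dist y x < d2 \<Longrightarrow> \<bar>?b y - ?b x\<bar> < e / 2"
      using cont[of v u] e unfolding continuous_at_eps_delta
      by (metis dist_real_def half_gt_zero)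
    obtain d3 where d3: "d3 > 0" "\<And>y. dist y x < d3 \<Longrightarrow> y \<in> S"
      using S unfolding open_dist by (metis dist_commute)
    define d where "d = Min {d1, d2, d3}"
    have d: "d > 0" "d \<le> d1" "d \<le> d2" "d \<le> d3" using d1 d2 d3 by (auto simp: d_def)
    \<comment> \<open>the parallelogram spanned by \<open>t u\<close> and \<open>t v\<close> then lies in the ball of radius \<open>d\<close>; the
      \<open>1\<close> covers \<open>u = v = 0\<close>\<close>
    define t where "t = d / (norm u + norm v + 1)"
    have pos: "norm u + norm v + 1 > 0" by (simp add: add_nonneg_pos)
    then have t: "t > 0" using d by (simp add: t_def)
    have near: "dist (x + r *\<^sub>R u + s *\<^sub>R v) x < d" if "0 \<le> r" "r \<le> t" "0 \<le> s" "s \<le> t" for r s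
    proof -
      have "dist (x + r *\<^sub>R u + s *\<^sub>R v) x = norm (r *\<^sub>R u + s *\<^sub>R v)"
        by (simp add: dist_norm add.assoc)
      also have "\<dots> \<le> norm (r *\<^sub>R u) + norm (s *\<^sub>R v)" by (rule norm_triangle_ineq)
      also have "\<dots> \<le> t * norm u + t * norm v"
        using that by (auto intro!: add_mono mult_right_mono)
      also have "\<dots> < t * (norm u + norm v + 1)" using t by (simp add: algebra_simps)
      also have "\<dots> = d" using pos by (simp add: t_def)
      finally show ?thesis .
    qed
    have near': "dist (x + r *\<^sub>R v + s *\<^sub>R u) x < d" if "0 \<le> r" "r \<le> t" "0 \<le> s" "s \<le> t" for r s
      using near[of s r] that by (simp add: add_ac)
    have "x + r *\<^sub>R u + s *\<^sub>R v \<in> S" if "0 \<le> r" "r \<le> t" "0 \<le> s" "s \<le> t" for r s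
      using near[OF that] d by (intro d3(2)) auto
    from second_difference_eq[OF f t this] obtain r s where rs: "0 \<le> r" "r \<le> t" "0 \<le> s" "s \<le> t"
      "f (x + t *\<^sub>R u + t *\<^sub>R v) - f (x + t *\<^sub>R u) - f (x + t *\<^sub>R v) + f x =
         t * t * ?a (x + r *\<^sub>R u + s *\<^sub>R v)" by blast
    have "x + r *\<^sub>R v + s *\<^sub>R u \<in> S" if "0 \<le> r" "r \<le> t" "0 \<le> s" "s \<le> t" for r s
      using near'[OF that] d by (intro d3(2)) auto
    from second_difference_eq[OF f t this] obtain r' s' where rs': "0 \<le> r'" "r' \<le> t" "0 \<le> s'" "s' \<le> t"
      "f (x + t *\<^sub>R v + t *\<^sub>R u) - f (x + t *\<^sub>R v) - f (x + t *\<^sub>R u) + f x =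
         t * t * ?b (x + r' *\<^sub>R v + s' *\<^sub>R u)" by blast
    have "t * t * ?a (x + r *\<^sub>R u + s *\<^sub>R v) = t * t * ?b (x + r' *\<^sub>R v + s' *\<^sub>R u)"
      using rs(5) rs'(5) by (simp add: algebra_simps)
    then have "?a (x + r *\<^sub>R u + s *\<^sub>R v) = ?b (x + r' *\<^sub>R v + s' *\<^sub>R u)" using t by simp
    moreover have "\<bar>?a (x + r *\<^sub>R u + s *\<^sub>R v) - ?a x\<bar> < e / 2"
      using near[OF rs(1-4)] d by (intro d1(2)) auto
    moreover have "\<bar>?b (x + r' *\<^sub>R v + s' *\<^sub>R u) - ?b x\<bar> < e / 2"
      using near'[OF rs'(1-4)] d by (intro d2(2)) auto
    ultimately show ?thesis by linarith
  qed
  then have "\<bar>?a x - ?b x\<bar> \<le> 0" by (rule field_le_epsilon)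
  then show ?thesis by simp
qed

lemma second_derivative_symmetric:
  fixes f :: "'e::euclidean_space \<Rightarrow> 'f::euclidean_space"
  assumes S: "open S" "x \<in> S" and f: "smooth_on S f"
  shows "frechet_derivative (\<lambda>y. frechet_derivative f (at y) u) (at x) v =
         frechet_derivative (\<lambda>y. frechet_derivative f (at y) v) (at x) u"
proof (rule euclidean_eqI)
  fix b :: 'f
  have 1: "frechet_derivative (\<lambda>y. g y \<bullet> b) (at y) w = frechet_derivative g (at y) w \<bullet> b"
    if "smooth_on S g" "y \<in> S" for g w y
    using has_derivative_inner_left[OF smooth_on_has_derivative[OF that], of b]
    by (simp add: frechet_derivative_at[symmetric])
  have 2: "frechet_derivative (\<lambda>y. frechet_derivative f (at y) u) (at x) v \<bullet> b =
    frechet_derivative (\<lambda>y. frechet_derivative (\<lambda>y. f y \<bullet> b) (at y) u) (at x) v" for u v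
  proof -
    have "frechet_derivative (\<lambda>y. frechet_derivative f (at y) u \<bullet> b) (at x) =
      frechet_derivative (\<lambda>y. frechet_derivative (\<lambda>y. f y \<bullet> b) (at y) u) (at x)"
    proof (rule frechet_derivative_transform_within_open[OF _ S])
      show "(\<lambda>y. frechet_derivative f (at y) u \<bullet> b) differentiable (at x)"
        by (rule smooth_on_differentiable[OF smooth_on_bounded_linear[OF bounded_linear_inner_left
            S(1) smooth_on_frechet_derivative[OF f]] S(2)])
    qed (simp add: 1[OF f])
    then show ?thesis using 1[OF smooth_on_frechet_derivative[OF f] S(2), of u v] by simp
  qed
  show "frechet_derivative (\<lambda>y. frechet_derivative f (at y) u) (at x) v \<bullet> b =
         frechet_derivative (\<lambda>y. frechet_derivative f (at y) v) (at x) u \<bullet> b"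
    unfolding 2
    by (rule second_derivative_symmetric_real[OF S smooth_on_bounded_linear[OF bounded_linear_inner_left S(1) f]])
qed

section \<open>Closed 2-forms in coordinates\<close>

lemma derivative_in_subspace:
  fixes f :: "'e::euclidean_space \<Rightarrow> 'f::euclidean_space"
  assumes f: "(f has_derivative f') (at x)" and U: "open U" "x \<in> U"
    and S: "subspace S" "x \<in> S" "s \<in> S" and S': "subspace S'"
    and maps: "\<And>y. y \<in> U \<Longrightarrow> y \<in> S \<Longrightarrow> f y \<in> S'"
  shows "f' s \<in> S'"
proof -
  have "w \<bullet> f' s = 0" if w: "\<And>y. y \<in> S' \<Longrightarrow> y \<bullet> w = 0" for w
  proof -
    have "((\<lambda>r. f (x + r *\<^sub>R s) \<bullet> w) has_derivative (\<lambda>h. f' (h *\<^sub>R s) \<bullet> w)) (at 0)"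
      by (rule has_derivative_inner_left[OF has_derivative_along_line]) (simp add: f)
    moreover have "((\<lambda>r. f (x + r *\<^sub>R s) \<bullet> w) has_derivative (\<lambda>h. 0)) (at 0)"
    proof (rule has_derivative_transform_within_open[OF has_derivative_const[of 0]])
      show "open ((\<lambda>r. x + r *\<^sub>R s) -` U)"
        by (intro open_vimage U continuous_intros)
      show "0 = f (x + r *\<^sub>R s) \<bullet> w" if "r \<in> (\<lambda>r. x + r *\<^sub>R s) -` U" for r
        using that S by (intro w[symmetric] maps) (auto simp: subspace_add subspace_scale)
    qed (use U in simp)
    ultimately have "(\<lambda>h. f' (h *\<^sub>R s) \<bullet> w) = (\<lambda>h. 0)" by (rule has_derivative_unique)
    from fun_cong[OF this, of 1] show ?thesis by (simp add: inner_commute)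
  qed
  then have "f' s \<in> S'\<^sup>\<bottom>\<^sup>\<bottom>" by (simp add: orthogonal_comp_def orthogonal_def)
  then show ?thesis by (simp add: orthogonal_comp_self S')
qed

lemma has_derivative_linear_family:
  fixes L :: "'d::euclidean_space \<Rightarrow> 'e::euclidean_space \<Rightarrow> 'f::real_normed_vector"
  assumes C: "open C" "x \<in> C" and lin: "\<And>x. x \<in> C \<Longrightarrow> linear (L x)"
    and d: "\<And>b. (\<lambda>x. L x b) differentiable (at x)" and g: "(g has_derivative g') (at x)"
  shows "((\<lambda>y. L y (g y)) has_derivative
    (\<lambda>h. frechet_derivative (\<lambda>y. L y (g x)) (at x) h + L x (g' h))) (at x)"
proof -
  have "((\<lambda>y. \<Sum>b\<in>Basis. (g y \<bullet> b) *\<^sub>R L y b) has_derivative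
     (\<lambda>h. \<Sum>b\<in>Basis. (g x \<bullet> b) *\<^sub>R frechet_derivative (\<lambda>y. L y b) (at x) h + (g' h \<bullet> b) *\<^sub>R L x b)) (at x)"
    using d by (intro has_derivative_sum has_derivative_scaleR has_derivative_inner_left[OF g])
      (simp flip: frechet_derivative_works)
  also have "(\<lambda>h. \<Sum>b\<in>Basis. (g x \<bullet> b) *\<^sub>R frechet_derivative (\<lambda>y. L y b) (at x) h + (g' h \<bullet> b) *\<^sub>R L x b)
      = (\<lambda>h. frechet_derivative (\<lambda>y. L y (g x)) (at x) h + L x (g' h))"
    by (simp add: sum.distrib linear_eq_basis_sum[OF linear_frechet_derivative_family[OF C lin d], symmetric]
        linear_eq_basis_sum[OF lin[OF C(2)], symmetric])
  finally show ?thesis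
    by (rule has_derivative_transform_within_open[OF _ C])
      (simp add: linear_eq_basis_sum[OF lin, symmetric])
qed

locale closed_form_on =
  fixes C :: "'e::euclidean_space set" and \<tau> :: "'e \<Rightarrow> 'e \<Rightarrow> 'e \<Rightarrow> real"
  assumes open_C: "open C"
    and bilin: "x \<in> C \<Longrightarrow> bilinear (\<tau> x)"
    and skew: "x \<in> C \<Longrightarrow> \<tau> x u w = - \<tau> x w u"
    and smooth: "smooth_on C (\<lambda>x. \<tau> x u w)"
    and closed: "x \<in> C \<Longrightarrow> frechet_derivative (\<lambda>y. \<tau> y v w) (at x) u +
       frechet_derivative (\<lambda>y. \<tau> y w u) (at x) v + frechet_derivative (\<lambda>y. \<tau> y u v) (at x) w = 0"
begin

lemma linear_left: "x \<in> C \<Longrightarrow> linear (\<lambda>u. \<tau> x u w)"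
  and linear_right: "x \<in> C \<Longrightarrow> linear (\<tau> x u)"
  using bilin by (auto simp: bilinear_def)

lemma has_derivative_pullback:
  fixes z w :: "'d::euclidean_space \<Rightarrow> 'e"
  assumes U: "open U" "y \<in> U" "\<phi> ` U \<subseteq> C"
    and \<phi>: "continuous_on U \<phi>" "(\<phi> has_derivative \<phi>') (at y)"
    and z: "(z has_derivative z') (at y)" and w: "(w has_derivative w') (at y)"
  shows "((\<lambda>y. \<tau> (\<phi> y) (z y) (w y)) has_derivative
    (\<lambda>h. frechet_derivative (\<lambda>x. \<tau> x (z y) (w y)) (at (\<phi> y)) (\<phi>' h)
      + \<tau> (\<phi> y) (z' h) (w y) + \<tau> (\<phi> y) (z y) (w' h))) (at y)"
proof -
  have C: "\<phi> q \<in> C" if "q \<in> U" for q using that U by auto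
  have \<tau>: "((\<lambda>q. \<tau> (\<phi> q) a b) has_derivative
      (\<lambda>h. frechet_derivative (\<lambda>x. \<tau> x a b) (at (\<phi> y)) (\<phi>' h))) (at y)" for a b
    by (rule has_derivative_compose[OF \<phi>(2) smooth_on_has_derivative[OF smooth C[OF U(2)]]])
  have 1: "((\<lambda>q. \<tau> (\<phi> q) (z q) b) has_derivative
      (\<lambda>h. frechet_derivative (\<lambda>x. \<tau> x (z y) b) (at (\<phi> y)) (\<phi>' h) + \<tau> (\<phi> y) (z' h) b)) (at y)" for b
    using has_derivative_linear_family[OF U(1,2) linear_left[OF C] differentiableI[OF \<tau>] z, of b]
    by (simp add: frechet_derivative_at[OF \<tau>, symmetric])
  show ?thesis
    using has_derivative_linear_family[OF U(1,2) linear_right[OF C] differentiableI[OF 1] w]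
    by (simp add: frechet_derivative_at[OF 1, symmetric])
qed

text \<open>
  This says that \<open>(L\<^sub>z\<tau>)(d\<phi> s, d\<phi> t) = 0\<close> when \<open>i(z)\<tau>\<close> vanishes on the vectors tangent to \<open>\<phi>(S)\<close>; the field
  \<open>z\<close> is only given along \<open>\<phi>\<close>, which covers normal fields of \<open>M\<close> and frames of \<open>\<nu>N\<close> alike.
  Differentiate \<open>\<tau>(z, d\<phi> t) = 0\<close> in the direction \<open>s\<close> and antisymmetrize: the terms with
  \<open>d\<^sup>2\<phi>(s, t)\<close> cancel, and closedness turns the two remaining derivatives of \<open>\<tau>\<close> into the
  derivative along \<open>z\<close>.
\<close>

lemma lie_derivative_vanishes:
  fixes \<phi> z :: "'d::euclidean_space \<Rightarrow> 'e"
  assumes U: "open U" "y \<in> U" "\<phi> ` U \<subseteq> C" and \<phi>: "smooth_on U \<phi>"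
    and S: "subspace S" "y \<in> S" "s \<in> S" "t \<in> S"
    and z: "(z has_derivative z') (at y)"
    and orth: "\<And>q t. q \<in> U \<Longrightarrow> q \<in> S \<Longrightarrow> t \<in> S \<Longrightarrow> \<tau> (\<phi> q) (z q) (frechet_derivative \<phi> (at q) t) = 0"
  shows "frechet_derivative (\<lambda>x. \<tau> x (frechet_derivative \<phi> (at y) s) (frechet_derivative \<phi> (at y) t)) (at (\<phi> y)) (z y)
    + \<tau> (\<phi> y) (frechet_derivative \<phi> (at y) s) (z' t) - \<tau> (\<phi> y) (frechet_derivative \<phi> (at y) t) (z' s) = 0"
proof -
  let ?D = "\<lambda>t q. frechet_derivative \<phi> (at q) t" and ?x = "\<phi> y"
  have x: "?x \<in> C" using U by auto
  have eq: "frechet_derivative (\<lambda>x. \<tau> x (z y) (?D t y)) (at ?x) (?D s y) + \<tau> ?x (z' s) (?D t y)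
     + \<tau> ?x (z y) (frechet_derivative (?D t) (at y) s) = 0" if "s \<in> S" "t \<in> S" for s t
  proof -
    have "((\<lambda>q. \<tau> (\<phi> q) (z q) (?D t q)) has_derivative
      (\<lambda>s. frechet_derivative (\<lambda>x. \<tau> x (z y) (?D t y)) (at ?x) (?D s y) + \<tau> ?x (z' s) (?D t y)
        + \<tau> ?x (z y) (frechet_derivative (?D t) (at y) s))) (at y)"
      by (rule has_derivative_pullback[OF U smooth_on_continuous_on[OF \<phi>] smooth_on_has_derivative[OF \<phi> U(2)]
         z smooth_on_has_derivative[OF smooth_on_frechet_derivative[OF \<phi>] U(2)]])
    from derivative_in_subspace[OF this U(1,2) S(1,2) that(1) subspace_single_0] show ?thesis
      using orth that by simp
  qed
  have neg: "frechet_derivative (\<lambda>x. \<tau> x a b) (at ?x) c = - frechet_derivative (\<lambda>x. \<tau> x b a) (at ?x) c" for a b c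
  proof -
    have "((\<lambda>x. \<tau> x a b) has_derivative (\<lambda>c. - frechet_derivative (\<lambda>x. \<tau> x b a) (at ?x) c)) (at ?x)"
      by (rule has_derivative_transform_within_open[OF has_derivative_minus[OF smooth_on_has_derivative[OF smooth x]] open_C x])
        (metis skew)
    from fun_cong[OF frechet_derivative_at[OF this]] show ?thesis by simp
  qed
  show ?thesis
    using eq[OF S(3,4)] eq[OF S(4,3)] second_derivative_symmetric[OF U(1,2) \<phi>, of s t]
      closed[OF x, of "?D s y" "?D t y" "z y"] neg[of "z y" "?D t y" "?D s y"]
      skew[OF x, of "z' s" "?D t y"] skew[OF x, of "z' t" "?D s y"]
    by simp
qed

end

section \<open>Bump functions\<close>

text \<open>
  The functions \<open>t\<^sup>-\<^sup>k exp(-1/t)\<close> for \<open>t > 0\<close>, extended by \<open>0\<close>. The derivative of each of them is a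
  combination of others, so all are smooth by a single induction.
\<close>

definition flat :: "nat \<Rightarrow> real \<Rightarrow> real" where
  "flat k t = (if t \<le> 0 then 0 else inverse t ^ k * exp (- inverse t))"

lemma flat_tendsto_0: "(flat k \<longlongrightarrow> 0) (at 0)"
proof (rule filterlim_split_at)
  show "(flat k \<longlongrightarrow> 0) (at_left 0)"
    by (rule Lim_transform_eventually[OF tendsto_const])
      (auto simp: flat_def eventually_at_filter)
  have "((\<lambda>x. inverse x ^ k / exp (inverse x)) \<longlongrightarrow> (0::real)) (at_right 0)"
    by (rule filterlim_compose[OF tendsto_power_div_exp_0 filterlim_inverse_at_top_right])
  then show "(flat k \<longlongrightarrow> 0) (at_right 0)"
    by (rule Lim_transform_eventually)
      (auto simp: flat_def eventually_at_filter exp_minus divide_inverse)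
qed

lemma flat_has_derivative:
  "(flat k has_real_derivative flat (k + 2) t - real k * flat (k + 1) t) (at t)"
proof -
  consider "t < 0" | "t = 0" | "t > 0" by linarith
  then show ?thesis
  proof cases
    case 1
    have "(flat k has_real_derivative 0) (at t)"
      by (rule has_field_derivative_transform_within_open[OF DERIV_const[of 0] open_lessThan[of 0]])
        (use 1 in \<open>auto simp: flat_def\<close>)
    then show ?thesis using 1 by (simp add: flat_def)
  next
    case 2
    have "((\<lambda>h. (flat k (0 + h) - flat k 0) / h) \<longlongrightarrow> 0) (at 0)"
      by (rule Lim_transform_eventually[OF flat_tendsto_0[of "Suc k"]])
        (auto simp: flat_def eventually_at_filter divide_inverse)
    then show ?thesis using 2 by (simp add: DERIV_def flat_def)
  next
    case 3
    have pow: "inverse t * inverse t ^ (n - Suc 0) = (if n = 0 then inverse t else inverse t ^ n)" for n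
      by (cases n) simp_all
    have "((\<lambda>t. inverse t ^ k * exp (- inverse t)) has_real_derivative
        flat (k + 2) t - real k * flat (k + 1) t) (at t)"
      using 3 by (cases k) (auto intro!: derivative_eq_intros simp: flat_def power2_eq_square algebra_simps pow)
    then show ?thesis
      by (rule has_field_derivative_transform_within_open[OF _ open_greaterThan[of 0]])
        (use 3 in \<open>auto simp: flat_def\<close>)
  qed
qed

lemma smooth_on_flat: "smooth_on UNIV (flat k)"
proof -
  have "Ck_on n UNIV (flat k)" for n
  proof (induction n arbitrary: k)
    case 0
    then show ?case
      by (auto intro!: continuous_at_imp_continuous_on DERIV_isCont[OF flat_has_derivative])
  next
    case (Suc n)
    show ?case
    proof (rule Ck_on_SucI[OF open_UNIV])
      show "(flat k has_derivative (\<lambda>h. h *\<^sub>R (flat (k + 2) t + (- real k) *\<^sub>R flat (k + 1) t))) (at t)" for t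
        using flat_has_derivative[of k t] by (simp add: has_field_derivative_def mult_commute_abs)
      show "Ck_on n UNIV (\<lambda>t. h *\<^sub>R (flat (k + 2) t + (- real k) *\<^sub>R flat (k + 1) t))" for h
        by (intro Ck_on_bounded_linear[OF bounded_linear_scaleR_right open_UNIV]
            Ck_on_add[OF open_UNIV] Suc.IH)
    qed
  qed
  then show ?thesis by (simp add: smooth_on_def)
qed

lemma bump_function_exists:
  fixes x\<^sub>0 :: "'e::euclidean_space"
  assumes "r > 0"
  obtains f :: "'e \<Rightarrow> real" where "smooth_on UNIV f" "f x\<^sub>0 = 1" "\<And>x. r \<le> dist x x\<^sub>0 \<Longrightarrow> f x = 0"
proof
  let ?f = "\<lambda>x. flat 0 (r\<^sup>2 - (x - x\<^sub>0) \<bullet> (x - x\<^sub>0)) / flat 0 (r\<^sup>2)"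
  have "smooth_on UNIV (\<lambda>x. r\<^sup>2 - (x - x\<^sub>0) \<bullet> (x - x\<^sub>0))"
  proof (rule smooth_on_diff[OF open_UNIV smooth_on_const])
    have "smooth_on UNIV (\<lambda>x. x - x\<^sub>0)"
      by (intro smooth_on_diff smooth_on_id smooth_on_const open_UNIV)
    then show "smooth_on UNIV (\<lambda>x. (x - x\<^sub>0) \<bullet> (x - x\<^sub>0))"
      by (simp add: smooth_on_def Ck_on_bounded_bilinear[OF bounded_bilinear_inner])
  qed
  from smooth_on_compose[OF open_UNIV smooth_on_flat this]
  show "smooth_on UNIV ?f"
    unfolding divide_inverse
    by (intro smooth_on_bounded_linear[OF bounded_linear_mult_left open_UNIV]) simp
  show "?f x\<^sub>0 = 1" using assms by (simp add: flat_def)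
  show "?f x = 0" if "r \<le> dist x x\<^sub>0" for x
    using that assms power_mono[of r "norm (x - x\<^sub>0)" 2]
    by (simp add: flat_def dist_norm power2_norm_eq_inner)
qed

section \<open>Charts and tangent spaces\<close>

lemma compatible_commute: "compatible c d \<longleftrightarrow> compatible d c"
  by (auto simp: compatible_def Int_commute)

locale atlas =
  fixes A :: "('a, 'e::euclidean_space) chart set"
  assumes smooth_atlas: "smooth_atlas A"
begin

lemma preferred_chart:
  assumes "p \<in> points A"
  shows "preferred_chart A p \<in> A" "p \<in> fst (preferred_chart A p)"
proof -
  have "\<exists>c. c \<in> A \<and> p \<in> fst c" using assms by (auto simp: points_def)
  from someI_ex[OF this] show "preferred_chart A p \<in> A" "p \<in> fst (preferred_chart A p)"
    by (simp_all add: preferred_chart_def)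
qed

lemma atlas_subset_maximal: "c \<in> A \<Longrightarrow> c \<in> maximal_atlas A"
  using smooth_atlas by (auto simp: maximal_atlas_def smooth_atlas_def points_def)

lemma preferred_maximal: "p \<in> points A \<Longrightarrow> preferred_chart A p \<in> maximal_atlas A"
  by (intro atlas_subset_maximal preferred_chart)

lemma maximal_points: "c \<in> maximal_atlas A \<Longrightarrow> p \<in> fst c \<Longrightarrow> p \<in> points A"
  by (auto simp: maximal_atlas_def)

lemma maximal_inj: "c \<in> maximal_atlas A \<Longrightarrow> inj_on (snd c) (fst c)"
  by (auto simp: maximal_atlas_def)

lemma maximal_compatible:
  "c \<in> maximal_atlas A \<Longrightarrow> d \<in> A \<Longrightarrow> compatible c d"
  "c \<in> maximal_atlas A \<Longrightarrow> d \<in> A \<Longrightarrow> compatible d c"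
  by (auto simp: maximal_atlas_def compatible_commute)

lemma chart_inv_chart [simp]:
  "c \<in> maximal_atlas A \<Longrightarrow> p \<in> fst c \<Longrightarrow> chart_inv c (snd c p) = p"
  by (simp add: maximal_inj)

lemma transition_chart [simp]:
  "c \<in> maximal_atlas A \<Longrightarrow> p \<in> fst c \<Longrightarrow> transition c d (snd c p) = snd d p"
  by (simp add: transition_def)

lemma open_coordinate_preimage:
  assumes c: "c \<in> maximal_atlas A" and d: "d \<in> A" and U: "open U"
  shows "open (snd c ` {p \<in> fst c \<inter> fst d. snd d p \<in> U})"
    "open (snd d ` {p \<in> fst c \<inter> fst d. snd c p \<in> U})"
proof -
  note cd = maximal_compatible(1)[OF c d, unfolded compatible_def]
  have "snd c ` {p \<in> fst c \<inter> fst d. snd d p \<in> U} = snd c ` (fst c \<inter> fst d) \<inter> transition c d -` U"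
    using c by auto
  then show "open (snd c ` {p \<in> fst c \<inter> fst d. snd d p \<in> U})"
    using cd U by (simp add: continuous_open_preimage smooth_on_continuous_on)
  have "snd d ` {p \<in> fst c \<inter> fst d. snd c p \<in> U} = snd d ` (fst c \<inter> fst d) \<inter> transition d c -` U"
    using atlas_subset_maximal[OF d] by auto
  then show "open (snd d ` {p \<in> fst c \<inter> fst d. snd c p \<in> U})"
    using cd U by (simp add: continuous_open_preimage smooth_on_continuous_on)
qed

lemma openin_iff:
  "openin (manifold_topology A) W \<longleftrightarrow> W \<subseteq> points A \<and> (\<forall>c\<in>A. open (snd c ` (W \<inter> fst c)))"
proof -
  have "istopology (\<lambda>W. W \<subseteq> points A \<and> (\<forall>c\<in>A. open (snd c ` (W \<inter> fst c))))"
    unfolding istopology_def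
  proof (intro conjI allI impI ballI)
    fix V W c
    assume VW: "V \<subseteq> points A \<and> (\<forall>c\<in>A. open (snd c ` (V \<inter> fst c)))"
      "W \<subseteq> points A \<and> (\<forall>c\<in>A. open (snd c ` (W \<inter> fst c)))"
    then show "V \<inter> W \<subseteq> points A" by blast
    assume "c \<in> A"
    then have "snd c ` (V \<inter> W \<inter> fst c) = snd c ` (V \<inter> fst c) \<inter> snd c ` (W \<inter> fst c)"
      using maximal_inj[OF atlas_subset_maximal] by (subst inj_on_image_Int[of "snd c" "fst c", symmetric]) (auto simp: Int_ac)
    then show "open (snd c ` (V \<inter> W \<inter> fst c))" using VW \<open>c \<in> A\<close> by auto
  next
    fix \<U> c
    assume U: "\<forall>V\<in>\<U>. V \<subseteq> points A \<and> (\<forall>c\<in>A. open (snd c ` (V \<inter> fst c)))"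
    then show "\<Union> \<U> \<subseteq> points A" by blast
    assume "c \<in> A"
    have "snd c ` (\<Union> \<U> \<inter> fst c) = (\<Union>V\<in>\<U>. snd c ` (V \<inter> fst c))" by blast
    then show "open (snd c ` (\<Union> \<U> \<inter> fst c))" using U \<open>c \<in> A\<close> by auto
  qed
  then show ?thesis by (simp add: manifold_topology_def topology_inverse')
qed

lemma openin_subset_points: "openin (manifold_topology A) W \<Longrightarrow> W \<subseteq> points A"
  by (simp add: openin_iff)

lemma openin_chart_preimage:
  assumes c: "c \<in> maximal_atlas A" and "open U"
  shows "openin (manifold_topology A) {p \<in> fst c. snd c p \<in> U}"
  unfolding openin_iff
proof (intro conjI ballI)
  fix d assume "d \<in> A"
  have "{p \<in> fst c. snd c p \<in> U} \<inter> fst d = {p \<in> fst c \<inter> fst d. snd c p \<in> U}" by blast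
  then show "open (snd d ` ({p \<in> fst c. snd c p \<in> U} \<inter> fst d))"
    using open_coordinate_preimage(2)[OF c \<open>d \<in> A\<close> assms(2)] by simp
qed (use maximal_points[OF c] in blast)

lemma openin_chart_domain: "c \<in> maximal_atlas A \<Longrightarrow> openin (manifold_topology A) (fst c)"
  using openin_chart_preimage[of c UNIV] by simp

text \<open>
  For a chart of the maximal atlas: openness is known only on the overlaps with charts of the atlas, which
  cover the domain.
\<close>

lemma open_chart_image:
  assumes c: "c \<in> maximal_atlas A" and W: "openin (manifold_topology A) W"
  shows "open (snd c ` (W \<inter> fst c))"
proof -
  have "snd c ` (W \<inter> fst c) = (\<Union>d\<in>A. snd c ` {p \<in> fst c \<inter> fst d. snd d p \<in> snd d ` (W \<inter> fst d)})"
  proof (intro equalityI subsetI)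
    fix x assume "x \<in> snd c ` (W \<inter> fst c)"
    then obtain p where p: "x = snd c p" "p \<in> W" "p \<in> fst c" by blast
    then obtain d where "d \<in> A" "p \<in> fst d"
      using maximal_points[OF c p(3)] unfolding points_def by blast
    then show "x \<in> (\<Union>d\<in>A. snd c ` {p \<in> fst c \<inter> fst d. snd d p \<in> snd d ` (W \<inter> fst d)})"
      using p by blast
  next
    fix x assume "x \<in> (\<Union>d\<in>A. snd c ` {p \<in> fst c \<inter> fst d. snd d p \<in> snd d ` (W \<inter> fst d)})"
    then obtain d p q where *: "d \<in> A" "p \<in> fst c" "p \<in> fst d" "x = snd c p"
      "snd d p = snd d q" "q \<in> W" "q \<in> fst d"
      by blast
    then have "p = q" using maximal_inj[OF atlas_subset_maximal[OF *(1)]] by (auto dest: inj_onD)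
    then show "x \<in> snd c ` (W \<inter> fst c)" using * by blast
  qed
  also have "open \<dots>"
    using W by (intro open_UN ballI open_coordinate_preimage(1)[OF c]) (auto simp: openin_iff)
  finally show ?thesis .
qed

lemma open_overlap:
  assumes "c \<in> maximal_atlas A" "d \<in> maximal_atlas A"
  shows "open (snd c ` (fst c \<inter> fst d))"
  using open_chart_image[OF assms(1) openin_chart_domain[OF assms(2)]] by (simp add: Int_commute)

lemma open_triple_overlap:
  assumes "c \<in> maximal_atlas A" "d \<in> maximal_atlas A" "e \<in> maximal_atlas A"
  shows "open (snd c ` (fst c \<inter> fst d \<inter> fst e))"
  using open_chart_image[OF assms(1) openin_Int[OF openin_chart_domain[OF assms(2)] openin_chart_domain[OF assms(3)]]]
  by (simp add: Int_ac)

lemma restricted_chart_maximal: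
  assumes c: "c \<in> maximal_atlas A" and V: "openin (manifold_topology A) V" "V \<subseteq> fst c"
  shows "(V, snd c) \<in> maximal_atlas A"
  unfolding maximal_atlas_def mem_Collect_eq fst_conv snd_conv
proof (intro conjI ballI)
  show "V \<subseteq> points A" by (rule openin_subset_points[OF V(1)])
  show "inj_on (snd c) V" using maximal_inj[OF c] V(2) by (rule inj_on_subset)
  fix d assume d: "d \<in> A"
  note cd = maximal_compatible(1)[OF c d, unfolded compatible_def]
  have V_inv: "inv_into V (snd c) (snd c p) = p" if "p \<in> V" for p
    using \<open>inj_on (snd c) V\<close> that by simp
  have "V \<inter> fst d \<inter> fst c = V \<inter> fst d" using V(2) by blast
  then have 1: "open (snd c ` (V \<inter> fst d))"
    using open_chart_image[OF c openin_Int[OF V(1) openin_chart_domain[OF atlas_subset_maximal[OF d]]]] by simp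
  moreover have "open (snd d ` (V \<inter> fst d))"
    using V d by (simp add: openin_iff)
  moreover have "smooth_on (snd c ` (V \<inter> fst d)) (transition (V, snd c) d)"
  proof (rule smooth_on_cong[OF smooth_on_subset[OF conjunct1[OF conjunct2[OF conjunct2[OF cd]]]] 1])
    show "snd c ` (V \<inter> fst d) \<subseteq> snd c ` (fst c \<inter> fst d)" using V(2) by blast
    show "transition c d x = transition (V, snd c) d x" if "x \<in> snd c ` (V \<inter> fst d)" for x
      using that V(2) c by (auto simp: transition_def V_inv maximal_inj subset_iff)
  qed
  moreover have "smooth_on (snd d ` (V \<inter> fst d)) (transition d (V, snd c))"
    unfolding transition_def snd_conv
    using smooth_on_subset[OF conjunct2[OF conjunct2[OF conjunct2[OF cd]]], of "snd d ` (V \<inter> fst d)"] V(2)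
    by (auto simp: transition_def)
  ultimately show "compatible (V, snd c) d" by (simp add: compatible_def)
qed

lemma transition_has_derivative_compose:
  assumes max: "c \<in> maximal_atlas A" "d \<in> maximal_atlas A" "e \<in> maximal_atlas A"
    and p: "p \<in> fst c" "p \<in> fst d" "p \<in> fst e"
    and ce: "(transition c e has_derivative L) (at (snd c p))"
    and ed: "(transition e d has_derivative L') (at (snd e p))"
  shows "(transition c d has_derivative (\<lambda>v. L' (L v))) (at (snd c p))"
proof -
  have "((\<lambda>x. transition e d (transition c e x)) has_derivative (\<lambda>v. L' (L v))) (at (snd c p))"
    using ed max p by (intro has_derivative_compose[OF ce]) simp
  then show ?thesis
    by (rule has_derivative_transform_within_open[OF _ open_triple_overlap[OF max]])
      (use max p in auto)
qed

text \<open>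
  Membership in the maximal atlas gives compatibility with the charts of the atlas only; for two charts
  of the maximal atlas the transition map is factored through one of these.
\<close>

lemma transition_differentiable:
  assumes max: "c \<in> maximal_atlas A" "d \<in> maximal_atlas A" and p: "p \<in> fst c" "p \<in> fst d"
  shows "transition c d differentiable (at (snd c p))"
proof -
  define e where "e = preferred_chart A p"
  have e: "e \<in> A" "p \<in> fst e" using preferred_chart maximal_points[OF max(1) p(1)] by (auto simp: e_def)
  have "smooth_on (snd c ` (fst c \<inter> fst e)) (transition c e)"
    using maximal_compatible(1)[OF max(1) e(1)] by (simp add: compatible_def)
  from smooth_on_has_derivative[OF this, of "snd c p"]
  have ce: "(transition c e has_derivative frechet_derivative (transition c e) (at (snd c p))) (at (snd c p))"
    using p e by blast
  have "smooth_on (snd e ` (fst e \<inter> fst d)) (transition e d)"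
    using maximal_compatible(2)[OF max(2) e(1)] by (simp add: compatible_def)
  from smooth_on_has_derivative[OF this, of "snd e p"]
  have ed: "(transition e d has_derivative frechet_derivative (transition e d) (at (snd e p))) (at (snd e p))"
    using p e by blast
  show ?thesis
    using transition_has_derivative_compose[OF max atlas_subset_maximal[OF e(1)] p e(2) ce ed]
    by (rule differentiableI)
qed

lemma transition_has_derivative:
  assumes "c \<in> maximal_atlas A" "d \<in> maximal_atlas A" "p \<in> fst c" "p \<in> fst d"
  shows "(transition c d has_derivative frechet_derivative (transition c d) (at (snd c p))) (at (snd c p))"
  using transition_differentiable[OF assms] by (simp add: frechet_derivative_works)

lemma frechet_derivative_transition_compose:
  assumes "c \<in> maximal_atlas A" "d \<in> maximal_atlas A" "e \<in> maximal_atlas A"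
    and "p \<in> fst c" "p \<in> fst d" "p \<in> fst e"
  shows "frechet_derivative (transition e d) (at (snd e p)) (frechet_derivative (transition c e) (at (snd c p)) v)
    = frechet_derivative (transition c d) (at (snd c p)) v"
  using frechet_derivative_at[OF transition_has_derivative_compose[OF assms
        transition_has_derivative transition_has_derivative]] assms
  by (auto dest: fun_cong)

lemma frechet_derivative_transition_self:
  assumes c: "c \<in> maximal_atlas A" "p \<in> fst c"
  shows "frechet_derivative (transition c c) (at (snd c p)) v = v"
proof -
  have "(transition c c has_derivative (\<lambda>v. v)) (at (snd c p))"
    by (rule has_derivative_transform_within_open[OF has_derivative_ident open_overlap[OF c(1) c(1)]])
      (use c in auto)
  from fun_cong[OF frechet_derivative_at[OF this]] show ?thesis by simp
qed

lemma linear_frechet_derivative_transition: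
  assumes "c \<in> maximal_atlas A" "d \<in> maximal_atlas A" "p \<in> fst c" "p \<in> fst d"
  shows "linear (frechet_derivative (transition c d) (at (snd c p)))"
  by (intro linear_frechet_derivative transition_differentiable assms)

lemma components_transition:
  assumes "c \<in> maximal_atlas A" "d \<in> maximal_atlas A" "p \<in> fst c" "p \<in> fst d"
  shows "components A d p v = frechet_derivative (transition c d) (at (snd c p)) (components A c p v)"
proof -
  have p: "p \<in> points A" using maximal_points assms by blast
  show ?thesis
    unfolding components_def
    by (rule frechet_derivative_transition_compose[symmetric])
      (use assms preferred_chart(2)[OF p] preferred_maximal[OF p] in auto)
qed

lemma linear_components:
  assumes "c \<in> maximal_atlas A" "p \<in> fst c"
  shows "linear (components A c p)"
proof -
  have p: "p \<in> points A" using maximal_points assms by blast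
  show ?thesis
    unfolding components_def[abs_def]
    by (rule linear_frechet_derivative_transition) (use assms preferred_chart(2)[OF p] preferred_maximal[OF p] in auto)
qed

lemma linear_vector_of_components:
  assumes "c \<in> maximal_atlas A" "p \<in> fst c"
  shows "linear (vector_of_components A c p)"
proof -
  have p: "p \<in> points A" using maximal_points assms by blast
  show ?thesis
    unfolding vector_of_components_def[abs_def]
    by (rule linear_frechet_derivative_transition) (use assms preferred_chart(2)[OF p] preferred_maximal[OF p] in auto)
qed

lemma components_vector_of_components [simp]:
  assumes "c \<in> maximal_atlas A" "p \<in> fst c"
  shows "components A c p (vector_of_components A c p u) = u"
proof -
  have p: "p \<in> points A" using maximal_points assms by blast
  show ?thesis
    unfolding components_def vector_of_components_def
    using assms preferred_chart(2)[OF p] preferred_maximal[OF p]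
    by (simp add: frechet_derivative_transition_compose frechet_derivative_transition_self)
qed

lemma vector_of_components_components [simp]:
  assumes "c \<in> maximal_atlas A" "p \<in> fst c"
  shows "vector_of_components A c p (components A c p u) = u"
proof -
  have p: "p \<in> points A" using maximal_points assms by blast
  show ?thesis
    unfolding components_def vector_of_components_def
    using assms preferred_chart(2)[OF p] preferred_maximal[OF p]
    by (simp add: frechet_derivative_transition_compose frechet_derivative_transition_self)
qed

lemma components_preferred [simp]:
  "p \<in> points A \<Longrightarrow> components A (preferred_chart A p) p v = v"
  unfolding components_def
  by (rule frechet_derivative_transition_self[OF preferred_maximal preferred_chart(2)])

lemma vector_of_components_preferred [simp]:
  "p \<in> points A \<Longrightarrow> vector_of_components A (preferred_chart A p) p v = v"
  unfolding vector_of_components_def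
  by (rule frechet_derivative_transition_self[OF preferred_maximal preferred_chart(2)])

lemma slice_chart_maximal: "slice_chart A N c S \<Longrightarrow> c \<in> maximal_atlas A"
  and slice_chart_subspace: "slice_chart A N c S \<Longrightarrow> subspace S"
  by (simp_all add: slice_chart_def)

lemma slice_chart_iff:
  assumes "slice_chart A N c S" "p \<in> fst c"
  shows "snd c p \<in> S \<longleftrightarrow> p \<in> N"
proof
  assume "snd c p \<in> S"
  then have "snd c p \<in> snd c ` (N \<inter> fst c)" using assms by (auto simp: slice_chart_def)
  then show "p \<in> N" using maximal_inj[OF slice_chart_maximal[OF assms(1)]] assms(2) by (auto dest: inj_onD)
next
  assume "p \<in> N"
  then have "snd c p \<in> snd c ` (N \<inter> fst c)" using assms(2) by blast
  then show "snd c p \<in> S" using assms(1) by (auto simp: slice_chart_def)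
qed

text \<open>
  Transition maps between slice charts map slice to slice, so their derivatives do as well, and every
  slice chart at \<open>p\<close> defines the same tangent space.
\<close>

lemma tangent_space_eq:
  assumes c: "slice_chart A N c S" and p: "p \<in> N" "p \<in> fst c"
  shows "tangent_space A N p = {v. components A c p v \<in> S}"
proof -
  have "components A c p v \<in> S" if d: "slice_chart A N d S'" "p \<in> fst d" "components A d p v \<in> S'" for d S' v
  proof -
    note max = slice_chart_maximal[OF d(1)] slice_chart_maximal[OF c]
    have "frechet_derivative (transition d c) (at (snd d p)) (components A d p v) \<in> S"
    proof (rule derivative_in_subspace[OF transition_has_derivative[OF max d(2) p(2)] open_overlap[OF max]
          _ slice_chart_subspace[OF d(1)] _ d(3) slice_chart_subspace[OF c]])
      show "snd d p \<in> snd d ` (fst d \<inter> fst c)" using d p by blast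
      show "snd d p \<in> S'" using slice_chart_iff[OF d(1,2)] p by simp
      show "transition d c y \<in> S" if "y \<in> snd d ` (fst d \<inter> fst c)" "y \<in> S'" for y
        using that slice_chart_iff[OF d(1)] slice_chart_iff[OF c] max by auto
    qed
    then show ?thesis using components_transition[OF max d(2) p(2)] by simp
  qed
  then show ?thesis using c p unfolding tangent_space_def by blast
qed

lemma subspace_tangent_space:
  assumes "slice_chart A N c S" "p \<in> N" "p \<in> fst c"
  shows "subspace (tangent_space A N p)"
  unfolding tangent_space_eq[OF assms]
  using linear_subspace_vimage[OF linear_components slice_chart_subspace[OF assms(1)]]
    slice_chart_maximal[OF assms(1)] assms(3) by (simp add: vimage_def)

end

section \<open>Charts of the tangent bundle\<close>

text \<open>
  A chart \<open>d\<close> of the base, together with a frame along it: \<open>K\<^sub>y\<close> maps fibre coordinates over the point with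
  coordinates \<open>y\<close> to vector components in the chart \<open>c\<close>, and \<open>H\<^sub>y\<close> is its inverse. With \<open>d = c\<close> and the
  identity for \<open>K\<close> this is the tangent chart of \<open>c\<close>, so that one compatibility proof serves the atlas of
  \<open>TM\<close> and the charts adapted to a normal bundle.
\<close>

locale bundle_chart = atlas A for A :: "('a, 'e::euclidean_space) chart set" +
  fixes d c :: "('a, 'e) chart" and K H :: "'e \<Rightarrow> 'e \<Rightarrow> 'e"
  assumes d: "d \<in> maximal_atlas A" and c: "c \<in> A" and dom: "fst d \<subseteq> fst c"
    and linear_K: "y \<in> chart_image d \<Longrightarrow> linear (K y)"
    and HK: "y \<in> chart_image d \<Longrightarrow> H y (K y w) = w"
    and KH: "y \<in> chart_image d \<Longrightarrow> K y (H y w) = w"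
    and smooth_K: "smooth_on (chart_image d) (\<lambda>y. K y w)"
begin

definition chart :: "('a \<times> 'e, 'e \<times> 'e) chart" where
  "chart = (fst d \<times> UNIV, \<lambda>(p, v). (snd d p, H (snd d p) (components A c p v)))"

text \<open>The inverse of the chart (see \<open>chart_inv_Pair\<close>).\<close>

abbreviation point :: "'e \<Rightarrow> 'e \<Rightarrow> 'a \<times> 'e" where
  "point y w \<equiv> (chart_inv d y, vector_of_components A c (chart_inv d y) (K y w))"

lemma c_max: "c \<in> maximal_atlas A"
  using atlas_subset_maximal[OF c] .

lemma fst_chart [simp]: "fst chart = fst d \<times> UNIV"
  by (simp add: chart_def)

lemma snd_chart [simp]: "snd chart (p, v) = (snd d p, H (snd d p) (components A c p v))"
  by (simp add: chart_def)

lemma inj_chart: "inj_on (snd chart) (fst chart)"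
proof (rule inj_onI)
  fix a b assume "a \<in> fst chart" "b \<in> fst chart" "snd chart a = snd chart b"
  then obtain p v q w where ab: "a = (p, v)" "b = (q, w)"
    and *: "p \<in> fst d" "q \<in> fst d" "snd d p = snd d q"
      "H (snd d p) (components A c p v) = H (snd d q) (components A c q w)"
    by (cases a, cases b) auto
  have "p = q" using * maximal_inj[OF d] by (auto dest: inj_onD)
  then have "components A c p v = components A c p w"
    using *(1,4) KH[of "snd d p" "components A c p v"] KH[of "snd d p" "components A c p w"] by auto
  then have "v = w"
    using vector_of_components_components[OF c_max, of p v] vector_of_components_components[OF c_max, of p w]
      *(1) dom by (metis subsetD)
  with \<open>p = q\<close> show "a = b" by (simp add: ab)
qed

lemma chart_point:
  assumes "p \<in> fst d"
  shows "snd chart (point (snd d p) w) = (snd d p, w)"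
  using assms dom d c_max by (auto simp: HK)

lemma chart_inv_Pair:
  assumes "p \<in> fst d"
  shows "chart_inv chart (snd d p, w) = point (snd d p) w"
proof -
  have "chart_inv chart (snd chart (point (snd d p) w)) = point (snd d p) w"
    by (rule inv_into_f_f[OF inj_chart]) (use assms d in simp)
  then show ?thesis by (simp only: chart_point[OF assms])
qed

lemma image_chart: "V \<subseteq> fst d \<Longrightarrow> snd chart ` (V \<times> UNIV) = snd d ` V \<times> UNIV"
proof (intro equalityI subsetI)
  fix z :: "'e \<times> 'e" assume V: "V \<subseteq> fst d" and "z \<in> snd d ` V \<times> UNIV"
  then obtain p w where p: "p \<in> V" "z = (snd d p, w)" by auto
  have "p \<in> fst d" using p V by blast
  then have "z = snd chart (point (snd d p) w)" by (simp only: p(2) chart_point)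
  moreover have "point (snd d p) w \<in> V \<times> UNIV" using p V d by auto
  ultimately show "z \<in> snd chart ` (V \<times> UNIV)" by blast
qed auto

lemma transition_out:
  assumes "p \<in> fst d" "p \<in> fst e" "e \<in> A"
  shows "transition chart (tangent_chart A e) (snd d p, w) =
    (snd e p, frechet_derivative (transition c e) (at (snd c p)) (K (snd d p) w))"
proof -
  have "transition chart (tangent_chart A e) (snd d p, w) = snd (tangent_chart A e) (point (snd d p) w)"
    by (simp only: transition_def chart_inv_Pair[OF assms(1)] comp_apply)
  also have "\<dots> = (snd e p, frechet_derivative (transition c e) (at (snd c p)) (K (snd d p) w))"
    using assms dom d c_max components_transition[OF c_max atlas_subset_maximal[OF assms(3)], of p]
    by (simp add: tangent_chart_def subset_iff)
  finally show ?thesis .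
qed

lemma smooth_transition_dc: "smooth_on (chart_image d) (transition d c)"
  using maximal_compatible(1)[OF d c] dom by (simp add: compatible_def Int_absorb2)

lemma smooth_H: "smooth_on (chart_image d) (\<lambda>y. H y w)"
  using smooth_on_inverse_family[OF _ linear_K HK KH smooth_K] open_overlap[OF d d] by simp

lemma linear_H: "y \<in> chart_image d \<Longrightarrow> linear (H y)"
  by (rule linear_two_sided_inverse[of "K y"]) (auto intro: linear_K HK KH)

end

context atlas
begin

lemma trivial_bundle_chart:
  assumes "c \<in> A"
  shows "bundle_chart A c c (\<lambda>_ v. v) (\<lambda>_ v. v)"
  by unfold_locales (use assms atlas_subset_maximal in \<open>auto intro: smooth_on_const\<close>)

lemma trivial_chart_eq: "c \<in> A \<Longrightarrow> bundle_chart.chart A c c (\<lambda>_ v. v) = tangent_chart A c"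
  by (simp add: bundle_chart.chart_def[OF trivial_bundle_chart] tangent_chart_def)

end

context bundle_chart
begin

lemma transition_in:
  assumes "p \<in> fst d" "p \<in> fst e" "e \<in> A"
  shows "transition (tangent_chart A e) chart (snd e p, v) =
    (snd d p, H (snd d p) (frechet_derivative (transition e c) (at (snd e p)) v))"
proof -
  have "chart_inv (tangent_chart A e) (snd e p, v) = (p, vector_of_components A e p v)"
    using bundle_chart.chart_inv_Pair[OF trivial_bundle_chart[OF assms(3)] assms(2)] assms
      atlas_subset_maximal[OF assms(3)]
    by (simp add: trivial_chart_eq)
  then show ?thesis
    using assms dom atlas_subset_maximal[OF assms(3)]
      components_transition[OF atlas_subset_maximal[OF assms(3)] c_max, of p]
    by (auto simp: transition_def subset_iff)
qed

lemma compatible_tangent_chart: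
  assumes e: "e \<in> A"
  shows "compatible chart (tangent_chart A e)"
proof -
  have e_max: "e \<in> maximal_atlas A" by (rule atlas_subset_maximal[OF e])
  note de = maximal_compatible(1)[OF d e, unfolded compatible_def]
  note ce = maximal_compatible(1)[OF c_max e, unfolded compatible_def]
  let ?V = "fst d \<inter> fst e"
  have V: "fst chart \<inter> fst (tangent_chart A e) = ?V \<times> UNIV"
    by (auto simp: tangent_chart_def)
  have img: "snd chart ` (?V \<times> UNIV) = snd d ` ?V \<times> UNIV" by (rule image_chart) simp
  have img': "snd (tangent_chart A e) ` (?V \<times> UNIV) = snd e ` ?V \<times> UNIV"
    using bundle_chart.image_chart[OF trivial_bundle_chart[OF e], of ?V] by (simp add: trivial_chart_eq[OF e])
  have o: "open (snd d ` ?V \<times> (UNIV :: 'e set))" "open (snd e ` ?V \<times> (UNIV :: 'e set))"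
    using de by (auto intro: open_Times)
  have fst_d: "smooth_on (snd d ` ?V \<times> (UNIV :: 'e set)) fst"
    and snd_d: "smooth_on (snd d ` ?V \<times> (UNIV :: 'e set)) snd"
    using smooth_on_fst[OF o(1) smooth_on_id] smooth_on_snd[OF o(1) smooth_on_id] by simp_all
  have fst_e: "smooth_on (snd e ` ?V \<times> (UNIV :: 'e set)) fst"
    and snd_e: "smooth_on (snd e ` ?V \<times> (UNIV :: 'e set)) snd"
    using smooth_on_fst[OF o(2) smooth_on_id] smooth_on_snd[OF o(2) smooth_on_id] by simp_all
  have "smooth_on (snd d ` ?V \<times> UNIV) (\<lambda>z. (transition d e (fst z),
    frechet_derivative (transition c e) (at (transition d c (fst z))) (K (fst z) (snd z))))"
  proof (intro smooth_on_Pair o)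
    show "smooth_on (snd d ` ?V \<times> (UNIV :: 'e set)) (\<lambda>z. transition d e (fst z))"
      by (rule smooth_on_compose[OF o(1) _ fst_d]) (use de in auto)
    show "smooth_on (snd d ` ?V \<times> (UNIV :: 'e set)) (\<lambda>z. frechet_derivative (transition c e) (at (transition d c (fst z))) (K (fst z) (snd z)))"
    proof (rule smooth_on_frechet_derivative_compose[OF o(1)])
      show "smooth_on (snd c ` (fst c \<inter> fst e)) (transition c e)" using ce by simp
      show "smooth_on (snd d ` ?V \<times> (UNIV :: 'e set)) (\<lambda>z. transition d c (fst z))"
        by (rule smooth_on_compose[OF o(1) smooth_transition_dc fst_d]) auto
      show "(\<lambda>z. transition d c (fst z)) ` (snd d ` ?V \<times> (UNIV :: 'e set)) \<subseteq> snd c ` (fst c \<inter> fst e)"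
        using d dom by auto
      show "smooth_on (snd d ` ?V \<times> (UNIV :: 'e set)) (\<lambda>z. K (fst z) (snd z))"
      proof (rule smooth_on_linear_family[OF o(1) _ _ snd_d])
        show "smooth_on (snd d ` ?V \<times> (UNIV :: 'e set)) (\<lambda>z. K (fst z) b)" for b
          by (rule smooth_on_compose[OF o(1) smooth_K fst_d]) auto
      qed (auto intro: linear_K)
    qed
  qed
  then have out: "smooth_on (snd d ` ?V \<times> UNIV) (transition chart (tangent_chart A e))"
  proof (rule smooth_on_cong[OF _ o(1)])
    fix z :: "'e \<times> 'e" assume "z \<in> snd d ` ?V \<times> UNIV"
    then obtain p w where "p \<in> fst d" "p \<in> fst e" "z = (snd d p, w)" by auto
    then show "(transition d e (fst z),
      frechet_derivative (transition c e) (at (transition d c (fst z))) (K (fst z) (snd z)))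
      = transition chart (tangent_chart A e) z"
      using e d by (simp add: transition_out)
  qed
  have "smooth_on (snd e ` ?V \<times> UNIV) (\<lambda>z. (transition e d (fst z),
    H (transition e d (fst z)) (frechet_derivative (transition e c) (at (fst z)) (snd z))))"
  proof (intro smooth_on_Pair o)
    show tr: "smooth_on (snd e ` ?V \<times> (UNIV :: 'e set)) (\<lambda>z. transition e d (fst z))"
      by (rule smooth_on_compose[OF o(2) _ fst_e]) (use de in auto)
    show "smooth_on (snd e ` ?V \<times> (UNIV :: 'e set)) (\<lambda>z. H (transition e d (fst z)) (frechet_derivative (transition e c) (at (fst z)) (snd z)))"
    proof (rule smooth_on_linear_family[where L = "\<lambda>z. H (transition e d (fst z))", OF o(2)])
      show "linear (H (transition e d (fst z)))" if "z \<in> snd e ` ?V \<times> (UNIV :: 'e set)" for z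
        using that e_max by (auto intro: linear_H)
      show "smooth_on (snd e ` ?V \<times> (UNIV :: 'e set)) (\<lambda>z. H (transition e d (fst z)) b)" for b
        by (rule smooth_on_compose[OF o(2) smooth_H tr]) (use e_max in auto)
      show "smooth_on (snd e ` ?V \<times> (UNIV :: 'e set)) (\<lambda>z. frechet_derivative (transition e c) (at (fst z)) (snd z))"
        by (rule smooth_on_frechet_derivative_compose[OF o(2) _ fst_e _ snd_e, of "snd e ` (fst c \<inter> fst e)"])
          (use ce dom in auto)
    qed
  qed
  then have into: "smooth_on (snd e ` ?V \<times> UNIV) (transition (tangent_chart A e) chart)"
  proof (rule smooth_on_cong[OF _ o(2)])
    fix z :: "'e \<times> 'e" assume "z \<in> snd e ` ?V \<times> UNIV"
    then obtain p w where "p \<in> fst d" "p \<in> fst e" "z = (snd e p, w)" by auto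
    then show "(transition e d (fst z),
    H (transition e d (fst z)) (frechet_derivative (transition e c) (at (fst z)) (snd z)))
      = transition (tangent_chart A e) chart z"
      using e e_max by (simp add: transition_in)
  qed
  show ?thesis
    unfolding compatible_def V img img' using o out into by blast
qed

end

context atlas
begin

lemma fst_tangent_chart [simp]: "fst (tangent_chart A c) = fst c \<times> UNIV"
  by (simp add: tangent_chart_def)

lemma snd_tangent_chart [simp]: "snd (tangent_chart A c) (p, v) = (snd c p, components A c p v)"
  by (simp add: tangent_chart_def)

lemma points_tangent_bundle: "points (tangent_bundle A) = points A \<times> UNIV"
  by (auto simp: points_def tangent_bundle_def)

lemma atlas_tangent_bundle: "atlas (tangent_bundle A)"
proof
  have "inj_on (snd (tangent_chart A c)) (fst (tangent_chart A c))" if "c \<in> A" for c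
    using bundle_chart.inj_chart[OF trivial_bundle_chart[OF that]] by (simp only: trivial_chart_eq[OF that])
  moreover have "compatible (tangent_chart A c) (tangent_chart A e)" if "c \<in> A" "e \<in> A" for c e
    using bundle_chart.compatible_tangent_chart[OF trivial_bundle_chart[OF that(1)] that(2)]
    by (simp only: trivial_chart_eq[OF that(1)])
  ultimately show "smooth_atlas (tangent_bundle A)"
    by (auto simp: smooth_atlas_def tangent_bundle_def)
qed

end

context bundle_chart
begin

sublocale TM: atlas "tangent_bundle A"
  by (rule atlas_tangent_bundle)

lemma chart_maximal: "chart \<in> maximal_atlas (tangent_bundle A)"
  unfolding maximal_atlas_def
proof (intro CollectI conjI ballI)
  show "fst chart \<subseteq> points (tangent_bundle A)"
    using maximal_points[OF d] by (auto simp: points_tangent_bundle)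
  show "inj_on (snd chart) (fst chart)" by (rule inj_chart)
  show "compatible chart e" if "e \<in> tangent_bundle A" for e
    using that compatible_tangent_chart by (auto simp: tangent_bundle_def)
qed

lemma tangent_chart_maximal: "tangent_chart A c \<in> maximal_atlas (tangent_bundle A)"
  using c by (intro TM.atlas_subset_maximal) (simp add: tangent_bundle_def)

text \<open>
  Near the given point the transition to the tangent chart of \<open>c\<close> is \<open>(y, w) \<mapsto> (\<phi>(y), K\<^sub>y w)\<close> with
  \<open>\<phi>\<close> the transition from \<open>d\<close> to \<open>c\<close>.
\<close>

lemma transition_has_derivative_out:
  assumes p: "p \<in> fst d"
  shows "(transition chart (tangent_chart A c) has_derivative (\<lambda>(s, a).
      (frechet_derivative (transition d c) (at (snd d p)) s,
       frechet_derivative (\<lambda>y. K y w) (at (snd d p)) s + K (snd d p) a))) (at (snd d p, w))"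
proof -
  let ?y = "snd d p" and ?O = "chart_image d \<times> (UNIV :: 'e set)"
  have y: "?y \<in> chart_image d" using p by blast
  have O: "open ?O" using open_overlap[OF d d] by (simp add: open_Times)
  have fst: "((\<lambda>z. f (fst z)) has_derivative (\<lambda>z. f' (fst z))) (at (?y, w))"
    if "(f has_derivative f') (at ?y)" for f f' and w :: 'e
    using has_derivative_compose[of fst fst "(?y, w)" UNIV f f'] that
    by (simp add: bounded_linear_imp_has_derivative[OF bounded_linear_fst])
  have d1: "((\<lambda>z. transition d c (fst z)) has_derivative
      (\<lambda>z. frechet_derivative (transition d c) (at ?y) (fst z))) (at (?y, w))"
    by (rule fst[OF smooth_on_has_derivative[OF smooth_transition_dc y]])
  have dK: "((\<lambda>z. K (fst z) b) has_derivative (\<lambda>z. frechet_derivative (\<lambda>y. K y b) (at ?y) (fst z))) (at (?y, w))" for b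
    by (rule fst[OF smooth_on_has_derivative[OF smooth_K y]])
  have "((\<lambda>z. K (fst z) (snd z)) has_derivative
     (\<lambda>h. frechet_derivative (\<lambda>z. K (fst z) (snd (?y, w))) (at (?y, w)) h + K (fst (?y, w)) (snd h))) (at (?y, w))"
    by (rule has_derivative_linear_family[OF O _ _ differentiableI[OF dK] bounded_linear_imp_has_derivative[OF bounded_linear_snd]])
      (use y in \<open>auto intro: linear_K\<close>)
  then have d2: "((\<lambda>z. K (fst z) (snd z)) has_derivative
     (\<lambda>h. frechet_derivative (\<lambda>y. K y w) (at ?y) (fst h) + K ?y (snd h))) (at (?y, w))"
    by (simp add: frechet_derivative_at[OF dK, symmetric])
  have "((\<lambda>z. (transition d c (fst z), K (fst z) (snd z))) has_derivative (\<lambda>(s, a).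
      (frechet_derivative (transition d c) (at ?y) s, frechet_derivative (\<lambda>y. K y w) (at ?y) s + K ?y a))) (at (?y, w))"
    using has_derivative_Pair[OF d1 d2] by (simp add: case_prod_unfold)
  then show ?thesis
  proof (rule has_derivative_transform_within_open[OF _ O])
    fix z assume "z \<in> ?O"
    then obtain q u where q: "q \<in> fst d" "z = (snd d q, u)" by auto
    then have "q \<in> fst c" using dom by auto
    then show "(transition d c (fst z), K (fst z) (snd z)) = transition chart (tangent_chart A c) z"
      using q c_max d transition_out[OF q(1) \<open>q \<in> fst c\<close> c, of u]
      by (simp add: frechet_derivative_transition_self)
  qed (use y in auto)
qed

end

section \<open>Charts adapted to a normal bundle\<close>

text \<open>
  Over \<open>N\<close> the frame sends \<open>S\<close> to \<open>TN\<close> and the orthogonal complement of \<open>S\<close> to \<open>\<nu>N\<close>, so that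
  the total space of \<open>\<nu>N\<close> becomes a linear slice of \<open>TM\<close>.
\<close>

locale adapted_chart = bundle_chart A d c K H
  for A :: "('a, 'e::euclidean_space) chart set" and d c K H +
  fixes N :: "'a set" and \<nu> :: "'a \<Rightarrow> 'e set" and S :: "'e set"
  assumes slice: "slice_chart A N d S"
    and K_tangent: "y \<in> chart_image d \<Longrightarrow> s \<in> S \<Longrightarrow> K y s = frechet_derivative (transition d c) (at y) s"
    and K_normal: "p \<in> N \<Longrightarrow> p \<in> fst d \<Longrightarrow> components A c p ` \<nu> p = K (snd d p) ` (S\<^sup>\<bottom>)"
begin

lemma subspace_S: "subspace S"
  by (rule slice_chart_subspace[OF slice])

lemma mem_normal_iff:
  assumes "p \<in> N" "p \<in> fst d"
  shows "v \<in> \<nu> p \<longleftrightarrow> H (snd d p) (components A c p v) \<in> S\<^sup>\<bottom>"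
proof -
  have "v \<in> \<nu> p \<longleftrightarrow> components A c p v \<in> components A c p ` \<nu> p"
  proof
    assume "components A c p v \<in> components A c p ` \<nu> p"
    then obtain u where "u \<in> \<nu> p" "components A c p v = components A c p u" by blast
    then show "v \<in> \<nu> p"
      using vector_of_components_components[OF c_max, of p] assms dom by (metis subsetD)
  qed blast
  also have "\<dots> \<longleftrightarrow> H (snd d p) (components A c p v) \<in> S\<^sup>\<bottom>"
    unfolding K_normal[OF assms] using HK[of "snd d p"] KH[of "snd d p" "components A c p v"] assms by force
  finally show ?thesis .
qed

lemma mem_total_space_iff:
  assumes "p \<in> fst d"
  shows "(p, v) \<in> total_space N \<nu> \<longleftrightarrow> snd chart (p, v) \<in> S \<times> (S\<^sup>\<bottom>)"
  using slice_chart_iff[OF slice assms] mem_normal_iff[of p v] assms by (auto simp: total_space_def)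

lemma slice_chart_total_space: "slice_chart (tangent_bundle A) (total_space N \<nu>) chart (S \<times> (S\<^sup>\<bottom>))"
  unfolding slice_chart_def
proof (intro conjI chart_maximal subspace_Times subspace_S subspace_orthogonal_comp equalityI subsetI)
  fix z assume "z \<in> snd chart ` (total_space N \<nu> \<inter> fst chart)"
  then show "z \<in> chart_image chart \<inter> S \<times> (S\<^sup>\<bottom>)" using mem_total_space_iff by (auto simp del: snd_chart)
next
  fix z assume "z \<in> chart_image chart \<inter> S \<times> (S\<^sup>\<bottom>)"
  then have z: "z \<in> chart_image chart" "z \<in> S \<times> (S\<^sup>\<bottom>)" by (rule IntD1, rule IntD2)
  obtain \<xi> where \<xi>: "z = snd chart \<xi>" "\<xi> \<in> fst chart" using z(1) by (rule imageE)
  have "fst \<xi> \<in> fst d" using \<xi>(2) by (simp only: fst_chart mem_Times_iff)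
  from mem_total_space_iff[OF this, of "snd \<xi>"] z(2) \<xi>(1) have "\<xi> \<in> total_space N \<nu>"
    by (simp only: prod.collapse)
  then show "z \<in> snd chart ` (total_space N \<nu> \<inter> fst chart)"
    using \<xi> by (intro image_eqI IntI)
qed

lemma tangent_space_total_space:
  assumes "p \<in> fst d" "(p, v) \<in> total_space N \<nu>"
  shows "tangent_space (tangent_bundle A) (total_space N \<nu>) (p, v) =
    {U. components (tangent_bundle A) chart (p, v) U \<in> S \<times> (S\<^sup>\<bottom>)}"
  by (rule TM.tangent_space_eq[OF slice_chart_total_space assms(2)]) (use assms in simp)

text \<open>
  The components of a tangent vector of \<open>TM\<close> in the chart where the complete lift is evaluated.
  For \<open>s \<in> S\<close> and \<open>a \<in> S\<^sup>\<bottom>\<close>, this is the lift of \<open>d\<phi> s\<close> by the normal field with constant coordinates,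
  plus the vertical vector \<open>K a\<close>.
\<close>

lemma components_base:
  assumes p: "p \<in> fst d" and U: "components (tangent_bundle A) chart (p, v) U = (s, a)"
  shows "components (tangent_bundle A) (tangent_chart A c) (p, v) U =
    (frechet_derivative (transition d c) (at (snd d p)) s,
     frechet_derivative (\<lambda>y. K y (H (snd d p) (components A c p v))) (at (snd d p)) s + K (snd d p) a)"
  using TM.components_transition[OF chart_maximal tangent_chart_maximal, of "(p, v)" U] p dom
    frechet_derivative_at[OF transition_has_derivative_out[OF p, of "H (snd d p) (components A c p v)"], symmetric]
  by (simp add: U subset_iff)

lemma tangent_components:
  assumes p: "p \<in> N" "p \<in> fst d" and "X \<in> tangent_space A N p"
  obtains s where "s \<in> S" "components A c p X = frechet_derivative (transition d c) (at (snd d p)) s"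
  using assms components_transition[OF d c_max p(2), of X] dom
  by (auto simp: tangent_space_eq[OF slice p])

lemma components_tangent:
  assumes p: "p \<in> N" "p \<in> fst d" and "s \<in> S"
  obtains X where "X \<in> tangent_space A N p" "components A c p X = frechet_derivative (transition d c) (at (snd d p)) s"
proof
  show "vector_of_components A d p s \<in> tangent_space A N p"
    using assms d by (simp add: tangent_space_eq[OF slice p])
  show "components A c p (vector_of_components A d p s) = frechet_derivative (transition d c) (at (snd d p)) s"
    using components_transition[OF d c_max p(2)] dom assms d by auto
qed

end

section \<open>The complete lift on the total space of a normal bundle\<close>

lemma (in atlas) two_form_coeff_components:
  assumes "c \<in> maximal_atlas A" "p \<in> fst c"
  shows "two_form_coeff A \<sigma> c (snd c p) (components A c p X) (components A c p Y) = \<sigma> p X Y"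
  using assms by (simp add: two_form_coeff_def)

lemma (in atlas) closed_form_on_two_form_coeff:
  assumes \<sigma>: "presymplectic A \<sigma>" and c: "c \<in> A"
  shows "closed_form_on (chart_image c) (two_form_coeff A \<sigma> c)"
proof
  have c': "c \<in> maximal_atlas A" by (rule atlas_subset_maximal[OF c])
  have tf: "bilinear (\<sigma> p)" "\<sigma> p u w = - \<sigma> p w u" if "p \<in> fst c" for p u w
    using \<sigma> maximal_points[OF c' that] unfolding presymplectic_def two_form_def by blast+
  show "open (chart_image c)" using open_overlap[OF c' c'] by simp
  fix x u v w assume x: "x \<in> chart_image c"
  then obtain p where p: "p \<in> fst c" "x = snd c p" by blast
  show "bilinear (two_form_coeff A \<sigma> c x)"
    using tf(1)[OF p(1)] linear_vector_of_components[OF c' p(1)] c' p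
    unfolding bilinear_def two_form_coeff_def
    by (auto intro: linear_compose[unfolded o_def, of _ "\<sigma> p _"] linear_compose[unfolded o_def, of _ "\<lambda>u. \<sigma> p u _"])
  show "two_form_coeff A \<sigma> c x u w = - two_form_coeff A \<sigma> c x w u"
    unfolding two_form_coeff_def p(2) chart_inv_chart[OF c' p(1)] by (rule tf(2)[OF p(1)])
  show "frechet_derivative (\<lambda>y. two_form_coeff A \<sigma> c y v w) (at x) u +
       frechet_derivative (\<lambda>y. two_form_coeff A \<sigma> c y w u) (at x) v +
       frechet_derivative (\<lambda>y. two_form_coeff A \<sigma> c y u v) (at x) w = 0"
    using \<sigma> c x unfolding presymplectic_def ext_deriv_coeff_def by blast
next
  show "smooth_on (chart_image c) (\<lambda>x. two_form_coeff A \<sigma> c x u w)" for u w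
    using \<sigma> c unfolding presymplectic_def two_form_def by blast
qed

context adapted_chart
begin

lemma complete_lift_eq:
  assumes p: "p \<in> fst d" and pref: "c = preferred_chart A p"
    and U: "components (tangent_bundle A) chart (p, v) U = (s, a)"
    and V: "components (tangent_bundle A) chart (p, v) V = (t, b)"
    and y: "y = snd d p" and w: "w = H y (components A c p v)"
  shows "complete_lift A \<sigma> (p, v) U V =
    frechet_derivative (\<lambda>x. two_form_coeff A \<sigma> c x (frechet_derivative (transition d c) (at y) s)
        (frechet_derivative (transition d c) (at y) t)) (at (transition d c y)) (K y w)
    + two_form_coeff A \<sigma> c (transition d c y) (frechet_derivative (transition d c) (at y) s)
        (frechet_derivative (\<lambda>y. K y w) (at y) t + K y b)
    - two_form_coeff A \<sigma> c (transition d c y) (frechet_derivative (transition d c) (at y) t)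
        (frechet_derivative (\<lambda>y. K y w) (at y) s + K y a)"
  unfolding complete_lift_def
  using components_base[OF p U] components_base[OF p V] d p KH[of y "components A c p v"]
  by (simp add: pref[symmetric] w y)

end

locale adapted_chart_form = adapted_chart A d c K H N \<nu> S
  for A :: "('a, 'e::euclidean_space) chart set" and d c K H N \<nu> S +
  fixes \<sigma> :: "'a \<Rightarrow> 'e \<Rightarrow> 'e \<Rightarrow> real"
  assumes presymplectic: "presymplectic A \<sigma>"
begin

sublocale form: closed_form_on "chart_image c" "two_form_coeff A \<sigma> c"
  by (rule closed_form_on_two_form_coeff[OF presymplectic c])

lemma form_tangent_normal:
  assumes orth: "\<And>X Z. X \<in> tangent_space A N p \<Longrightarrow> Z \<in> \<nu> p \<Longrightarrow> \<sigma> p X Z = 0"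
    and p: "p \<in> N" "p \<in> fst d" and "s \<in> S" "w \<in> S\<^sup>\<bottom>"
  shows "two_form_coeff A \<sigma> c (transition d c (snd d p)) (frechet_derivative (transition d c) (at (snd d p)) s) (K (snd d p) w) = 0"
proof -
  obtain X where X: "X \<in> tangent_space A N p"
    "components A c p X = frechet_derivative (transition d c) (at (snd d p)) s"
    using components_tangent[OF p \<open>s \<in> S\<close>] .
  have "K (snd d p) w \<in> components A c p ` \<nu> p" using K_normal[OF p] \<open>w \<in> S\<^sup>\<bottom>\<close> by blast
  then obtain Z where Z: "Z \<in> \<nu> p" "K (snd d p) w = components A c p Z" by blast
  have "p \<in> fst c" using p dom by blast
  then show ?thesis
    using orth[OF X(1) Z(1)] two_form_coeff_components[OF c_max, of p \<sigma> X Z] d p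
    by (simp add: X(2) Z(2))
qed

text \<open>
  The vertical parts contribute \<open>\<sigma>(TN, \<nu>N) = 0\<close>, and what remains is the Lie derivative of \<open>\<sigma>\<close>
  along the normal field with constant coordinates \<open>w\<close>.
\<close>

lemma complete_lift_vanishes:
  assumes orth: "\<And>q X Z. q \<in> N \<Longrightarrow> X \<in> tangent_space A N q \<Longrightarrow> Z \<in> \<nu> q \<Longrightarrow> \<sigma> q X Z = 0"
    and p: "p \<in> fst d" "(p, v) \<in> total_space N \<nu>" and pref: "c = preferred_chart A p"
    and U: "U \<in> tangent_space (tangent_bundle A) (total_space N \<nu>) (p, v)"
    and V: "V \<in> tangent_space (tangent_bundle A) (total_space N \<nu>) (p, v)"
  shows "complete_lift A \<sigma> (p, v) U V = 0"
proof -
  define y where "y = snd d p"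
  define w where "w = H y (components A c p v)"
  let ?\<phi> = "transition d c" and ?\<tau> = "two_form_coeff A \<sigma> c"
  have pN: "p \<in> N" using p by (simp add: total_space_def)
  have y: "y \<in> chart_image d" "y \<in> S" "?\<phi> y \<in> chart_image c"
    using p slice_chart_iff[OF slice p(1)] pN d dom by (auto simp: y_def)
  have w: "w \<in> S\<^sup>\<bottom>" using mem_normal_iff[OF pN p(1), of v] p by (simp add: w_def y_def total_space_def)
  obtain s a where sa: "components (tangent_bundle A) chart (p, v) U = (s, a)" "s \<in> S" "a \<in> S\<^sup>\<bottom>"
    using U tangent_space_total_space[OF p] by auto
  obtain t b where tb: "components (tangent_bundle A) chart (p, v) V = (t, b)" "t \<in> S" "b \<in> S\<^sup>\<bottom>"
    using V tangent_space_total_space[OF p] by auto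
  have vanish: "?\<tau> (?\<phi> (snd d q)) (frechet_derivative ?\<phi> (at (snd d q)) t) (K (snd d q) w) = 0"
    if "q \<in> N" "q \<in> fst d" "t \<in> S" "w \<in> S\<^sup>\<bottom>" for q t w
    using form_tangent_normal[OF orth[OF that(1)] that] .
  have in_c: "?\<phi> ` chart_image d \<subseteq> chart_image c" using d dom by auto
  have lie: "frechet_derivative (\<lambda>x. ?\<tau> x (frechet_derivative ?\<phi> (at y) s) (frechet_derivative ?\<phi> (at y) t)) (at (?\<phi> y)) (K y w)
    + ?\<tau> (?\<phi> y) (frechet_derivative ?\<phi> (at y) s) (frechet_derivative (\<lambda>y. K y w) (at y) t)
    - ?\<tau> (?\<phi> y) (frechet_derivative ?\<phi> (at y) t) (frechet_derivative (\<lambda>y. K y w) (at y) s) = 0"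
  proof (rule form.lie_derivative_vanishes[OF _ y(1) in_c smooth_transition_dc subspace_S y(2) sa(2) tb(2)
        smooth_on_has_derivative[OF smooth_K y(1)]])
    show "open (chart_image d)" using open_overlap[OF d d] by simp
    show "?\<tau> (?\<phi> q) (K q w) (frechet_derivative ?\<phi> (at q) t) = 0"
      if q: "q \<in> chart_image d" "q \<in> S" "t \<in> S" for q t
    proof -
      obtain r where r: "r \<in> fst d" "q = snd d r" using q(1) by blast
      then have "r \<in> N" using slice_chart_iff[OF slice r(1)] q(2) by simp
      from vanish[OF this r(1) q(3) w] form.skew[of "?\<phi> q" "K q w"] show ?thesis
        using in_c q(1) by (force simp: r(2))
    qed
  qed
  have "?\<tau> (?\<phi> y) (frechet_derivative ?\<phi> (at y) s) (K y b) = 0"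
    "?\<tau> (?\<phi> y) (frechet_derivative ?\<phi> (at y) t) (K y a) = 0"
    unfolding y_def by (rule vanish[OF pN p(1)], (rule sa tb)+)+
  then show ?thesis
    using lie complete_lift_eq[OF p(1) pref sa(1) tb(1) y_def w_def, of \<sigma>]
    by (simp add: linear_add[OF form.linear_right[OF y(3)]])
qed

text \<open>
  At a point \<open>(p, 0)\<close> of the zero section, the lift of \<open>X\<close> by the zero field and the vertical vector
  \<open>Z\<close> are both tangent to the total space; on this pair the complete lift is \<open>\<sigma>(X, Z)\<close>.
\<close>

lemma orthogonal_of_complete_lift:
  assumes p: "p \<in> N" "p \<in> fst d" and pref: "c = preferred_chart A p"
    and "0 \<in> \<nu> p"
    and iso: "\<And>U V. U \<in> tangent_space (tangent_bundle A) (total_space N \<nu>) (p, 0) \<Longrightarrow>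
      V \<in> tangent_space (tangent_bundle A) (total_space N \<nu>) (p, 0) \<Longrightarrow> complete_lift A \<sigma> (p, 0) U V = 0"
    and X: "X \<in> tangent_space A N p" and Z: "Z \<in> \<nu> p"
  shows "\<sigma> p X Z = 0"
proof -
  have tot: "(p, 0) \<in> total_space N \<nu>" using p \<open>0 \<in> \<nu> p\<close> by (simp add: total_space_def)
  obtain s where s: "s \<in> S" "components A c p X = frechet_derivative (transition d c) (at (snd d p)) s"
    using tangent_components[OF p X] .
  obtain b where b: "b \<in> S\<^sup>\<bottom>" "components A c p Z = K (snd d p) b"
    using Z K_normal[OF p] by blast
  have y: "snd d p \<in> chart_image d" "p \<in> fst c" using p dom by auto
  have ex: "\<exists>U. components (tangent_bundle A) chart (p, 0) U = z" for z
    by (rule exI, rule TM.components_vector_of_components[OF chart_maximal]) (use p in simp)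
  obtain U V where UV: "components (tangent_bundle A) chart (p, 0) U = (s, 0)"
    "components (tangent_bundle A) chart (p, 0) V = (0, b)"
    using ex by meson
  have "complete_lift A \<sigma> (p, 0) U V = 0"
    by (rule iso) (use UV s b subspace_0[OF subspace_S] subspace_0[OF subspace_orthogonal_comp]
      in \<open>simp_all add: tangent_space_total_space[OF p(2) tot]\<close>)
  moreover have "components A c p 0 = 0" "K (snd d p) 0 = 0" "H (snd d p) 0 = 0"
    using linear_0[OF linear_components[OF c_max y(2)]] linear_0[OF linear_K[OF y(1)]]
      linear_0[OF linear_H[OF y(1)]] by auto
  moreover have "frechet_derivative (transition d c) (at (snd d p)) 0 = 0"
    "frechet_derivative (\<lambda>y. K y 0) (at (snd d p)) 0 = 0"
    using linear_0[OF linear_frechet_derivative_transition[OF d c_max p(2) y(2)]]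
      linear_0[OF linear_frechet_derivative[OF smooth_on_differentiable[OF smooth_K y(1)]]] by auto
  moreover have "frechet_derivative f (at (transition d c (snd d p))) 0 = 0"
      if "f differentiable (at (transition d c (snd d p)))" for f :: "'e \<Rightarrow> real"
    by (rule linear_0[OF linear_frechet_derivative[OF that]])
  moreover have "(\<lambda>x. two_form_coeff A \<sigma> c x u u') differentiable (at (transition d c (snd d p)))" for u u'
    by (rule smooth_on_differentiable[OF form.smooth]) (use y d p in auto)
  moreover have "transition d c (snd d p) \<in> chart_image c" using y d p by auto
  ultimately have "two_form_coeff A \<sigma> c (transition d c (snd d p))
      (frechet_derivative (transition d c) (at (snd d p)) s) (K (snd d p) b) = 0"
    using complete_lift_eq[OF p(2) pref UV refl refl, of \<sigma>] linear_0[OF form.linear_left]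
    by simp
  then show ?thesis
    using two_form_coeff_components[OF c_max y(2), of \<sigma> X Z] s b d p by simp
qed

end

section \<open>Existence of adapted charts\<close>

context atlas
begin

lemma normal_bundleD:
  assumes "normal_bundle A N \<nu>" "p \<in> N"
  shows "subspace (\<nu> p)" "\<nu> p \<inter> tangent_space A N p = {0}"
    "\<And>v. \<exists>z t. z \<in> \<nu> p \<and> t \<in> tangent_space A N p \<and> v = z + t"
proof -
  have *: "subspace (\<nu> p)" "\<nu> p \<inter> tangent_space A N p = {0}"
    "{z + t | z t. z \<in> \<nu> p \<and> t \<in> tangent_space A N p} = UNIV"
    using assms unfolding normal_bundle_def by blast+
  then show "subspace (\<nu> p)" "\<nu> p \<inter> tangent_space A N p = {0}" by blast+
  show "\<exists>z t. z \<in> \<nu> p \<and> t \<in> tangent_space A N p \<and> v = z + t" for v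
    using *(3) UNIV_I[of v] by blast
qed

lemma dim_orthogonal_comp:
  fixes S :: "'e set"
  assumes "subspace S"
  shows "dim (S\<^sup>\<bottom>) + dim S = DIM('e)"
  using dim_subspace_orthogonal_to_vectors[OF assms subspace_UNIV] by (simp add: orthogonal_comp_def)

lemma dim_normal_space:
  assumes \<nu>: "normal_bundle A N \<nu>" and d: "slice_chart A N d S" and p: "p \<in> N" "p \<in> fst d"
  shows "dim (\<nu> p) = dim (S\<^sup>\<bottom>)"
proof -
  note nb = normal_bundleD[OF \<nu> p(1)]
  have d': "d \<in> maximal_atlas A" by (rule slice_chart_maximal[OF d])
  have "tangent_space A N p = vector_of_components A d p ` S"
  proof (intro equalityI subsetI)
    fix v assume "v \<in> tangent_space A N p"
    then show "v \<in> vector_of_components A d p ` S"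
      using vector_of_components_components[OF d' p(2), of v, symmetric]
      by (auto simp: tangent_space_eq[OF d p])
  qed (use d' p in \<open>auto simp: tangent_space_eq[OF d p]\<close>)
  moreover have "inj (vector_of_components A d p)"
    by (rule inj_on_inverseI[of _ "components A d p"]) (use d' p in simp)
  ultimately have T: "dim (tangent_space A N p) = dim S"
    using dim_image_eq[OF linear_vector_of_components[OF d' p(2)]] by (simp add: inj_on_subset)
  have "{x + y |x y. x \<in> \<nu> p \<and> y \<in> tangent_space A N p} = UNIV"
    using nb(3) by blast
  then have "dim (\<nu> p) + dim S = DIM('e)"
    using dim_sums_Int[OF nb(1) subspace_tangent_space[OF d p]] nb(2) T by simp
  then show ?thesis using dim_orthogonal_comp[OF slice_chart_subspace[OF d]] by simp
qed

text \<open>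
  Given a frame \<open>Z\<^sub>i\<close> of \<open>\<nu>N\<close> and an orthonormal basis of the orthogonal complement of \<open>S\<close>, the linear
  map \<open>K\<^sub>y\<close> is the derivative of the transition map on \<open>S\<close> and sends the basis to the frame. It is an
  isomorphism at \<open>p\<^sub>0\<close> because the tangent space of \<open>M\<close> there is the sum of the one of \<open>N\<close> and the fibre of \<open>\<nu>N\<close>, hence also at nearby points, to
  which the chart is restricted.
\<close>

lemma adapted_chart_exists:
  assumes \<nu>: "normal_bundle A N \<nu>" and d0: "slice_chart A N d\<^sub>0 S"
    and p0: "p\<^sub>0 \<in> N" "p\<^sub>0 \<in> fst d\<^sub>0" and c: "c \<in> A" "p\<^sub>0 \<in> fst c"
  obtains d K H where "adapted_chart A d c K H N \<nu> S" "p\<^sub>0 \<in> fst d"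
proof -
  note d0_max = slice_chart_maximal[OF d0] and S = slice_chart_subspace[OF d0]
  have c_max: "c \<in> maximal_atlas A" using c atlas_subset_maximal by blast
  have "\<exists>W Z m. openin (manifold_topology A) W \<and> p\<^sub>0 \<in> W \<and> (\<forall>i<m::nat. vector_field_on A W (Z i)) \<and>
      (\<forall>q\<in>N \<inter> W. \<nu> q = span ((\<lambda>i. Z i q) ` {..<m}) \<and> dim (\<nu> q) = m)"
    using \<nu> p0(1) unfolding normal_bundle_def by (elim conjE bspec)
  then obtain W Z m where W: "openin (manifold_topology A) W" "p\<^sub>0 \<in> W"
    and Z: "\<forall>i<m. vector_field_on A W (Z i)"
    and fr: "\<forall>q\<in>N \<inter> W. \<nu> q = span ((\<lambda>i. Z i q) ` {..<m::nat}) \<and> dim (\<nu> q) = m"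
    by (elim exE conjE)
  note frame = fr[THEN bspec, THEN conjunct1] fr[THEN bspec, THEN conjunct2]
  define V where "V = W \<inter> fst c \<inter> fst d\<^sub>0"
  have V: "openin (manifold_topology A) V"
    unfolding V_def by (intro openin_Int W openin_chart_domain c_max d0_max)
  define U where "U = snd d\<^sub>0 ` V"
  have "open U"
    using open_chart_image[OF d0_max V] by (simp add: U_def V_def Int_absorb2 Int_assoc)
  have mem_U: "p \<in> V" if "p \<in> fst d\<^sub>0" "snd d\<^sub>0 p \<in> U" for p
    using that maximal_inj[OF d0_max] unfolding U_def V_def by (auto dest: inj_onD)
  define \<phi> where "\<phi> = transition d\<^sub>0 c"
  have smooth_\<phi>: "smooth_on U \<phi>"
  proof (rule smooth_on_subset)
    show "smooth_on (snd d\<^sub>0 ` (fst d\<^sub>0 \<inter> fst c)) \<phi>"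
      using maximal_compatible(1)[OF d0_max c(1)] by (simp add: compatible_def \<phi>_def)
  qed (auto simp: U_def V_def)
  have \<phi>: "\<phi> (snd d\<^sub>0 q) = snd c q" if "q \<in> V" for q
    using that d0_max by (simp add: \<phi>_def V_def)
  define f where "f i = vector_field_coeff A (Z i) c" for i
  have f: "f i (snd c q) = components A c q (Z i q)" if "q \<in> fst c" for q i
    using that c_max by (simp add: f_def vector_field_coeff_def)
  have smooth_f: "smooth_on U (\<lambda>y. f i (\<phi> y))" if "i < m" for i
  proof (rule smooth_on_compose[OF \<open>open U\<close> _ smooth_\<phi>])
    show "smooth_on (snd c ` (W \<inter> fst c)) (f i)"
      using Z that c by (simp add: vector_field_on_def f_def)
    show "\<phi> ` U \<subseteq> snd c ` (W \<inter> fst c)" using \<phi> by (auto simp: U_def V_def)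
  qed
  obtain B where B: "B \<subseteq> S\<^sup>\<bottom>" "pairwise orthogonal B" "\<And>x. x \<in> B \<Longrightarrow> norm x = 1"
    "independent B" "card B = dim (S\<^sup>\<bottom>)" "span B = S\<^sup>\<bottom>"
    using orthonormal_basis_subspace[OF subspace_orthogonal_comp] by metis
  have finB: "finite B" using B(4) by (rule independent_imp_finite)
  have "card B = m"
    using dim_normal_space[OF \<nu> d0 p0] frame(2)[of p\<^sub>0] p0 W B(5) by simp
  then obtain h where h: "bij_betw h B {..<m}"
    using ex_bij_betw_finite_nat[OF finB] by (auto simp: atLeast0LessThan)
  define D where "D y = frechet_derivative \<phi> (at y)" for y
  \<comment> \<open>the derivative of the transition map, corrected on the basis \<open>B\<close> of \<open>S\<^sup>\<bottom>\<close> so that \<open>b\<close>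
    is sent to the frame vector with index \<open>h b\<close>\<close>
  define K where "K y w = D y w + (\<Sum>b\<in>B. (w \<bullet> b) *\<^sub>R (f (h b) (\<phi> y) - D y b))" for y w
  have linD: "linear (D y)" if "y \<in> U" for y
    unfolding D_def by (intro linear_frechet_derivative smooth_on_differentiable[OF smooth_\<phi> that])
  have linK: "linear (K y)" if "y \<in> U" for y
    unfolding K_def[abs_def] using linD[OF that]
    by (intro linear_compose_add linear_compose_sum ballI linear_compose[of "\<lambda>w. w \<bullet> _" "\<lambda>r. r *\<^sub>R _", unfolded o_def])
      (auto intro!: linearI simp: inner_add_left scaleR_add_left)
  have smoothK: "smooth_on U (\<lambda>y. K y w)" for w
    unfolding K_def D_def using h
    by (intro smooth_on_add smooth_on_sum smooth_on_bounded_linear[OF bounded_linear_scaleR_right]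
        smooth_on_diff smooth_on_frechet_derivative smooth_\<phi> smooth_f \<open>open U\<close>)
      (auto simp: bij_betw_def)
  have KS: "K y s = D y s" if "s \<in> S" for y s
  proof -
    have "s \<bullet> b = 0" if "b \<in> B" for b
      using B(1) that \<open>s \<in> S\<close> by (auto simp: orthogonal_comp_def orthogonal_def)
    then show ?thesis by (simp add: K_def)
  qed
  have KB: "K y b = f (h b) (\<phi> y)" if "b \<in> B" for y b
  proof -
    have "b \<bullet> b' = (if b' = b then 1 else 0)" if "b' \<in> B" for b'
      using B(2,3) \<open>b \<in> B\<close> that by (auto simp: pairwise_def orthogonal_def norm_eq_1)
    then have "(\<Sum>b'\<in>B. (b \<bullet> b') *\<^sub>R (f (h b') (\<phi> y) - D y b')) =
        (\<Sum>b'\<in>B. if b' = b then f (h b') (\<phi> y) - D y b' else 0)"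
      by (intro sum.cong refl) simp
    then show ?thesis using that finB by (simp add: K_def)
  qed
  have normal: "components A c q ` \<nu> q = K (snd d\<^sub>0 q) ` (S\<^sup>\<bottom>)" if q: "q \<in> N" "q \<in> V" for q
  proof -
    have qc: "q \<in> fst c" and qW: "q \<in> N \<inter> W" and qU: "snd d\<^sub>0 q \<in> U" using q by (auto simp: V_def U_def)
    have "components A c q ` \<nu> q = span (components A c q ` (\<lambda>i. Z i q) ` {..<m})"
      by (simp add: frame(1)[OF qW] linear_span_image[OF linear_components[OF c_max qc]])
    also have "components A c q ` (\<lambda>i. Z i q) ` {..<m} = (\<lambda>i. f i (snd c q)) ` {..<m}"
      by (simp add: image_image f[OF qc])
    also have "\<dots> = K (snd d\<^sub>0 q) ` B"
      using h by (auto simp: KB \<phi>[OF q(2)] bij_betw_def image_image[symmetric, of "\<lambda>i. f i (snd c q)" h B])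
    also have "span \<dots> = K (snd d\<^sub>0 q) ` (S\<^sup>\<bottom>)"
      by (simp add: linear_span_image[OF linK[OF qU]] B(6))
    finally show ?thesis .
  qed
  define y\<^sub>0 where "y\<^sub>0 = snd d\<^sub>0 p\<^sub>0"
  have p0V: "p\<^sub>0 \<in> V" using p0 c W by (simp add: V_def)
  then have y0: "y\<^sub>0 \<in> U" by (simp add: y\<^sub>0_def U_def)
  have "surj (K y\<^sub>0)"
    unfolding surj_def
  proof
    fix u
    obtain z t where zt: "z \<in> \<nu> p\<^sub>0" "t \<in> tangent_space A N p\<^sub>0" "vector_of_components A c p\<^sub>0 u = z + t"
      using normal_bundleD(3)[OF \<nu> p0(1)] by blast
    obtain w where w: "components A c p\<^sub>0 z = K y\<^sub>0 w"
      using normal[OF p0(1) p0V] zt(1) unfolding y\<^sub>0_def by blast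
    have "components A c p\<^sub>0 t = K y\<^sub>0 (components A d\<^sub>0 p\<^sub>0 t)"
      using zt(2) components_transition[OF d0_max c_max p0(2) c(2), of t]
      by (simp add: tangent_space_eq[OF d0 p0] KS D_def \<phi>_def y\<^sub>0_def)
    moreover have "u = components A c p\<^sub>0 (z + t)"
      using zt(3) c_max c(2) by (metis components_vector_of_components)
    ultimately have "u = K y\<^sub>0 (w + components A d\<^sub>0 p\<^sub>0 t)"
      by (simp add: linear_add[OF linear_components[OF c_max c(2)]] linear_add[OF linK[OF y0]] w)
    then show "\<exists>w. u = K y\<^sub>0 w" by (rule exI)
  qed
  then have inj: "inj (K y\<^sub>0)" by (rule linear_surjective_imp_injective[OF linK[OF y0]]) (rule refl)
  obtain T k where T: "open T" "y\<^sub>0 \<in> T" "T \<subseteq> U" "k > 0" "\<And>y w. y \<in> T \<Longrightarrow> k * norm w \<le> norm (K y w)"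
    using linear_family_bounded_below[OF \<open>open U\<close> y0 linK smooth_on_continuous_on[OF smoothK] inj] by blast
  define d where "d = ({p \<in> fst d\<^sub>0. snd d\<^sub>0 p \<in> T}, snd d\<^sub>0)"
  have snd_d: "snd d = snd d\<^sub>0" and fst_d: "p \<in> fst d \<longleftrightarrow> p \<in> fst d\<^sub>0 \<and> snd d\<^sub>0 p \<in> T" for p
    by (auto simp: d_def)
  have dV: "fst d \<subseteq> V" using mem_U T(3) by (auto simp: fst_d)
  have image_d: "chart_image d = T"
    using T(3) by (auto simp: d_def U_def V_def)
  have inj_K: "inj (K y)" if "y \<in> T" for y
  proof (rule linear_injective_0[OF linK, THEN iffD2, rule_format])
    show "y \<in> U" using that T by blast
    show "w = 0" if "K y w = 0" for w
      using T(5)[OF \<open>y \<in> T\<close>, of w] T(4) that by (simp add: mult_le_0_iff)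
  qed
  have surj_K: "surj (K y)" if "y \<in> T" for y
    using inj_K[OF that] linK T(3) that by (intro linear_injective_imp_surjective) auto
  have transition_eq: "frechet_derivative (transition d c) (at y) = D y" if "y \<in> T" for y
    unfolding D_def
  proof (rule frechet_derivative_transform_within_open[OF _ T(1) that, symmetric])
    show "\<phi> differentiable (at y)" using that T(3) by (intro smooth_on_differentiable[OF smooth_\<phi>]) auto
  next
    fix x assume "x \<in> T"
    then obtain q where "q \<in> fst d" "x = snd d q" using image_d by blast
    moreover have "inj_on (snd d) (fst d)"
      unfolding snd_d by (rule inj_on_subset[OF maximal_inj[OF d0_max]]) (auto simp: fst_d)
    ultimately show "\<phi> x = transition d c x"
      using d0_max by (simp add: transition_def \<phi>_def fst_d snd_d)
  qed
  have d_max: "d \<in> maximal_atlas A"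
    unfolding d_def by (rule restricted_chart_maximal[OF d0_max openin_chart_preimage[OF d0_max T(1)]]) auto
  have "adapted_chart A d c K (\<lambda>y. inv (K y)) N \<nu> S"
  proof (intro adapted_chart.intro bundle_chart.intro bundle_chart_axioms.intro adapted_chart_axioms.intro)
    show "atlas A" by (rule atlas_axioms)
    show "d \<in> maximal_atlas A" by (rule d_max)
    show "c \<in> A" by (rule c(1))
    show "fst d \<subseteq> fst c" using dV by (auto simp: V_def)
    show "linear (K y)" if "y \<in> chart_image d" for y
      using that linK T(3) unfolding image_d by blast
    show "inv (K y) (K y w) = w" if "y \<in> chart_image d" for y w
      using that inj_K unfolding image_d by simp
    show "K y (inv (K y) w) = w" if "y \<in> chart_image d" for y w
      using that surj_K unfolding image_d by (simp add: surj_f_inv_f)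
    show "K y s = frechet_derivative (transition d c) (at y) s" if "y \<in> chart_image d" "s \<in> S" for y s
      using that unfolding image_d by (simp add: transition_eq KS)
    show "smooth_on (chart_image d) (\<lambda>y. K y w)" for w
      unfolding image_d by (rule smooth_on_subset[OF smoothK T(3)])
    show "slice_chart A N d S"
      unfolding slice_chart_def
    proof (intro conjI d_max S)
      show "snd d ` (N \<inter> fst d) = chart_image d \<inter> S"
        using slice_chart_iff[OF d0] by (auto simp: fst_d snd_d)
    qed
    show "components A c p ` \<nu> p = K (snd d p) ` (S\<^sup>\<bottom>)" if "p \<in> N" "p \<in> fst d" for p
      using normal[of p] that dV by (auto simp: snd_d)
  qed
  moreover have "p\<^sub>0 \<in> fst d" using p0 T(2) by (simp add: fst_d y\<^sub>0_def)
  ultimately show thesis by (rule that)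
qed

lemma embedded_total_space:
  assumes N: "embedded_submanifold A N" and \<nu>: "normal_bundle A N \<nu>"
  shows "embedded_submanifold (tangent_bundle A) (total_space N \<nu>)"
  unfolding embedded_submanifold_def
proof (intro conjI exI[of _ "DIM('e)"] ballI)
  have NA: "N \<subseteq> points A" using N by (simp add: embedded_submanifold_def)
  then show "total_space N \<nu> \<subseteq> points (tangent_bundle A)"
    by (auto simp: total_space_def points_tangent_bundle)
  fix \<xi> assume \<xi>: "\<xi> \<in> total_space N \<nu>"
  obtain p v where pv: "\<xi> = (p, v)" "p \<in> N" using \<xi> by (auto simp: total_space_def)
  obtain d\<^sub>0 S where d0: "slice_chart A N d\<^sub>0 S" "p \<in> fst d\<^sub>0"
    using N pv(2) unfolding embedded_submanifold_def by blast
  have p: "p \<in> points A" using NA pv by blast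
  obtain d K H where ad: "adapted_chart A d (preferred_chart A p) K H N \<nu> S" and pd: "p \<in> fst d"
    using adapted_chart_exists[OF \<nu> d0(1) pv(2) d0(2) preferred_chart[OF p]] .
  interpret adapted_chart A d "preferred_chart A p" K H N \<nu> S by (rule ad)
  show "\<exists>c S. slice_chart (tangent_bundle A) (total_space N \<nu>) c S \<and> dim S = DIM('e) \<and> \<xi> \<in> fst c"
  proof (intro exI conjI)
    show "slice_chart (tangent_bundle A) (total_space N \<nu>) chart (S \<times> (S\<^sup>\<bottom>))"
      by (rule slice_chart_total_space)
    show "dim (S \<times> (S\<^sup>\<bottom>)) = DIM('e)"
      using dim_orthogonal_comp[OF subspace_S]
      by (simp add: dim_Times[OF subspace_S subspace_orthogonal_comp])
    show "\<xi> \<in> fst chart" using pd pv by simp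
  qed
qed

end

section \<open>Isotropy of the total space\<close>

lemma mem_dirac_of_form: "(X, \<alpha>) \<in> dirac_of_form \<sigma> p \<longleftrightarrow> \<alpha> = \<sigma> p X"
  by (auto simp: dirac_of_form_def)

context atlas
begin

lemma linear_complete_lift:
  assumes \<sigma>: "presymplectic A \<sigma>" and p: "p \<in> points A"
  shows "linear (complete_lift A \<sigma> (p, v) U)"
proof -
  interpret TM: atlas "tangent_bundle A" by (rule atlas_tangent_bundle)
  define c where "c = preferred_chart A p"
  have c: "c \<in> A" "p \<in> fst c" using preferred_chart[OF p] by (simp_all add: c_def)
  interpret form: closed_form_on "chart_image c" "two_form_coeff A \<sigma> c"
    by (rule closed_form_on_two_form_coeff[OF \<sigma> c(1)])
  let ?x = "snd c p" and ?\<tau> = "two_form_coeff A \<sigma> c"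
  have x: "?x \<in> chart_image c" using c by blast
  define L where "L = components (tangent_bundle A) (tangent_chart A c) (p, v)"
  have L: "linear L"
    unfolding L_def using c by (intro TM.linear_components TM.atlas_subset_maximal) (auto simp: tangent_bundle_def)
  have L1: "linear (\<lambda>V. fst (L V))" and L2: "linear (\<lambda>V. snd (L V))"
    using linear_compose[OF L bounded_linear.linear[OF bounded_linear_fst]]
      linear_compose[OF L bounded_linear.linear[OF bounded_linear_snd]] by (simp_all add: o_def)
  have deriv: "linear (\<lambda>w. frechet_derivative (\<lambda>y. ?\<tau> y u w) (at ?x) a)" for u a
    by (rule linear_frechet_derivative_family[OF form.open_C x form.linear_right smooth_on_differentiable[OF form.smooth x]])
  have eq: "complete_lift A \<sigma> (p, v) U = (\<lambda>V. frechet_derivative (\<lambda>y. ?\<tau> y (fst (L U)) (fst (L V))) (at ?x) (components A c p v)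
      + ?\<tau> ?x (fst (L U)) (snd (L V)) - ?\<tau> ?x (fst (L V)) (snd (L U)))"
    by (rule ext) (simp add: complete_lift_def c_def[symmetric] L_def case_prod_unfold Let_def)
  show ?thesis
    unfolding eq using linear_compose[OF L1 deriv] linear_compose[OF L2 form.linear_right[OF x]]
      linear_compose[OF L1 form.linear_left[OF x]]
    by (intro linear_compose_add linear_compose_sub) (simp_all add: o_def)
qed

definition conormal :: "('a \<Rightarrow> 'e \<Rightarrow> 'e \<Rightarrow> real) \<Rightarrow> 'a set \<Rightarrow> ('a \<Rightarrow> 'e set) \<Rightarrow> bool" where
  "conormal \<sigma> N \<nu> \<longleftrightarrow> (\<forall>p\<in>N. \<forall>X\<in>tangent_space A N p. \<forall>Z\<in>\<nu> p. \<sigma> p X Z = 0)"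

text \<open>
  The complete lift is evaluated in the preferred chart at \<open>p\<close>, so an adapted chart built over that
  chart is chosen for every \<open>p\<close>.
\<close>

lemma isotropic_total_space_iff:
  assumes \<sigma>: "presymplectic A \<sigma>" and N: "embedded_submanifold A N" and \<nu>: "normal_bundle A N \<nu>"
  shows "isotropic_submanifold (tangent_bundle A) (dirac_of_form (complete_lift A \<sigma>)) (total_space N \<nu>)
    \<longleftrightarrow> conormal \<sigma> N \<nu>"
proof -
  let ?Q = "total_space N \<nu>" and ?T = "tangent_space (tangent_bundle A) (total_space N \<nu>)"
  have iso: "isotropic_submanifold (tangent_bundle A) (dirac_of_form (complete_lift A \<sigma>)) ?Q \<longleftrightarrow>
    (\<forall>p v U V. (p, v) \<in> ?Q \<longrightarrow> U \<in> ?T (p, v) \<longrightarrow> V \<in> ?T (p, v) \<longrightarrow> complete_lift A \<sigma> (p, v) U V = 0)"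
  proof -
    have "linear (complete_lift A \<sigma> (p, v) U)" if "(p, v) \<in> ?Q" for p v U
      using that N by (intro linear_complete_lift[OF \<sigma>]) (auto simp: total_space_def embedded_submanifold_def)
    then show ?thesis
      using embedded_total_space[OF N \<nu>]
      by (auto simp: isotropic_submanifold_def mem_dirac_of_form annihilator_def)
  qed
  have chart: "\<exists>d K H S. adapted_chart_form A d (preferred_chart A p) K H N \<nu> S \<sigma> \<and> p \<in> fst d"
    if p: "p \<in> N" for p
  proof -
    obtain d\<^sub>0 S where d0: "slice_chart A N d\<^sub>0 S" "p \<in> fst d\<^sub>0"
      using N p unfolding embedded_submanifold_def by blast
    have "p \<in> points A" using N p by (auto simp: embedded_submanifold_def)
    from adapted_chart_exists[OF \<nu> d0(1) p d0(2) preferred_chart[OF this]] obtain d K H where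
      ad: "adapted_chart A d (preferred_chart A p) K H N \<nu> S" and pd: "p \<in> fst d" .
    then have "adapted_chart_form A d (preferred_chart A p) K H N \<nu> S \<sigma>"
      using \<sigma> by (intro adapted_chart_form.intro adapted_chart_form_axioms.intro)
    with pd show ?thesis by blast
  qed
  show ?thesis
    unfolding iso
  proof (intro iffI allI impI)
    assume *: "\<forall>p v U V. (p, v) \<in> ?Q \<longrightarrow> U \<in> ?T (p, v) \<longrightarrow> V \<in> ?T (p, v) \<longrightarrow> complete_lift A \<sigma> (p, v) U V = 0"
    show "conormal \<sigma> N \<nu>"
      unfolding conormal_def
    proof (intro ballI)
      fix p X Z assume p: "p \<in> N" and XZ: "X \<in> tangent_space A N p" "Z \<in> \<nu> p"
      obtain d K H S where ad: "adapted_chart_form A d (preferred_chart A p) K H N \<nu> S \<sigma>" "p \<in> fst d"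
        using chart[OF p] by blast
      interpret adapted_chart_form A d "preferred_chart A p" K H N \<nu> S \<sigma> by (rule ad(1))
      have "0 \<in> \<nu> p" by (rule subspace_0[OF normal_bundleD(1)[OF \<nu> p]])
      moreover have "(p, 0) \<in> ?Q" using p \<open>0 \<in> \<nu> p\<close> by (simp add: total_space_def)
      ultimately show "\<sigma> p X Z = 0"
        using * XZ by (intro orthogonal_of_complete_lift[OF p ad(2) refl]) blast+
    qed
  next
    fix p v U V
    assume orth: "conormal \<sigma> N \<nu>" and pv: "(p, v) \<in> ?Q" and UV: "U \<in> ?T (p, v)" "V \<in> ?T (p, v)"
    have p: "p \<in> N" using pv by (simp add: total_space_def)
    obtain d K H S where ad: "adapted_chart_form A d (preferred_chart A p) K H N \<nu> S \<sigma>" "p \<in> fst d"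
      using chart[OF p] by blast
    interpret adapted_chart_form A d "preferred_chart A p" K H N \<nu> S \<sigma> by (rule ad(1))
    show "complete_lift A \<sigma> (p, v) U V = 0"
      by (rule complete_lift_vanishes[OF _ ad(2) pv refl UV]) (use orth in \<open>simp add: conormal_def\<close>)
  qed
qed

end

section \<open>Proper normalization\<close>

lemma projection_eqI:
  assumes "y \<in> P" "x - y \<in> Q" "\<And>y'. y' \<in> P \<Longrightarrow> x - y' \<in> Q \<Longrightarrow> y' = y"
  shows "projection P Q x = y"
  unfolding projection_def using assms by (intro the_equality) blast+

locale complementary_subspaces =
  fixes P Q :: "'v::real_vector set"
  assumes P: "subspace P" and Q: "subspace Q" and int: "P \<inter> Q = {0}"
    and sum: "\<exists>y z. y \<in> P \<and> z \<in> Q \<and> x = y + z"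
begin

lemma component_unique:
  assumes "y \<in> P" "x - y \<in> Q" "y' \<in> P" "x - y' \<in> Q"
  shows "y' = y"
proof -
  have "(x - y) - (x - y') \<in> Q" using subspace_diff[OF Q assms(2,4)] .
  then have "y' - y \<in> P \<inter> Q" using subspace_diff[OF P assms(3,1)] by simp
  then show ?thesis by (simp add: int)
qed

lemma projection_eq: "y \<in> P \<Longrightarrow> x - y \<in> Q \<Longrightarrow> projection P Q x = y"
  by (rule projection_eqI) (auto intro: component_unique)

lemma projection_mem: "projection P Q x \<in> P" "x - projection P Q x \<in> Q"
proof -
  obtain y z where "y \<in> P" "z \<in> Q" "x = y + z" using sum by blast
  then show "projection P Q x \<in> P" "x - projection P Q x \<in> Q"
    using projection_eq[of y x] by auto
qed

lemma linear_projection: "linear (projection P Q)"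
proof (rule linearI)
  show "projection P Q (a + b) = projection P Q a + projection P Q b" for a b
    using subspace_add[OF Q projection_mem(2)[of a] projection_mem(2)[of b]]
    by (intro projection_eq subspace_add[OF P] projection_mem(1)) (simp add: algebra_simps)
  show "projection P Q (r *\<^sub>R a) = r *\<^sub>R projection P Q a" for r a
    using subspace_scale[OF Q projection_mem(2)[of a], of r]
    by (intro projection_eq subspace_scale[OF P] projection_mem(1)) (simp add: scaleR_diff_right)
qed

text \<open>
  The annihilators of \<open>Q\<close> and \<open>P\<close> are complementary in the dual space. They are treated separately because a linear
  form is here a function, so that the dual space is not a type.
\<close>

lemma projection_annihilator_eq:
  assumes y: "y \<in> annihilator Q" "\<alpha> - y \<in> annihilator P"
  shows "projection (annihilator Q) (annihilator P) \<alpha> = y"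
proof (rule projection_eqI[OF y])
  fix y' assume y': "y' \<in> annihilator Q" "\<alpha> - y' \<in> annihilator P"
  show "y' = y"
  proof
    fix x
    have *: "f x = \<alpha> (projection P Q x)" if f: "f \<in> annihilator Q" "\<alpha> - f \<in> annihilator P" for f
    proof -
      have "f x = f (projection P Q x) + f (x - projection P Q x)"
        using f(1) by (simp add: annihilator_def linear_diff)
      then show ?thesis using f projection_mem[of x] by (simp add: annihilator_def)
    qed
    show "y' x = y x" using *[OF y] *[OF y'] by simp
  qed
qed

lemma projection_annihilator_mem:
  assumes "linear \<alpha>"
  shows "projection (annihilator Q) (annihilator P) \<alpha> \<in> annihilator Q"
proof -
  have lin: "linear (\<lambda>x. \<alpha> (projection P Q x))"
    using linear_compose[OF linear_projection assms] by (simp add: o_def)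
  have "projection P Q x = 0" if "x \<in> Q" for x
    using that by (intro projection_eq) (simp_all add: subspace_0[OF P])
  then have 1: "(\<lambda>x. \<alpha> (projection P Q x)) \<in> annihilator Q"
    using lin linear_0[OF assms] by (simp add: annihilator_def)
  have "projection P Q x = x" if "x \<in> P" for x
    using that by (intro projection_eq) (simp_all add: subspace_0[OF Q])
  then have 2: "\<alpha> - (\<lambda>x. \<alpha> (projection P Q x)) \<in> annihilator P"
    using linear_compose_sub[OF assms lin] by (simp add: annihilator_def fun_diff_def)
  show ?thesis using projection_annihilator_eq[OF 1 2] 1 by simp
qed

end

context atlas
begin

lemma presymplecticD:
  assumes "presymplectic A \<sigma>" "p \<in> points A"
  shows "linear (\<sigma> p X)" "linear (\<lambda>X. \<sigma> p X Y)" "\<sigma> p X Y = - \<sigma> p Y X"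
proof -
  have "bilinear (\<sigma> p)" using assms unfolding presymplectic_def two_form_def by blast
  then show "linear (\<sigma> p X)" "linear (\<lambda>X. \<sigma> p X Y)" by (simp_all add: bilinear_def)
  show "\<sigma> p X Y = - \<sigma> p Y X" using assms unfolding presymplectic_def two_form_def by blast
qed

text \<open>
  Proper normalization says that \<open>X \<mapsto> i(X)\<sigma>\<close> commutes with the projections onto \<open>TN\<close> and
  \<open>ann \<nu>N\<close>. For \<open>X\<close> in \<open>TN\<close> this puts \<open>i(X)\<sigma>\<close> into \<open>ann \<nu>N\<close>. Conversely, if \<open>\<sigma>(TN, \<nu>N) = 0\<close>, then
  \<open>i(X)\<sigma>\<close> lies in \<open>ann \<nu>N\<close> for tangential \<open>X\<close> and in \<open>ann TN\<close> for normal \<open>X\<close>.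
\<close>

lemma properly_normalized_iff:
  assumes \<sigma>: "presymplectic A \<sigma>" and N: "embedded_submanifold A N"
  shows "properly_normalized A (dirac_of_form \<sigma>) N \<nu> \<longleftrightarrow> normal_bundle A N \<nu> \<and> conormal \<sigma> N \<nu>"
proof (cases "normal_bundle A N \<nu>")
  case \<nu>: True
  have "(\<forall>X. projection (annihilator (\<nu> p)) (annihilator (tangent_space A N p)) (\<sigma> p X)
      = \<sigma> p (projection (tangent_space A N p) (\<nu> p) X))
    \<longleftrightarrow> (\<forall>X\<in>tangent_space A N p. \<forall>Z\<in>\<nu> p. \<sigma> p X Z = 0)" (is "?L \<longleftrightarrow> ?R") if p: "p \<in> N" for p
  proof -
    obtain d S where d: "slice_chart A N d S" "p \<in> fst d"
      using N p unfolding embedded_submanifold_def by blast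
    have pA: "p \<in> points A" using N p by (auto simp: embedded_submanifold_def)
    note \<sigma>D = presymplecticD[OF \<sigma> pA]
    interpret complementary_subspaces "tangent_space A N p" "\<nu> p"
    proof
      show "\<exists>y z. y \<in> tangent_space A N p \<and> z \<in> \<nu> p \<and> x = y + z" for x
        using normal_bundleD(3)[OF \<nu> p, of x] by (metis add.commute)
    qed (use subspace_tangent_space[OF d(1) p d(2)] normal_bundleD[OF \<nu> p] in \<open>auto simp: Int_commute\<close>)
    show ?thesis
    proof
      assume L: ?L
      show ?R
      proof (intro ballI)
        fix X Z assume X: "X \<in> tangent_space A N p" and Z: "Z \<in> \<nu> p"
        have "projection (tangent_space A N p) (\<nu> p) X = X"
          using X by (intro projection_eq) (simp_all add: subspace_0[OF Q])
        then have "\<sigma> p X \<in> annihilator (\<nu> p)"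
          using L projection_annihilator_mem[OF \<sigma>D(1)[of X]] by metis
        then show "\<sigma> p X Z = 0" using Z by (simp add: annihilator_def)
      qed
    next
      assume R: ?R
      show ?L
      proof
        fix X
        let ?t = "projection (tangent_space A N p) (\<nu> p) X"
        have "\<sigma> p ?t \<in> annihilator (\<nu> p)"
          using R projection_mem(1)[of X] \<sigma>D(1) by (simp add: annihilator_def)
        moreover have "\<sigma> p X s - \<sigma> p ?t s = 0" if "s \<in> tangent_space A N p" for s
        proof -
          have "\<sigma> p X s - \<sigma> p ?t s = \<sigma> p (X - ?t) s" by (simp add: linear_diff[OF \<sigma>D(2)])
          also have "\<dots> = - \<sigma> p s (X - ?t)" by (rule \<sigma>D(3))
          also have "\<dots> = 0" using R that projection_mem(2)[of X] by simp
          finally show ?thesis .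
        qed
        then have "\<sigma> p X - \<sigma> p ?t \<in> annihilator (tangent_space A N p)"
          using linear_compose_sub[OF \<sigma>D(1) \<sigma>D(1)] by (simp add: annihilator_def fun_diff_def)
        ultimately show "projection (annihilator (\<nu> p)) (annihilator (tangent_space A N p)) (\<sigma> p X) = \<sigma> p ?t"
          by (rule projection_annihilator_eq)
      qed
    qed
  qed
  then show ?thesis
    using \<nu> by (auto simp: properly_normalized_def conormal_def mem_dirac_of_form)
qed (simp add: properly_normalized_def)

end

section \<open>Global extensions of vector fields\<close>

context atlas
begin

lemma openin_points: "openin (manifold_topology A) (points A)"
  unfolding openin_iff
proof (intro conjI ballI subset_refl)
  fix c assume "c \<in> A"
  then have "points A \<inter> fst c = fst c" by (auto simp: points_def)
  then show "open (snd c ` (points A \<inter> fst c))"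
    using open_overlap[of c c] atlas_subset_maximal[OF \<open>c \<in> A\<close>] by simp
qed

lemma topspace_manifold_topology: "topspace (manifold_topology A) = points A"
  using openin_points openin_subset_points unfolding topspace_def by blast

lemma vector_field_on_smooth:
  "vector_field_on A (points A) X \<Longrightarrow> c \<in> A \<Longrightarrow> smooth_on (chart_image c) (vector_field_coeff A X c)"
proof -
  assume "vector_field_on A (points A) X" "c \<in> A"
  moreover from \<open>c \<in> A\<close> have "points A \<inter> fst c = fst c" by (auto simp: points_def)
  ultimately show ?thesis by (auto simp: vector_field_on_def)
qed

lemma vector_field_coeff_chart:
  "c \<in> maximal_atlas A \<Longrightarrow> p \<in> fst c \<Longrightarrow> vector_field_coeff A X c (snd c p) = components A c p (X p)"
  by (simp add: vector_field_coeff_def)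

lemma closedin_chart_compact:
  assumes T2: "Hausdorff_space (manifold_topology A)"
    and c: "c \<in> A" and K: "compact K" "K \<subseteq> chart_image c"
  shows "closedin (manifold_topology A) (chart_inv c ` K)"
proof (rule compactin_imp_closedin[OF T2])
  have c': "c \<in> maximal_atlas A" by (rule atlas_subset_maximal[OF c])
  have "continuous_map (top_of_set (chart_image c)) (manifold_topology A) (chart_inv c)"
    unfolding continuous_map_def
  proof (intro conjI allI impI)
    show "chart_inv c \<in> topspace (top_of_set (chart_image c)) \<rightarrow> topspace (manifold_topology A)"
      using maximal_points[OF c'] c' by (auto simp: topspace_manifold_topology)
    fix W assume W: "openin (manifold_topology A) W"
    have "{x \<in> topspace (top_of_set (chart_image c)). chart_inv c x \<in> W} = snd c ` (W \<inter> fst c)"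
      using c' by auto
    then show "openin (top_of_set (chart_image c)) {x \<in> topspace (top_of_set (chart_image c)). chart_inv c x \<in> W}"
      using open_chart_image[OF c' W] by (auto intro: open_subset)
  qed
  moreover have "compactin (top_of_set (chart_image c)) K"
    using K by (simp add: compactin_subtopology)
  ultimately show "compactin (manifold_topology A) (chart_inv c ` K)"
    using image_compactin by blast
qed

text \<open>
  Extension by zero of the product with a bump function. It is smooth because the support lies in a compact set \<open>K\<close>,
  closed by the Hausdorff property: \<open>U\<close> and the complement of \<open>K\<close> cover the manifold.
\<close>

lemma cut_off_vector_field:
  assumes T2: "Hausdorff_space (manifold_topology A)"
    and U: "openin (manifold_topology A) U" "p \<in> U" and X: "vector_field_on A U X"
  obtains f :: "'a \<Rightarrow> real" where "vector_field_on A (points A) (\<lambda>q. f q *\<^sub>R X q)"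
    "f p = 1" "\<And>q. q \<notin> U \<Longrightarrow> f q = 0"
proof -
  have pA: "p \<in> points A" using U openin_subset_points by blast
  define c where "c = preferred_chart A p"
  have c: "c \<in> A" "p \<in> fst c" using preferred_chart[OF pA] by (simp_all add: c_def)
  have c': "c \<in> maximal_atlas A" by (rule atlas_subset_maximal[OF c(1)])
  define G where "G = snd c ` (U \<inter> fst c)"
  have "open G" unfolding G_def by (rule open_chart_image[OF c' U(1)])
  moreover have "snd c p \<in> G" using U c by (auto simp: G_def)
  ultimately obtain r where r: "r > 0" "cball (snd c p) r \<subseteq> G"
    using open_contains_cball by blast
  obtain \<beta> :: "'e \<Rightarrow> real" where \<beta>: "smooth_on UNIV \<beta>" "\<beta> (snd c p) = 1" "\<And>x. r \<le> dist x (snd c p) \<Longrightarrow> \<beta> x = 0"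
    using bump_function_exists[OF r(1), of "snd c p"] by metis
  define f where "f q = (if q \<in> fst c then \<beta> (snd c q) else 0)" for q
  have f_in: "f q = \<beta> (snd c q)" if "q \<in> fst c" for q
    using that by (simp add: f_def)
  define K where "K = chart_inv c ` cball (snd c p) r"
  have K: "closedin (manifold_topology A) K"
    unfolding K_def by (rule closedin_chart_compact[OF T2 c(1)]) (use r(2) G_def in auto)
  have f0: "f q = 0" if "q \<notin> K" for q
  proof (cases "q \<in> fst c")
    case True
    have "snd c q \<notin> cball (snd c p) r"
      using that c' True unfolding K_def by (metis chart_inv_chart imageI)
    then show ?thesis using True \<beta>(3)[of "snd c q"] by (simp add: f_def dist_commute)
  qed (simp add: f_def)
  have KU: "K \<subseteq> U \<inter> fst c" using r(2) c' by (auto simp: K_def G_def)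
  have "vector_field_on A (points A) (\<lambda>q. f q *\<^sub>R X q)"
    unfolding vector_field_on_def
  proof (intro ballI smooth_on_local)
    fix e x assume e: "e \<in> A" and "x \<in> snd e ` (points A \<inter> fst e)"
    then obtain q where q: "q \<in> points A" "q \<in> fst e" "x = snd e q" by blast
    have e': "e \<in> maximal_atlas A" by (rule atlas_subset_maximal[OF e])
    have coeff: "vector_field_coeff A (\<lambda>q. f q *\<^sub>R X q) e (snd e q) = f q *\<^sub>R vector_field_coeff A X e (snd e q)"
      if "q \<in> fst e" for q
      using that e' by (simp add: vector_field_coeff_chart linear_scale[OF linear_components])
    show "\<exists>T. open T \<and> x \<in> T \<and> smooth_on T (vector_field_coeff A (\<lambda>q. f q *\<^sub>R X q) e)"
    proof (cases "q \<in> K")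
      case True
      define V where "V = U \<inter> fst c"
      have V: "openin (manifold_topology A) V"
        unfolding V_def by (intro openin_Int U openin_chart_domain c')
      let ?T = "snd e ` (V \<inter> fst e)"
      have T: "open ?T" by (rule open_chart_image[OF e' V])
      have "smooth_on ?T (\<lambda>x. \<beta> (transition e c x) *\<^sub>R vector_field_coeff A X e x)"
      proof (intro smooth_on_scaleR T)
        show "smooth_on ?T (\<lambda>x. \<beta> (transition e c x))"
        proof (rule smooth_on_compose[OF T \<beta>(1)])
          show "smooth_on ?T (transition e c)"
            by (rule smooth_on_subset[of "snd e ` (fst e \<inter> fst c)"])
              (use maximal_compatible(1)[OF e' c(1)] in \<open>auto simp: compatible_def V_def\<close>)
        qed simp
        show "smooth_on ?T (vector_field_coeff A X e)"
          by (rule smooth_on_subset[of "snd e ` (U \<inter> fst e)"])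
            (use X e in \<open>auto simp: vector_field_on_def V_def\<close>)
      qed
      then have "smooth_on ?T (vector_field_coeff A (\<lambda>q. f q *\<^sub>R X q) e)"
        by (rule smooth_on_cong[OF _ T]) (use e' f_in in \<open>auto simp: coeff V_def\<close>)
      moreover have "x \<in> ?T" using True KU q by (auto simp: V_def)
      ultimately show ?thesis using T by blast
    next
      case False
      have V: "openin (manifold_topology A) (points A - K)"
        using K by (simp add: closedin_def topspace_manifold_topology)
      let ?T = "snd e ` ((points A - K) \<inter> fst e)"
      have T: "open ?T" by (rule open_chart_image[OF e' V])
      have "smooth_on ?T (vector_field_coeff A (\<lambda>q. f q *\<^sub>R X q) e)"
        by (rule smooth_on_cong[OF smooth_on_const[of _ 0] T]) (auto simp: coeff f0)
      moreover have "x \<in> ?T" using False q by auto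
      ultimately show ?thesis using T by blast
    qed
  qed
  moreover have "f p = 1" using c \<beta> by (simp add: f_def)
  moreover have "f q = 0" if "q \<notin> U" for q using f0 KU that by blast
  ultimately show thesis by (rule that)
qed

lemma vector_field_on_sum:
  assumes W: "openin (manifold_topology A) W" and X: "\<And>i. i \<in> I \<Longrightarrow> vector_field_on A W (X i)"
  shows "vector_field_on A W (\<lambda>q. \<Sum>i\<in>I. a i *\<^sub>R X i q)"
  unfolding vector_field_on_def
proof
  fix c assume c: "c \<in> A"
  have c': "c \<in> maximal_atlas A" by (rule atlas_subset_maximal[OF c])
  let ?T = "snd c ` (W \<inter> fst c)"
  have T: "open ?T" by (rule open_chart_image[OF c' W])
  have "smooth_on ?T (\<lambda>x. \<Sum>i\<in>I. a i *\<^sub>R vector_field_coeff A (X i) c x)"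
    using X c by (intro smooth_on_sum smooth_on_bounded_linear[OF bounded_linear_scaleR_right] T)
      (auto simp: vector_field_on_def)
  then show "smooth_on ?T (vector_field_coeff A (\<lambda>q. \<Sum>i\<in>I. a i *\<^sub>R X i q) c)"
    by (rule smooth_on_cong[OF _ T])
      (use c' in \<open>auto simp: vector_field_coeff_chart linear_sum[OF linear_components] linear_scale[OF linear_components]\<close>)
qed

text \<open>
  A constant combination of a local frame, cut off. Outside the domain of the frame the field is zero, which
  is an element of every fibre of \<open>\<nu>N\<close>, so it is normal along all of \<open>N\<close>.
\<close>

lemma normal_extension_exists:
  assumes T2: "Hausdorff_space (manifold_topology A)"
    and \<nu>: "normal_bundle A N \<nu>" and p: "p \<in> N" and Z: "Z \<in> \<nu> p"
  obtains Z' where "normal_extension A N \<nu> p Z Z'"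
proof -
  have "\<exists>W F m. openin (manifold_topology A) W \<and> p \<in> W \<and> (\<forall>i<m::nat. vector_field_on A W (F i)) \<and>
      (\<forall>q\<in>N \<inter> W. \<nu> q = span ((\<lambda>i. F i q) ` {..<m}) \<and> dim (\<nu> q) = m)"
    using \<nu> p unfolding normal_bundle_def by (elim conjE bspec)
  then obtain W F m where W: "openin (manifold_topology A) W" "p \<in> W"
    and F: "\<forall>i<m. vector_field_on A W (F i)"
    and fr: "\<forall>q\<in>N \<inter> W. \<nu> q = span ((\<lambda>i. F i q) ` {..<m::nat}) \<and> dim (\<nu> q) = m"
    by (elim exE conjE)
  define B where "B = (\<lambda>i. F i p) ` {..<m}"
  have "Z \<in> span B" using Z fr p W by (auto simp: B_def)
  then obtain u where u: "Z = (\<Sum>b\<in>B. u b *\<^sub>R b)"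
    using span_finite[of B] by (auto simp: B_def)
  have "\<forall>b\<in>B. \<exists>i<m. F i p = b" by (auto simp: B_def)
  then obtain g where g: "\<And>b. b \<in> B \<Longrightarrow> g b < m \<and> F (g b) p = b" by metis
  define Y where "Y q = (\<Sum>b\<in>B. u b *\<^sub>R F (g b) q)" for q
  have "vector_field_on A W Y"
    unfolding Y_def using F g by (intro vector_field_on_sum W) auto
  then obtain f where
    f: "vector_field_on A (points A) (\<lambda>q. f q *\<^sub>R Y q)" "f p = 1" "\<And>q. q \<notin> W \<Longrightarrow> f q = 0"
    using cut_off_vector_field[OF T2 W] by blast
  have "normal_extension A N \<nu> p Z (\<lambda>q. f q *\<^sub>R Y q)"
    unfolding normal_extension_def
  proof (intro conjI ballI f(1))
    show "f p *\<^sub>R Y p = Z" using g by (simp add: f(2) Y_def u)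
    fix q assume q: "q \<in> N"
    have "Y q \<in> \<nu> q" if "q \<in> W"
    proof -
      have "\<nu> q = span ((\<lambda>i. F i q) ` {..<m})" using fr q that by blast
      then show ?thesis unfolding Y_def using g by (simp only:) (intro span_sum span_scale span_base, blast)
    qed
    then show "f q *\<^sub>R Y q \<in> \<nu> q"
      using f(3)[of q] normal_bundleD(1)[OF \<nu> q] by (cases "q \<in> W") (auto simp: subspace_scale subspace_0)
  qed
  then show thesis by (rule that)
qed

text \<open>
  In a slice chart, a vector field with constant components in \<open>S\<close> is tangent to \<open>N\<close>; it is then cut off.
\<close>

lemma tangential_extension_exists:
  assumes T2: "Hausdorff_space (manifold_topology A)"
    and N: "embedded_submanifold A N" and p: "p \<in> N" and X: "X \<in> tangent_space A N p"
  obtains X' where "vector_field_on A (points A) X'" "\<And>q. q \<in> N \<Longrightarrow> X' q \<in> tangent_space A N q" "X' p = X"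
proof -
  obtain d S where d: "slice_chart A N d S" "p \<in> fst d"
    using N p unfolding embedded_submanifold_def by blast
  have d': "d \<in> maximal_atlas A" by (rule slice_chart_maximal[OF d(1)])
  define s where "s = components A d p X"
  have s: "s \<in> S" using X by (simp add: s_def tangent_space_eq[OF d(1) p d(2)])
  define Y where "Y q = vector_of_components A d q s" for q
  have "vector_field_on A (fst d) Y"
    unfolding vector_field_on_def
  proof
    fix e assume e: "e \<in> A"
    have e': "e \<in> maximal_atlas A" by (rule atlas_subset_maximal[OF e])
    note de = maximal_compatible(1)[OF d' e, unfolded compatible_def]
    let ?T = "snd e ` (fst d \<inter> fst e)"
    have T: "open ?T" using de by blast
    have "smooth_on ?T (\<lambda>x. frechet_derivative (transition d e) (at (transition e d x)) s)"
      by (rule smooth_on_compose[OF T smooth_on_frechet_derivative]) (use de e' in auto)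
    then show "smooth_on ?T (vector_field_coeff A Y e)"
    proof (rule smooth_on_cong[OF _ T])
      fix x assume "x \<in> ?T"
      then obtain q where q: "q \<in> fst d" "q \<in> fst e" "x = snd e q" by blast
      then show "frechet_derivative (transition d e) (at (transition e d x)) s = vector_field_coeff A Y e x"
        using components_transition[OF d' e' q(1,2), of "Y q"] d' e'
        by (simp add: vector_field_coeff_chart Y_def)
    qed
  qed
  then obtain f where
    f: "vector_field_on A (points A) (\<lambda>q. f q *\<^sub>R Y q)" "f p = 1" "\<And>q. q \<notin> fst d \<Longrightarrow> f q = 0"
    using cut_off_vector_field[OF T2 openin_chart_domain[OF d'] d(2)] by blast
  show thesis
  proof (rule that[OF f(1)])
    show "f p *\<^sub>R Y p = X" using d d' by (simp add: f(2) Y_def s_def)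
    fix q assume q: "q \<in> N"
    obtain e R where e: "slice_chart A N e R" "q \<in> fst e"
      using N q unfolding embedded_submanifold_def by blast
    have "Y q \<in> tangent_space A N q" if "q \<in> fst d"
      using that s d' by (simp add: tangent_space_eq[OF d(1) q] Y_def)
    then show "f q *\<^sub>R Y q \<in> tangent_space A N q"
      using f(3)[of q] subspace_tangent_space[OF e(1) q e(2)] by (cases "q \<in> fst d") (auto simp: subspace_scale subspace_0)
  qed
qed

lemma one_form_interior_product:
  assumes \<sigma>: "presymplectic A \<sigma>" and X: "vector_field_on A (points A) X"
  shows "one_form A (\<lambda>q. \<sigma> q (X q))"
  unfolding one_form_def
proof (intro conjI ballI allI)
  show "linear (\<sigma> p (X p))" if "p \<in> points A" for p by (rule presymplecticD(1)[OF \<sigma> that])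
  fix c u assume c: "c \<in> A"
  have c': "c \<in> maximal_atlas A" by (rule atlas_subset_maximal[OF c])
  interpret form: closed_form_on "chart_image c" "two_form_coeff A \<sigma> c"
    by (rule closed_form_on_two_form_coeff[OF \<sigma> c])
  have "smooth_on (chart_image c) (\<lambda>x. two_form_coeff A \<sigma> c x (vector_field_coeff A X c x) u)"
    by (rule smooth_on_linear_family[where L = "\<lambda>x a. two_form_coeff A \<sigma> c x a u",
        OF form.open_C form.linear_left form.smooth vector_field_on_smooth[OF X c]])
  then show "smooth_on (chart_image c) (\<lambda>x. one_form_coeff A (\<lambda>q. \<sigma> q (X q)) c x u)"
  proof (rule smooth_on_cong[OF _ form.open_C])
    fix x assume "x \<in> chart_image c"
    then obtain q where q: "q \<in> fst c" "x = snd c q" by blast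
    then show "two_form_coeff A \<sigma> c x (vector_field_coeff A X c x) u = one_form_coeff A (\<lambda>q. \<sigma> q (X q)) c x u"
      using c' by (simp add: two_form_coeff_def one_form_coeff_def vector_field_coeff_chart)
  qed
qed

text \<open>
  For a tangential field \<open>X\<close> the section \<open>(X, i(X)\<sigma>)\<close> of the Dirac structure lies over \<open>N\<close> in \<open>TN \<oplus> ann \<nu>N\<close>, because
  \<open>\<sigma>(TN, \<nu>N) = 0\<close>.
\<close>

lemma dirac_extension_exists:
  assumes T2: "Hausdorff_space (manifold_topology A)" and \<sigma>: "presymplectic A \<sigma>"
    and N: "embedded_submanifold A N" and orth: "conormal \<sigma> N \<nu>"
    and p: "p \<in> N" and \<Phi>: "\<Phi> \<in> tangential_part A (dirac_of_form \<sigma>) N \<nu> p"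
  obtains X' \<alpha>' where "dirac_extension A (dirac_of_form \<sigma>) N \<nu> p \<Phi> X' \<alpha>'"
proof -
  have NA: "N \<subseteq> points A" using N by (simp add: embedded_submanifold_def)
  obtain X where X: "\<Phi> = (X, \<sigma> p X)" "X \<in> tangent_space A N p"
    using \<Phi> by (auto simp: tangential_part_def dirac_of_form_def)
  obtain X' where X': "vector_field_on A (points A) X'" "\<And>q. q \<in> N \<Longrightarrow> X' q \<in> tangent_space A N q" "X' p = X"
    using tangential_extension_exists[OF T2 N p X(2)] by metis
  have "dirac_extension A (dirac_of_form \<sigma>) N \<nu> p \<Phi> X' (\<lambda>q. \<sigma> q (X' q))"
    unfolding dirac_extension_def
  proof (intro conjI ballI X'(1) one_form_interior_product[OF \<sigma> X'(1)])
    show "(X' p, \<sigma> p (X' p)) = \<Phi>" by (simp add: X X')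
    show "(X' q, \<sigma> q (X' q)) \<in> tangential_part A (dirac_of_form \<sigma>) N \<nu> q" if "q \<in> N" for q
      using that X'(2)[OF that] orth presymplecticD(1)[OF \<sigma>] NA
      by (auto simp: tangential_part_def mem_dirac_of_form annihilator_def conormal_def)
  qed (simp add: mem_dirac_of_form)
  then show thesis by (rule that)
qed

section \<open>Vanishing of the second fundamental form\<close>

text \<open>
  In the preferred chart at \<open>p\<close> the product rule turns the expression into
  \<open>(\<partial>\<^sub>Z\<sigma>)(X, Y) + \<sigma>(X, \<partial>\<^sub>YZ) - \<sigma>(Y, \<partial>\<^sub>XZ)\<close>, the derivatives of the extensions of \<open>X\<close> and \<open>Y\<close> cancelling.
  This is \<open>(L\<^sub>Z\<sigma>)(X, Y)\<close>, and the field \<open>Z\<close> satisfies \<open>\<sigma>(Z, TN) = 0\<close> along \<open>N\<close>.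
\<close>

lemma second_fundamental_expression_eq_0:
  assumes \<sigma>: "presymplectic A \<sigma>" and N: "embedded_submanifold A N" and orth: "conormal \<sigma> N \<nu>"
    and p: "p \<in> N"
    and Z': "normal_extension A N \<nu> p Z Z'"
    and X': "dirac_extension A (dirac_of_form \<sigma>) N \<nu> p \<Phi> X' \<alpha>'"
    and Y': "dirac_extension A (dirac_of_form \<sigma>) N \<nu> p \<Psi> Y' \<beta>'"
  shows "directional_derivative A p Z (\<lambda>q. \<alpha>' q (Y' q)) - snd \<Phi> (lie_bracket A Z' Y' p)
    + snd \<Psi> (lie_bracket A Z' X' p) = 0"
proof -
  have NA: "N \<subseteq> points A" using N by (simp add: embedded_submanifold_def)
  have pA: "p \<in> points A" using p NA by blast
  define c where "c = preferred_chart A p"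
  have c: "c \<in> A" "p \<in> fst c" using preferred_chart[OF pA] by (simp_all add: c_def)
  have c': "c \<in> maximal_atlas A" by (rule atlas_subset_maximal[OF c(1)])
  interpret form: closed_form_on "chart_image c" "two_form_coeff A \<sigma> c"
    by (rule closed_form_on_two_form_coeff[OF \<sigma> c(1)])
  let ?\<tau> = "two_form_coeff A \<sigma> c" and ?x = "snd c p"
  have x: "?x \<in> chart_image c" using c by blast
  have vf: "vector_field_on A (points A) X'" "vector_field_on A (points A) Y'" "vector_field_on A (points A) Z'"
    using X' Y' Z' by (simp_all add: dirac_extension_def normal_extension_def)
  have \<alpha>': "\<alpha>' q = \<sigma> q (X' q)" if "q \<in> points A" for q
    using X' that by (auto simp: dirac_extension_def mem_dirac_of_form)
  have \<Phi>: "snd \<Phi> = \<sigma> p (X' p)" and \<Psi>: "snd \<Psi> = \<sigma> p (Y' p)"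
    using X' Y' pA by (auto simp: dirac_extension_def mem_dirac_of_form)
  have Zp: "Z' p = Z" using Z' by (simp add: normal_extension_def)
  define DX where "DX = frechet_derivative (vector_field_coeff A X' c) (at ?x)"
  define DY where "DY = frechet_derivative (vector_field_coeff A Y' c) (at ?x)"
  define DZ where "DZ = frechet_derivative (vector_field_coeff A Z' c) (at ?x)"
  have DX: "(vector_field_coeff A X' c has_derivative DX) (at ?x)"
    and DY: "(vector_field_coeff A Y' c has_derivative DY) (at ?x)"
    and DZ: "(vector_field_coeff A Z' c has_derivative DZ) (at ?x)"
    unfolding DX_def DY_def DZ_def by (intro smooth_on_has_derivative[OF vector_field_on_smooth x] vf c)+
  have at_p: "vector_field_coeff A V c ?x = V p" for V
    using pA c' c(2) by (simp add: vector_field_coeff_chart) (simp add: c_def)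
  have \<sigma>_p: "\<sigma> p u w = ?\<tau> ?x u w" for u w
    using two_form_coeff_components[OF c' c(2), of \<sigma> u w] pA by (simp add: c_def)
  have "((\<lambda>y. ?\<tau> y (vector_field_coeff A X' c y) (vector_field_coeff A Y' c y)) has_derivative
    (\<lambda>h. frechet_derivative (\<lambda>x. ?\<tau> x (X' p) (Y' p)) (at ?x) h + ?\<tau> ?x (DX h) (Y' p) + ?\<tau> ?x (X' p) (DY h))) (at ?x)"
    using form.has_derivative_pullback[OF form.open_C x _ _ has_derivative_ident DX DY]
    by (simp add: at_p continuous_on_id)
  then have "((\<lambda>q. \<alpha>' q (Y' q)) \<circ> chart_inv c has_derivative
    (\<lambda>h. frechet_derivative (\<lambda>x. ?\<tau> x (X' p) (Y' p)) (at ?x) h + ?\<tau> ?x (DX h) (Y' p) + ?\<tau> ?x (X' p) (DY h))) (at ?x)"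
  proof (rule has_derivative_transform_within_open[OF _ form.open_C x])
    fix y assume "y \<in> chart_image c"
    then obtain q where q: "q \<in> fst c" "y = snd c q" by blast
    then show "?\<tau> y (vector_field_coeff A X' c y) (vector_field_coeff A Y' c y) = ((\<lambda>q. \<alpha>' q (Y' q)) \<circ> chart_inv c) y"
      using c' \<alpha>'[OF maximal_points[OF c' q(1)]]
      by (simp add: vector_field_coeff_chart two_form_coeff_components)
  qed
  from fun_cong[OF frechet_derivative_at[OF this], of Z, symmetric]
  have dd: "directional_derivative A p Z (\<lambda>q. \<alpha>' q (Y' q)) =
    frechet_derivative (\<lambda>x. ?\<tau> x (X' p) (Y' p)) (at ?x) Z + ?\<tau> ?x (DX Z) (Y' p) + ?\<tau> ?x (X' p) (DY Z)"
    by (simp add: directional_derivative_def c_def)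
  have lb: "lie_bracket A Z' Y' p = DY Z - DZ (Y' p)" "lie_bracket A Z' X' p = DX Z - DZ (X' p)"
    by (simp_all add: lie_bracket_def c_def[symmetric] at_p DX_def DY_def DZ_def Zp Let_def)
  obtain d S where d: "slice_chart A N d S" "p \<in> fst d"
    using N p unfolding embedded_submanifold_def by blast
  have d': "d \<in> maximal_atlas A" by (rule slice_chart_maximal[OF d(1)])
  let ?\<phi> = "transition d c" and ?U = "snd d ` (fst d \<inter> fst c)" and ?y = "snd d p"
  have tangent: "components A d q V \<in> S" "frechet_derivative ?\<phi> (at (snd d q)) (components A d q V) = components A c q V"
    if "q \<in> N" "q \<in> fst d" "q \<in> fst c" "V \<in> tangent_space A N q" for q V
    using that components_transition[OF d' c' that(2,3), of V] by (simp_all add: tangent_space_eq[OF d(1)])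
  have XY: "X' p \<in> tangent_space A N p" "Y' p \<in> tangent_space A N p"
    using X' Y' p by (auto simp: dirac_extension_def tangential_part_def)
  define s where "s = components A d p (X' p)"
  define t where "t = components A d p (Y' p)"
  have st: "s \<in> S" "t \<in> S" "frechet_derivative ?\<phi> (at ?y) s = X' p" "frechet_derivative ?\<phi> (at ?y) t = Y' p"
    using tangent[OF p d(2) c(2)] XY pA by (auto simp: s_def t_def c_def)
  have \<phi>_y: "?\<phi> ?y = ?x" using d d' by simp
  have "frechet_derivative (\<lambda>x. ?\<tau> x (frechet_derivative ?\<phi> (at ?y) s) (frechet_derivative ?\<phi> (at ?y) t)) (at (?\<phi> ?y)) (vector_field_coeff A Z' c (?\<phi> ?y))
    + ?\<tau> (?\<phi> ?y) (frechet_derivative ?\<phi> (at ?y) s) (DZ (frechet_derivative ?\<phi> (at ?y) t))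
    - ?\<tau> (?\<phi> ?y) (frechet_derivative ?\<phi> (at ?y) t) (DZ (frechet_derivative ?\<phi> (at ?y) s)) = 0"
  proof (rule form.lie_derivative_vanishes[OF _ _ _ _ slice_chart_subspace[OF d(1)] _ st(1,2)])
    show "open ?U" by (rule open_overlap[OF d' c'])
    show "?y \<in> ?U" using d c by blast
    show "?\<phi> ` ?U \<subseteq> chart_image c" using d' by auto
    show "smooth_on ?U ?\<phi>" using maximal_compatible(1)[OF d' c(1)] by (simp add: compatible_def)
    show "?y \<in> S" using slice_chart_iff[OF d] p by simp
    show "((\<lambda>y. vector_field_coeff A Z' c (?\<phi> y)) has_derivative (\<lambda>h. DZ (frechet_derivative ?\<phi> (at ?y) h))) (at ?y)"
      by (rule has_derivative_compose[OF transition_has_derivative[OF d' c' d(2) c(2)]]) (simp add: \<phi>_y DZ)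
    fix y w assume y: "y \<in> ?U" "y \<in> S" "w \<in> S"
    then obtain q where q: "q \<in> fst d" "q \<in> fst c" "y = snd d q" by blast
    have qN: "q \<in> N" using slice_chart_iff[OF d(1) q(1)] y(2) q(3) by simp
    define V where "V = vector_of_components A d q w"
    have V: "V \<in> tangent_space A N q" "components A d q V = w"
      using q d' y(3) by (simp_all add: V_def tangent_space_eq[OF d(1) qN q(1)])
    have "Z' q \<in> \<nu> q" using Z' qN by (simp add: normal_extension_def)
    then have "\<sigma> q V (Z' q) = 0" using orth qN V(1) by (simp add: conormal_def)
    moreover have "\<sigma> q (Z' q) V = - \<sigma> q V (Z' q)" using NA qN by (intro presymplecticD(3)[OF \<sigma>]) blast
    ultimately have "\<sigma> q (Z' q) V = 0" by simp
    then show "?\<tau> (?\<phi> y) (vector_field_coeff A Z' c (?\<phi> y)) (frechet_derivative ?\<phi> (at y) w) = 0"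
      using two_form_coeff_components[OF c' q(2), of \<sigma> "Z' q" V] tangent(2)[OF qN q(1,2) V(1)] q d' c'
      by (simp add: V(2) vector_field_coeff_chart)
  qed
  then have "frechet_derivative (\<lambda>x. ?\<tau> x (X' p) (Y' p)) (at ?x) Z + ?\<tau> ?x (X' p) (DZ (Y' p)) - ?\<tau> ?x (Y' p) (DZ (X' p)) = 0"
    by (simp only: st \<phi>_y at_p Zp)
  then show ?thesis
    using form.skew[OF x, of "DX Z" "Y' p"]
    by (simp add: dd lb \<Phi> \<Psi> \<sigma>_p linear_diff[OF form.linear_right[OF x]])
qed

text \<open>
  The definite description denotes \<open>0\<close>: every choice of extensions gives this value, and extensions exist.
\<close>

lemma second_fundamental_form_eq_0:
  assumes T2: "Hausdorff_space (manifold_topology A)" and \<sigma>: "presymplectic A \<sigma>"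
    and N: "embedded_submanifold A N" and \<nu>: "normal_bundle A N \<nu>" and orth: "conormal \<sigma> N \<nu>"
    and p: "p \<in> N" and Z: "Z \<in> \<nu> p"
    and \<Phi>: "\<Phi> \<in> tangential_part A (dirac_of_form \<sigma>) N \<nu> p"
    and \<Psi>: "\<Psi> \<in> tangential_part A (dirac_of_form \<sigma>) N \<nu> p"
  shows "second_fundamental_form A (dirac_of_form \<sigma>) N \<nu> p \<Phi> \<Psi> Z = 0"
proof -
  obtain Z' where Z': "normal_extension A N \<nu> p Z Z'"
    using normal_extension_exists[OF T2 \<nu> p Z] .
  obtain X' \<alpha>' where X': "dirac_extension A (dirac_of_form \<sigma>) N \<nu> p \<Phi> X' \<alpha>'"
    using dirac_extension_exists[OF T2 \<sigma> N orth p \<Phi>] .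
  obtain Y' \<beta>' where Y': "dirac_extension A (dirac_of_form \<sigma>) N \<nu> p \<Psi> Y' \<beta>'"
    using dirac_extension_exists[OF T2 \<sigma> N orth p \<Psi>] .
  note eq = second_fundamental_expression_eq_0[OF \<sigma> N orth p]
  show ?thesis
    unfolding second_fundamental_form_def
  proof (rule the_equality)
    show "\<exists>Z' X' \<alpha>' Y' \<beta>'. normal_extension A N \<nu> p Z Z' \<and>
        dirac_extension A (dirac_of_form \<sigma>) N \<nu> p \<Phi> X' \<alpha>' \<and> dirac_extension A (dirac_of_form \<sigma>) N \<nu> p \<Psi> Y' \<beta>' \<and>
        0 = directional_derivative A p Z (\<lambda>q. \<alpha>' q (Y' q))
              - snd \<Phi> (lie_bracket A Z' Y' p) + snd \<Psi> (lie_bracket A Z' X' p)"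
      using Z' X' Y' eq[OF Z' X' Y', symmetric]
      by (intro exI[of _ Z'] exI[of _ X'] exI[of _ \<alpha>'] exI[of _ Y'] exI[of _ \<beta>'] conjI)
  qed (elim exE conjE, simp only: eq)
qed

end

theorem proposition4p3:
  fixes M :: "('a, 'e::euclidean_space) chart set"
    and \<sigma> :: "'a \<Rightarrow> 'e \<Rightarrow> 'e \<Rightarrow> real"
    and N :: "'a set"
  assumes "smooth_manifold M"
    and "presymplectic M \<sigma>"
    and "embedded_submanifold M N"
  shows "totally_dirac M (dirac_of_form \<sigma>) N \<longleftrightarrow>
    (\<exists>\<nu>. normal_bundle M N \<nu> \<and>
         isotropic_submanifold (tangent_bundle M) (dirac_of_form (complete_lift M \<sigma>))
           (total_space N \<nu>))"
proof -
  interpret atlas M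
    using assms(1) by unfold_locales (simp add: smooth_manifold_def)
  have T2: "Hausdorff_space (manifold_topology M)"
    using assms(1) by (simp add: smooth_manifold_def)
  have "totally_dirac M (dirac_of_form \<sigma>) N \<longleftrightarrow> (\<exists>\<nu>. normal_bundle M N \<nu> \<and> conormal \<sigma> N \<nu>)"
    using second_fundamental_form_eq_0[OF T2 assms(2,3)] assms(3)
    unfolding totally_dirac_def properly_normalized_iff[OF assms(2,3)] by blast
  also have "\<dots> \<longleftrightarrow> (\<exists>\<nu>. normal_bundle M N \<nu> \<and>
         isotropic_submanifold (tangent_bundle M) (dirac_of_form (complete_lift M \<sigma>)) (total_space N \<nu>))"
    using isotropic_total_space_iff[OF assms(2,3)] by blast
  finally show ?thesis .
qed

end
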